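(* Let $H\in(0,1/2)$, $T>0$, let $B^H$ be a fractional Brownian motion with Hurst index $H$, let $W$ be a Wiener process independent of $B^H$, let $f:[0,T]\to\mathbb R_+$ be a positive measurable function, and let $g\in AC([0,T])$, $g(t)=\int_0^t g'(s)\,ds$, with $g'\in L_2([0,T])$. Let $g_B'\in L_2([0,T])$ be the unique solution of $$g'(t)-g_B'(t)=\left(K^{H,*}_T\left(K^{H,*}_0 g_B'\right)\right)(t),\qquad t\in[0,T],$$ let $g_B(t)=\int_0^t g_B'(s)\,ds$, $g_W(t)=g(t)-g_B(t)$, and $h(t)=(K^{H,*}_0g_B')(t)$ (so that $g_W'=K^{H,*}_Th$). Then there exist a sequence of real numbers $C_n$, $n\ge1$, and a sequence $c_n$, $n\ge 1$, with $c_n\to0$ as $n\to\infty$, such that for any $\varepsilon>0$ and every $n\ge 1$ $$\mathbb P(A_{T,g,\varepsilon})\le\exp\left\{-\frac12\int_0^T\left((g_W'(t))^2+(h(t))^2\right)dt\right\}\mathbb P(A_{T,0,\varepsilon})+\mathbb P(A_{T,0,\varepsilon})\left(\exp\{\varepsilon C_n+c_n\}-1\right).$$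
   Context: For a trend $g$ and $\varepsilon>0$, $A_{T,g,\varepsilon}=\{|B^H(t)+W(t)+g(t)|\le \varepsilon f(t),\ 0\le t\le T\}$, and $A_{T,0,\varepsilon}$ is this event with $g\equiv0$. A fractional Brownian motion with Hurst index $H$ is a centered Gaussian process with covariance $\frac12(t^{2H}+s^{2H}-|t-s|^{2H})$. With $C_1=\left(\frac{2H\Gamma(H+1/2)\Gamma(3/2-H)}{\Gamma(2-2H)}\right)^{1/2}$, $$(K^{H,*}_0\varphi)(t)=\frac{C_1^{-1}t^{H-1/2}}{\Gamma(1/2-H)}\int_0^t (t-u)^{-1/2-H}u^{1/2-H}\varphi(u)\,du,$$ $$(K^{H,*}_T\varphi)(t)=\frac{C_1^{-1}t^{1/2-H}}{\Gamma(1/2-H)}\int_t^T (u-t)^{-1/2-H}u^{H-1/2}\varphi(u)\,du;$$ both map $L_2([0,T])$ into itself. Equations between elements of $L_2([0,T])$ are understood almost everywhere.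
   Formalization: The fractional Brownian motion B^H is additionally assumed to have almost surely continuous paths on [0,T]; for an arbitrary version (e.g. altered at an independent random time) the inequality can fail. *)

theory Defs
  imports "HOL-Probability.Probability"
begin

section \<open>Gaussian processes, fractional Brownian motion, Wiener process\<close>

text \<open>Point masses count as Gaussian, with variance zero.\<close>

definition gaussian_rv :: "'a measure \<Rightarrow> ('a \<Rightarrow> real) \<Rightarrow> bool" where
  "gaussian_rv M X \<longleftrightarrow> X \<in> borel_measurable M \<and>
     (\<exists>\<mu> \<sigma>. (\<sigma> > 0 \<and> distributed M lborel X (normal_density \<mu> \<sigma>)) \<or>
            (AE \<omega> in M. X \<omega> = \<mu>))"

definition centered_gaussian_process ::
    "'a measure \<Rightarrow> real set \<Rightarrow> (real \<Rightarrow> 'a \<Rightarrow> real) \<Rightarrow> bool" where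
  "centered_gaussian_process M I X \<longleftrightarrow>
     (\<forall>t\<in>I. X t \<in> borel_measurable M) \<and>
     (\<forall>J a. finite J \<and> J \<subseteq> I \<longrightarrow> gaussian_rv M (\<lambda>\<omega>. \<Sum>t\<in>J. a t * X t \<omega>)) \<and>
     (\<forall>t\<in>I. integral\<^sup>L M (X t) = 0)"

definition fractional_brownian_motion ::
    "'a measure \<Rightarrow> real set \<Rightarrow> real \<Rightarrow> (real \<Rightarrow> 'a \<Rightarrow> real) \<Rightarrow> bool" where
  "fractional_brownian_motion M I H B \<longleftrightarrow>
     centered_gaussian_process M I B \<and>
     (\<forall>s\<in>I. \<forall>t\<in>I. (\<integral>\<omega>. B t \<omega> * B s \<omega> \<partial>M) =
        (t powr (2 * H) + s powr (2 * H) - \<bar>t - s\<bar> powr (2 * H)) / 2)"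

definition continuous_paths ::
    "'a measure \<Rightarrow> real set \<Rightarrow> (real \<Rightarrow> 'a \<Rightarrow> real) \<Rightarrow> bool" where
  "continuous_paths M I X \<longleftrightarrow> (AE \<omega> in M. continuous_on I (\<lambda>t. X t \<omega>))"

text \<open>The time set \<open>I\<close> is meant to be an interval with left end point \<open>0\<close>.\<close>

definition wiener_process ::
    "'a measure \<Rightarrow> real set \<Rightarrow> (real \<Rightarrow> 'a \<Rightarrow> real) \<Rightarrow> bool" where
  "wiener_process M I W \<longleftrightarrow>
     (\<forall>t\<in>I. W t \<in> borel_measurable M) \<and>
     (AE \<omega> in M. W 0 \<omega> = 0) \<and>
     (\<forall>s\<in>I. \<forall>t\<in>I. s < t \<longrightarrow>
        distributed M lborel (\<lambda>\<omega>. W t \<omega> - W s \<omega>) (normal_density 0 (sqrt (t - s)))) \<and>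
     (\<forall>n. \<forall>t::nat \<Rightarrow> real. (\<forall>i\<le>n. t i \<in> I) \<and> (\<forall>i<n. t i < t (Suc i)) \<longrightarrow>
        prob_space.indep_vars M (\<lambda>_. borel) (\<lambda>i \<omega>. W (t (Suc i)) \<omega> - W (t i) \<omega>) {..<n}) \<and>
     continuous_paths M I W"

definition independent_processes ::
    "'a measure \<Rightarrow> real set \<Rightarrow> (real \<Rightarrow> 'a \<Rightarrow> real) \<Rightarrow> (real \<Rightarrow> 'a \<Rightarrow> real) \<Rightarrow> bool" where
  "independent_processes M I X Y \<longleftrightarrow>
     prob_space.indep_var M
       (Pi\<^sub>M I (\<lambda>_. borel)) (\<lambda>\<omega>. \<lambda>t\<in>I. X t \<omega>)
       (Pi\<^sub>M I (\<lambda>_. borel)) (\<lambda>\<omega>. \<lambda>t\<in>I. Y t \<omega>)"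


section \<open>Square integrable functions and the operators\<close>

definition L2_on :: "real \<Rightarrow> (real \<Rightarrow> real) \<Rightarrow> bool" where
  "L2_on T \<phi> \<longleftrightarrow> \<phi> \<in> borel_measurable (lebesgue_on {0..T}) \<and>
     integrable (lebesgue_on {0..T}) (\<lambda>t. (\<phi> t)\<^sup>2)"

text \<open>\<open>F\<close> is absolutely continuous on \<open>[0,T]\<close>, vanishes at \<open>0\<close>, and has the square
  integrable derivative \<open>F'\<close>; as an element of \<open>L\<^sub>2\<close>, \<open>F'\<close> is determined by \<open>F\<close>.\<close>

definition AC0_with_L2_derivative :: "real \<Rightarrow> (real \<Rightarrow> real) \<Rightarrow> (real \<Rightarrow> real) \<Rightarrow> bool" where
  "AC0_with_L2_derivative T F F' \<longleftrightarrow> L2_on T F' \<and>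
     (\<forall>t\<in>{0..T}. F t = (\<integral>s. F' s \<partial>lebesgue_on {0..t}))"

definition C1 :: "real \<Rightarrow> real" where
  "C1 H = (2 * H * Gamma (H + 1/2) * Gamma (3/2 - H) / Gamma (2 - 2 * H)) powr (1/2)"

text \<open>For \<open>\<phi>\<close> in \<open>L\<^sub>2\<close> the integrals below converge for almost every \<open>t\<close>. On the
  exceptional null set the Bochner integral is \<open>0\<close> by convention; at the end point \<open>u = t\<close>
  the singular kernel takes the value \<open>0 powr _ = 0\<close>.\<close>

definition K0_star :: "real \<Rightarrow> (real \<Rightarrow> real) \<Rightarrow> real \<Rightarrow> real" where
  "K0_star H \<phi> t = inverse (C1 H) * t powr (H - 1/2) / Gamma (1/2 - H) *
     (\<integral>u. (t - u) powr (- 1/2 - H) * u powr (1/2 - H) * \<phi> u \<partial>lebesgue_on {0..t})"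

definition KT_star :: "real \<Rightarrow> real \<Rightarrow> (real \<Rightarrow> real) \<Rightarrow> real \<Rightarrow> real" where
  "KT_star H T \<phi> t = inverse (C1 H) * t powr (1/2 - H) / Gamma (1/2 - H) *
     (\<integral>u. (u - t) powr (- 1/2 - H) * u powr (H - 1/2) * \<phi> u \<partial>lebesgue_on {t..T})"


section \<open>The small ball event\<close>

definition small_ball_event ::
    "'a measure \<Rightarrow> (real \<Rightarrow> 'a \<Rightarrow> real) \<Rightarrow> (real \<Rightarrow> 'a \<Rightarrow> real) \<Rightarrow> (real \<Rightarrow> real) \<Rightarrow>
     real \<Rightarrow> (real \<Rightarrow> real) \<Rightarrow> real \<Rightarrow> 'a set" where
  "small_ball_event M B W f T g \<epsilon> =
     {\<omega> \<in> space M. \<forall>t\<in>{0..T}. \<bar>B t \<omega> + W t \<omega> + g t\<bar> \<le> \<epsilon> * f t}"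

text \<open>The event involves uncountably many times. Since paths are only required to be
  continuous almost surely, it is measurable in general only for the completion of \<open>M\<close>,
  so that is where its probability is taken. If the event lies in \<open>sets M\<close> (for instance
  if all paths are continuous), this is its probability under \<open>M\<close>.\<close>

definition small_ball_prob ::
    "'a measure \<Rightarrow> (real \<Rightarrow> 'a \<Rightarrow> real) \<Rightarrow> (real \<Rightarrow> 'a \<Rightarrow> real) \<Rightarrow> (real \<Rightarrow> real) \<Rightarrow>
     real \<Rightarrow> (real \<Rightarrow> real) \<Rightarrow> real \<Rightarrow> real" where
  "small_ball_prob M B W f T g \<epsilon> = measure (completion M) (small_ball_event M B W f T g \<epsilon>)"

end

theory Submission
  imports Defs
begin

text \<open>
  Write \<open>X = B + W\<close> and let \<open>l = \<Sum> a t \<cdot> X t\<close> be a finite linear functional with variance \<open>v\<close>. The Cameron-Martin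
  shift along \<open>t \<mapsto> Cov(l, X t)\<close> has density \<open>exp (l - v / 2)\<close>, and on the event in question \<open>l\<close> differs from a
  constant by at most \<open>\<epsilon> \<Sum> \<bar>a t\<bar> f t\<close>; the trend that remains is removed by Anderson's inequality. This gives
  \<open>P(A\<^sub>g) \<le> exp (\<epsilon> C - (l(g) - v / 2)) \<cdot> P(A\<^sub>0)\<close>, so that it suffices to choose \<open>l\<close> with \<open>l(g) - v / 2\<close> close to
  half of the energy \<open>\<parallel>g\<^sub>W'\<parallel>\<^sup>2 + \<parallel>h\<parallel>\<^sup>2\<close>. Only finitely many times matter, since for continuous paths the event is
  determined by countably many of them.

  The functionals are discretizations of \<open>- \<integral> X d\<phi>\<close>, where \<open>\<phi>\<close> is a linear combination of the functions
  \<open>(t (x - t))\<^sup>a\<close> on \<open>[0, x]\<close> with \<open>a = 1/2 - H\<close>. These are multiples of the images of \<open>u\<^sup>a 1\<^sub>[\<^sub>0\<^sub>,\<^sub>x\<^sub>]\<close> under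
  \<open>K\<^sub>T\<^sup>*\<close>, the functions \<open>u\<^sup>a 1\<^sub>[\<^sub>0\<^sub>,\<^sub>x\<^sub>]\<close> span a dense subspace of \<open>L\<^sub>2\<close>, and the covariance structure of \<open>B\<close> on them is
  explicit because \<open>\<integral> (t (x - t))\<^sup>a dB\<close> is a martingale in \<open>x\<close> (Molchan).
\<close>

section \<open>Uniqueness of characteristic functions of random vectors\<close>

text \<open>The operators \<open>K0_star\<close> and \<open>KT_star\<close> are adjoint in L2 of the
  interval: their kernels are \<open>frac_kernel\<close> with its arguments in the two orders. Write
  K for \<open>KT_star\<close>. The equation then says g' = K h + g_B', where h is the adjoint of K
  applied to g_B'. For the functional l built from \<phi> = K P this gives l(g) = <K h, K P> + <h,
  P> and variance ||K P||^2 + ||P||^2, so P = h is optimal and yields exactly half of the energy.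
  Approximating h costs the error c_n, and the weights of the approximating functionals, which need
  not stay bounded, enter C_n. Finite sums rather than integrals of the process are kept to the end
  because f is merely positive and measurable, so that an integral of f against the weights could be
  infinite. Since these functionals miss the optimum, the shift does not cancel g; Anderson's
  inequality lets the remainder be dropped whatever its size, so nothing has to be known about
  it.\<close>

lemma finite_measure_char_unique:
  fixes M N :: "real measure"
  assumes M: "finite_measure M" "sets M = sets borel"
    and N: "finite_measure N" "sets N = sets borel"
    and char_eq: "char M = char N"
  shows "M = N"
proof -
  interpret M: finite_measure M by fact
  interpret N: finite_measure N by fact
  have sp: "space M = UNIV" "space N = UNIV"
    using sets_eq_imp_space_eq[OF M(2)] sets_eq_imp_space_eq[OF N(2)] by auto
  \<comment> \<open>Levy's uniqueness theorem concerns probability measures. The total mass is the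
    value of \<open>char\<close> at 0, so both measures have the same mass \<open>m\<close> and can
    be divided by it unless it vanishes.\<close>
  define m where "m = measure M UNIV"
  have m: "measure N UNIV = m"
  proof -
    have "char M 0 = char N 0" using char_eq by simp
    then show ?thesis by (simp add: char_def m_def sp)
  qed
  show ?thesis
  proof (cases "m = 0")
    case True
    show ?thesis
    proof (rule measure_eqI)
      fix A assume "A \<in> sets M"
      have "emeasure M A \<le> emeasure M UNIV" "emeasure N A \<le> emeasure N UNIV"
        using sp M N by (metis emeasure_space)+
      then show "emeasure M A = emeasure N A"
        using True m by (metis M.emeasure_eq_measure N.emeasure_eq_measure m_def ennreal_0 le_zero_eq sp)
    qed (use M N in simp)
  next
    case False
    then have mpos: "m > 0" by (simp add: m_def zero_less_measure_iff)
    have real_dist: "real_distribution (density K (\<lambda>_. ennreal (1/m)))"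
      if K: "finite_measure K" "sets K = sets borel" "measure K UNIV = m" for K
    proof -
      interpret K: finite_measure K by fact
      have "space K = UNIV" using sets_eq_imp_space_eq[OF K(2)] by simp
      then show ?thesis
        using K mpos by (intro real_distribution.intro prob_spaceI real_distribution_axioms.intro)
          (auto simp: emeasure_density K.emeasure_eq_measure ennreal_mult[symmetric])
    qed
    have char_scale: "char (density K (\<lambda>_. ennreal (1/m))) t = (1/m) * char K t"
      if K: "sets K = sets borel" for K t
    proof -
      have [measurable_cong]: "sets K = sets borel" by fact
      show ?thesis
        unfolding char_def using mpos
        by (subst integral_density) (auto simp: scaleR_conv_of_real)
    qed
    have eq: "density M (\<lambda>_. ennreal (1/m)) = density N (\<lambda>_. ennreal (1/m))"
      by (intro Levy_uniqueness real_dist M N m ext m_def[symmetric]) (simp only: char_scale M N char_eq)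
    have inv: "density (density K (\<lambda>_. ennreal (1/m))) (\<lambda>_. ennreal m) = K" if "sets K = sets borel" for K
      using mpos by (subst density_density_eq) (auto simp: ennreal_mult[symmetric] density_1)
    show ?thesis using inv[OF M(2)] inv[OF N(2)] unfolding eq by (rule trans[OF sym])
  qed
qed

text \<open>Multiplying a measure by the nonnegative density \<open>1 + Re (z e\<^sup>i\<^sup>x)\<close> makes the complex weight
  \<open>e\<^sup>i\<^sup>x\<close> accessible to uniqueness theorems for positive measures.\<close>

definition cis_density :: "complex \<Rightarrow> real \<Rightarrow> real" where
  "cis_density z x = 1 + Re (z * iexp x)"

lemma cis_density_measurable [measurable]: "cis_density z \<in> borel_measurable borel"
  unfolding cis_density_def by measurable

lemma cis_density_bounds:
  assumes "cmod z = 1"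
  shows "0 \<le> cis_density z x" "cis_density z x \<le> 2"
  using abs_Re_le_cmod[of "z * iexp x"] assms by (auto simp: cis_density_def norm_mult)

text \<open>The real part is half the sum of a number and its conjugate, so the weight
  \<open>cis_density\<close> turns one exponential into three. The characteristic function of the
  weighted measure is thereby determined by the joint one.\<close>

lemma cis_density_mult_iexp:
  "complex_of_real (cis_density z x) * iexp y = iexp y + z / 2 * iexp (y + x) + cnj z / 2 * iexp (y - x)"
proof -
  have "complex_of_real (Re (z * iexp x)) = (z * iexp x + cnj (z * iexp x)) / 2"
    by (simp only: complex_add_cnj) simp
  also have "cnj (z * iexp x) = cnj z * iexp (- x)" by (simp add: exp_cnj)
  finally have *: "complex_of_real (cis_density z x) = 1 + (z * iexp x + cnj z * iexp (- x)) / 2"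
    by (simp only: cis_density_def of_real_add of_real_1)
  have **: "iexp (y + x) = iexp y * iexp x" "iexp (y - x) = iexp y * iexp (- x)"
    by (simp_all add: exp_add[symmetric] algebra_simps)
  show ?thesis unfolding * ** by (simp only: algebra_simps add_divide_distrib) simp
qed

lemma (in finite_measure) integrable_iexp_comp:
  "f \<in> borel_measurable M \<Longrightarrow> complex_integrable M (\<lambda>\<omega>. iexp (f \<omega>))"
  by (rule integrable_const_bound[where B=1]) (simp, measurable)

lemma (in finite_measure) finite_measure_distr_cis_density:
  assumes [measurable]: "f \<in> borel_measurable M" "g \<in> borel_measurable M" and z: "cmod z = 1"
  shows "finite_measure (distr (density M (\<lambda>\<omega>. ennreal (cis_density z (f \<omega>)))) borel g)"
proof -
  have "(\<integral>\<^sup>+\<omega>. ennreal (cis_density z (f \<omega>)) \<partial>M) \<le> (\<integral>\<^sup>+\<omega>. ennreal 2 \<partial>M)"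
    by (intro nn_integral_mono ennreal_leI cis_density_bounds z)
  also have "\<dots> < \<infinity>" by (simp add: emeasure_eq_measure ennreal_mult_less_top)
  finally show ?thesis
    by (intro finite_measureI) (auto simp: emeasure_distr emeasure_density)
qed

text \<open>The frequencies 0, 1 and -1 of \<open>f\<close> are spelled out so that the right-hand
  side consists of values of the joint characteristic function of \<open>g\<close> and
  \<open>f\<close>.\<close>

lemma (in finite_measure) char_distr_cis_density:
  assumes [measurable]: "f \<in> borel_measurable M" "g \<in> borel_measurable M" and z: "cmod z = 1"
  shows "char (distr (density M (\<lambda>\<omega>. ennreal (cis_density z (f \<omega>)))) borel g) v =
     (CLINT \<omega>|M. iexp (v * g \<omega> + 0 * f \<omega>)) + z / 2 * (CLINT \<omega>|M. iexp (v * g \<omega> + 1 * f \<omega>))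
       + cnj z / 2 * (CLINT \<omega>|M. iexp (v * g \<omega> + (-1) * f \<omega>))"
proof -
  have "char (distr (density M (\<lambda>\<omega>. ennreal (cis_density z (f \<omega>)))) borel g) v =
      (CLINT \<omega>|M. of_real (cis_density z (f \<omega>)) * iexp (v * g \<omega>))"
    unfolding char_def using cis_density_bounds[OF z]
    by (subst integral_distr) (auto simp: integral_density scaleR_conv_of_real)
  also have "\<dots> = (CLINT \<omega>|M. iexp (v * g \<omega>) + z / 2 * iexp (v * g \<omega> + f \<omega>) + cnj z / 2 * iexp (v * g \<omega> - f \<omega>))"
    by (simp only: cis_density_mult_iexp)
  also have "\<dots> = (CLINT \<omega>|M. iexp (v * g \<omega>)) + (CLINT \<omega>|M. z / 2 * iexp (v * g \<omega> + f \<omega>))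
       + (CLINT \<omega>|M. cnj z / 2 * iexp (v * g \<omega> - f \<omega>))"
  proof -
    have i: "complex_integrable M (\<lambda>\<omega>. iexp (v * g \<omega>))" 
      "complex_integrable M (\<lambda>\<omega>. z / 2 * iexp (v * g \<omega> + f \<omega>))"
      "complex_integrable M (\<lambda>\<omega>. cnj z / 2 * iexp (v * g \<omega> - f \<omega>))"
      by (intro integrable_mult_right integrable_iexp_comp; measurable)+
    show ?thesis
      using Bochner_Integration.integral_add[OF Bochner_Integration.integrable_add[OF i(1,2)] i(3)] 
        Bochner_Integration.integral_add[OF i(1,2)] by (simp only:)
  qed
  also have "\<dots> = (CLINT \<omega>|M. iexp (v * g \<omega>)) + z / 2 * (CLINT \<omega>|M. iexp (v * g \<omega> + f \<omega>))
       + cnj z / 2 * (CLINT \<omega>|M. iexp (v * g \<omega> - f \<omega>))"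
    by (simp only: Bochner_Integration.integral_mult_right_zero)
  finally show ?thesis by simp
qed

lemma (in finite_measure) integral_indicator_cis_density:
  assumes [measurable]: "f \<in> borel_measurable M" "g \<in> borel_measurable M" "A \<in> sets borel"
    and z: "cmod z = 1"
  shows "measure (distr (density M (\<lambda>\<omega>. ennreal (cis_density z (f \<omega>)))) borel g) A
     = measure (distr M borel g) A + Re (z * (CLINT \<omega>|M. indicator A (g \<omega>) * iexp (f \<omega>)))"
proof -
  have int: "complex_integrable M (\<lambda>\<omega>. indicator A (g \<omega>) * iexp (f \<omega>))"
    by (rule integrable_const_bound[where B=1]) (auto simp: indicator_def norm_mult)
  have "measure (distr (density M (\<lambda>\<omega>. ennreal (cis_density z (f \<omega>)))) borel g) A
    = (LINT x|distr (density M (\<lambda>\<omega>. ennreal (cis_density z (f \<omega>)))) borel g. indicator A x)"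
    by simp
  also have "\<dots> = (LINT \<omega>|M. cis_density z (f \<omega>) * indicator A (g \<omega>))"
    using cis_density_bounds[OF z] by (subst integral_distr) (auto simp: integral_density)
  also have "\<dots> = (LINT \<omega>|M. indicator A (g \<omega>) + Re (z * (indicator A (g \<omega>) * iexp (f \<omega>))))"
    by (intro Bochner_Integration.integral_cong) (auto simp: cis_density_def indicator_def)
  also have "\<dots> = (LINT \<omega>|M. indicator A (g \<omega>)) + (LINT \<omega>|M. Re (z * (indicator A (g \<omega>) * iexp (f \<omega>))))"
  proof (intro Bochner_Integration.integral_add)
    show "integrable M (\<lambda>\<omega>. indicator A (g \<omega>) :: real)"
      by (rule integrable_const_bound[where B=1]) (auto simp: indicator_def)
    show "integrable M (\<lambda>\<omega>. Re (z * (indicator A (g \<omega>) * iexp (f \<omega>))))"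
      using int by (intro integrable_Re integrable_mult_right)
  qed
  also have "(LINT \<omega>|M. Re (z * (indicator A (g \<omega>) * iexp (f \<omega>)))) = Re (CLINT \<omega>|M. z * (indicator A (g \<omega>) * iexp (f \<omega>)))"
    using int by (intro integral_Re integrable_mult_right)
  also have "(LINT \<omega>|M. indicator A (g \<omega>)) = (LINT x|distr M borel g. indicator A x :: real)"
    by (subst integral_distr) auto
  finally show ?thesis by (simp only: Bochner_Integration.integral_mult_right_zero) simp
qed

text \<open>One coordinate is taken out of the exponent and replaced by an indicator. The measures
  weighted by \<open>cis_density\<close> have equal characteristic functions, hence agree on the
  event, for every unimodular \<open>z\<close>.\<close>

lemma integral_indicator_iexp_eq:
  fixes X s :: "'a \<Rightarrow> real" and Y r :: "'b \<Rightarrow> real"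
  assumes "finite_measure M" "finite_measure N"
    and [measurable]: "X \<in> borel_measurable M" "s \<in> borel_measurable M"
      "Y \<in> borel_measurable N" "r \<in> borel_measurable N" "A \<in> sets borel"
    and eq: "\<And>v w. (CLINT \<omega>|M. iexp (v * X \<omega> + w * s \<omega>)) = (CLINT \<omega>|N. iexp (v * Y \<omega> + w * r \<omega>))"
  shows "(CLINT \<omega>|M. indicator A (X \<omega>) * iexp (s \<omega>)) = (CLINT \<omega>|N. indicator A (Y \<omega>) * iexp (r \<omega>))"
proof -
  interpret M: finite_measure M by fact
  interpret N: finite_measure N by fact
  have meas_eq: "distr (density M (\<lambda>\<omega>. ennreal (cis_density z (s \<omega>)))) borel X
      = distr (density N (\<lambda>\<omega>. ennreal (cis_density z (r \<omega>)))) borel Y"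
    if z: "cmod z = 1" for z
  proof (rule finite_measure_char_unique)
    show "char (distr (density M (\<lambda>\<omega>. ennreal (cis_density z (s \<omega>)))) borel X)
      = char (distr (density N (\<lambda>\<omega>. ennreal (cis_density z (r \<omega>)))) borel Y)"
      by (rule ext) (simp only: M.char_distr_cis_density[OF assms(4,3) z]
            N.char_distr_cis_density[OF assms(6,5) z] eq)
  qed (use z in \<open>auto intro!: M.finite_measure_distr_cis_density N.finite_measure_distr_cis_density\<close>)
  have meas_eq0: "distr M borel X = distr N borel Y"
  proof (rule finite_measure_char_unique)
    have "char (distr M borel X) v = char (distr N borel Y) v" for v
      using eq[of v 0] unfolding char_def by (simp add: integral_distr)
    then show "char (distr M borel X) = char (distr N borel Y)" ..
  qed (auto intro: M.finite_measure_distr N.finite_measure_distr)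
  have Re_eq: "Re (z * (CLINT \<omega>|M. indicator A (X \<omega>) * iexp (s \<omega>)))
      = Re (z * (CLINT \<omega>|N. indicator A (Y \<omega>) * iexp (r \<omega>)))"
    if z: "cmod z = 1" for z
    using M.integral_indicator_cis_density[OF assms(4,3,7) z]
      N.integral_indicator_cis_density[OF assms(6,5,7) z] meas_eq[OF z] meas_eq0 by simp
  show ?thesis
    \<comment> \<open>\<open>z = 1\<close> gives the real part of the integral and
      \<open>z = -\<i>\<close> the imaginary part.\<close>
    by (rule complex_eqI) (use Re_eq[of 1] Re_eq[of "-\<i>"] in auto)
qed

text \<open>Induction on the coordinates: both measures are restricted to the event for one
  coordinate, and \<open>integral_indicator_iexp_eq\<close> carries the hypothesis over to the
  restrictions. These need not have mass one, which is why finite measures are treated instead of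
  probability measures.\<close>

lemma emeasure_events_eq_of_iexp:
  fixes X :: "'i \<Rightarrow> 'a \<Rightarrow> real" and Y :: "'i \<Rightarrow> 'b \<Rightarrow> real"
  assumes "finite J" "finite_measure M" "finite_measure N"
    and "\<And>j. j \<in> J \<Longrightarrow> X j \<in> borel_measurable M" "\<And>j. j \<in> J \<Longrightarrow> Y j \<in> borel_measurable N"
    and "\<And>u. (CLINT \<omega>|M. iexp (\<Sum>j\<in>J. u j * X j \<omega>)) = (CLINT \<omega>|N. iexp (\<Sum>j\<in>J. u j * Y j \<omega>))"
    and "\<And>j. j \<in> J \<Longrightarrow> A j \<in> sets borel"
  shows "emeasure M {\<omega>\<in>space M. \<forall>j\<in>J. X j \<omega> \<in> A j} = emeasure N {\<omega>\<in>space N. \<forall>j\<in>J. Y j \<omega> \<in> A j}"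
  using assms
proof (induction J arbitrary: M N rule: finite_induct)
  case empty
  interpret M: finite_measure M by fact
  interpret N: finite_measure N by fact
  \<comment> \<open>The empty sum is 0, so the hypothesis compares the total masses.\<close>
  show ?case using empty(5)[of undefined] by (simp add: M.emeasure_eq_measure N.emeasure_eq_measure)
next
  case (insert i J)
  interpret M: finite_measure M by fact
  interpret N: finite_measure N by fact
  note [measurable] = insert.prems(3,4,6) insert.hyps(1)
  define M' where "M' = density M (\<lambda>\<omega>. indicator (A i) (X i \<omega>))"
  define N' where "N' = density N (\<lambda>\<omega>. indicator (A i) (Y i \<omega>))"
  have [measurable_cong]: "sets M' = sets M" "sets N' = sets N" by (auto simp: M'_def N'_def)
  have fin: "finite_measure M'" "finite_measure N'"
  proof -
    have "(\<integral>\<^sup>+\<omega>. indicator (A i) (X i \<omega>) \<partial>M) \<le> (\<integral>\<^sup>+\<omega>. 1 \<partial>M)"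
      "(\<integral>\<^sup>+\<omega>. indicator (A i) (Y i \<omega>) \<partial>N) \<le> (\<integral>\<^sup>+\<omega>. 1 \<partial>N)"
      by (intro nn_integral_mono; simp add: indicator_def)+
    then show "finite_measure M'" "finite_measure N'" unfolding M'_def N'_def
      by (auto intro!: finite_measureI simp: emeasure_density M.emeasure_eq_measure N.emeasure_eq_measure top_unique)
  qed
  have "emeasure M' {\<omega>\<in>space M'. \<forall>j\<in>J. X j \<omega> \<in> A j} = emeasure N' {\<omega>\<in>space N'. \<forall>j\<in>J. Y j \<omega> \<in> A j}"
  proof (rule insert.IH)
    fix u
    have "(CLINT \<omega>|M. indicator (A i) (X i \<omega>) * iexp (\<Sum>j\<in>J. u j * X j \<omega>))
      = (CLINT \<omega>|N. indicator (A i) (Y i \<omega>) * iexp (\<Sum>j\<in>J. u j * Y j \<omega>))"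
    proof (rule integral_indicator_iexp_eq)
      fix v w
      have *: "v * x i + w * (\<Sum>j\<in>J. u j * x j) = (\<Sum>j\<in>insert i J. (if j = i then v else w * u j) * x j)" for x
        using insert.hyps by (simp add: sum_distrib_left mult.assoc) (intro sum.cong, auto)
      show "(CLINT \<omega>|M. iexp (v * X i \<omega> + w * (\<Sum>j\<in>J. u j * X j \<omega>)))
        = (CLINT \<omega>|N. iexp (v * Y i \<omega> + w * (\<Sum>j\<in>J. u j * Y j \<omega>)))"
        using insert.prems(5)[of "\<lambda>j. if j = i then v else w * u j"] *[of "\<lambda>j. X j _"] *[of "\<lambda>j. Y j _"]
        by (simp only:)
    qed (auto intro: M.finite_measure_axioms N.finite_measure_axioms insert.prems)
    moreover have "(CLINT \<omega>|M'. iexp (\<Sum>j\<in>J. u j * X j \<omega>)) = (CLINT \<omega>|M. indicator (A i) (X i \<omega>) * iexp (\<Sum>j\<in>J. u j * X j \<omega>))"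
      "(CLINT \<omega>|N'. iexp (\<Sum>j\<in>J. u j * Y j \<omega>)) = (CLINT \<omega>|N. indicator (A i) (Y i \<omega>) * iexp (\<Sum>j\<in>J. u j * Y j \<omega>))"
    proof -
      have ind: "(indicator (A i) x :: ennreal) = ennreal (indicator (A i) x)" for x by (simp add: indicator_def)
      show "(CLINT \<omega>|M'. iexp (\<Sum>j\<in>J. u j * X j \<omega>)) = (CLINT \<omega>|M. indicator (A i) (X i \<omega>) * iexp (\<Sum>j\<in>J. u j * X j \<omega>))"
        unfolding M'_def ind by (subst integral_density) (auto intro!: Bochner_Integration.integral_cong simp: indicator_def)
      show "(CLINT \<omega>|N'. iexp (\<Sum>j\<in>J. u j * Y j \<omega>)) = (CLINT \<omega>|N. indicator (A i) (Y i \<omega>) * iexp (\<Sum>j\<in>J. u j * Y j \<omega>))"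
        unfolding N'_def ind by (subst integral_density) (auto intro!: Bochner_Integration.integral_cong simp: indicator_def)
    qed
    ultimately show "(CLINT \<omega>|M'. iexp (\<Sum>j\<in>J. u j * X j \<omega>)) = (CLINT \<omega>|N'. iexp (\<Sum>j\<in>J. u j * Y j \<omega>))" by simp
  qed (use fin insert.prems in auto)
  moreover have "emeasure M' {\<omega>\<in>space M'. \<forall>j\<in>J. X j \<omega> \<in> A j} = emeasure M {\<omega>\<in>space M. \<forall>j\<in>insert i J. X j \<omega> \<in> A j}"
  proof -
    have "emeasure M' {\<omega>\<in>space M'. \<forall>j\<in>J. X j \<omega> \<in> A j}
      = (\<integral>\<^sup>+\<omega>. indicator (A i) (X i \<omega>) * indicator {\<omega>\<in>space M. \<forall>j\<in>J. X j \<omega> \<in> A j} \<omega> \<partial>M)"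
      unfolding M'_def by (subst emeasure_density) auto
    also have "\<dots> = (\<integral>\<^sup>+\<omega>. indicator {\<omega>\<in>space M. \<forall>j\<in>insert i J. X j \<omega> \<in> A j} \<omega> \<partial>M)"
      by (intro nn_integral_cong) (auto simp: indicator_def)
    finally show ?thesis by simp
  qed
  moreover have "emeasure N' {\<omega>\<in>space N'. \<forall>j\<in>J. Y j \<omega> \<in> A j} = emeasure N {\<omega>\<in>space N. \<forall>j\<in>insert i J. Y j \<omega> \<in> A j}"
  proof -
    have "emeasure N' {\<omega>\<in>space N'. \<forall>j\<in>J. Y j \<omega> \<in> A j}
      = (\<integral>\<^sup>+\<omega>. indicator (A i) (Y i \<omega>) * indicator {\<omega>\<in>space N. \<forall>j\<in>J. Y j \<omega> \<in> A j} \<omega> \<partial>N)"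
      unfolding N'_def by (subst emeasure_density) auto
    also have "\<dots> = (\<integral>\<^sup>+\<omega>. indicator {\<omega>\<in>space N. \<forall>j\<in>insert i J. Y j \<omega> \<in> A j} \<omega> \<partial>N)"
      by (intro nn_integral_cong) (auto simp: indicator_def)
    finally show ?thesis by simp
  qed
  ultimately show ?case by simp
qed

text \<open>Boxes form an intersection-stable generator of the product sigma-algebra, so agreement
  on them suffices.\<close>

lemma distr_PiM_eq_of_iexp:
  fixes X :: "'i \<Rightarrow> 'a \<Rightarrow> real" and Y :: "'i \<Rightarrow> 'b \<Rightarrow> real"
  assumes J: "finite J" and "finite_measure M" "finite_measure N"
    and X: "\<And>j. j \<in> J \<Longrightarrow> X j \<in> borel_measurable M" and Y: "\<And>j. j \<in> J \<Longrightarrow> Y j \<in> borel_measurable N"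
    and eq: "\<And>u. (CLINT \<omega>|M. iexp (\<Sum>j\<in>J. u j * X j \<omega>)) = (CLINT \<omega>|N. iexp (\<Sum>j\<in>J. u j * Y j \<omega>))"
  shows "distr M (Pi\<^sub>M J (\<lambda>_. borel)) (\<lambda>\<omega>. \<lambda>j\<in>J. X j \<omega>) = distr N (Pi\<^sub>M J (\<lambda>_. borel)) (\<lambda>\<omega>. \<lambda>j\<in>J. Y j \<omega>)"
proof -
  interpret M: finite_measure M by fact
  interpret N: finite_measure N by fact
  note [measurable] = X Y
  have mX: "(\<lambda>\<omega>. \<lambda>j\<in>J. X j \<omega>) \<in> M \<rightarrow>\<^sub>M Pi\<^sub>M J (\<lambda>_. borel)" "(\<lambda>\<omega>. \<lambda>j\<in>J. Y j \<omega>) \<in> N \<rightarrow>\<^sub>M Pi\<^sub>M J (\<lambda>_. borel)"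
    by (intro measurable_restrict X Y; assumption)+
  have rect: "emeasure (distr M (Pi\<^sub>M J (\<lambda>_. borel)) (\<lambda>\<omega>. \<lambda>j\<in>J. X j \<omega>)) (Pi\<^sub>E J A) =
      emeasure (distr N (Pi\<^sub>M J (\<lambda>_. borel)) (\<lambda>\<omega>. \<lambda>j\<in>J. Y j \<omega>)) (Pi\<^sub>E J A)"
    if A: "\<And>j. j \<in> J \<Longrightarrow> A j \<in> sets borel" for A
  proof -
    have "Pi\<^sub>E J A \<in> sets (Pi\<^sub>M J (\<lambda>_. borel))" using J A by (intro sets_PiM_I_finite) auto
    moreover have "(\<lambda>\<omega>. \<lambda>j\<in>J. X j \<omega>) -` (Pi\<^sub>E J A) \<inter> space M = {\<omega>\<in>space M. \<forall>j\<in>J. X j \<omega> \<in> A j}"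
      "(\<lambda>\<omega>. \<lambda>j\<in>J. Y j \<omega>) -` (Pi\<^sub>E J A) \<inter> space N = {\<omega>\<in>space N. \<forall>j\<in>J. Y j \<omega> \<in> A j}"
      by (auto simp: PiE_iff)
    ultimately show ?thesis
      using emeasure_events_eq_of_iexp[OF J assms(2,3) X Y eq A] by (simp add: emeasure_distr mX)
  qed
  show ?thesis
  proof (rule measure_eqI_PiM_finite[OF J, where A="\<lambda>_. \<Pi>\<^sub>E j\<in>J. UNIV" and M="\<lambda>_. borel"])
    show "emeasure (distr M (Pi\<^sub>M J (\<lambda>_. borel)) (\<lambda>\<omega>. \<lambda>j\<in>J. X j \<omega>)) (Pi\<^sub>E J (\<lambda>_. UNIV)) \<noteq> \<infinity>"
      using finite_measure.emeasure_finite[OF M.finite_measure_distr[OF mX(1)]] by simp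
  qed (use J in \<open>auto simp: rect space_PiM intro!: prod_algebraI_finite\<close>)
qed

section \<open>Product Gaussian measures\<close>

definition gauss :: "'i set \<Rightarrow> ('i \<Rightarrow> real) measure" where
  "gauss J = Pi\<^sub>M J (\<lambda>_. std_normal_distribution)"

lemma std_normal_prob_space: "prob_space std_normal_distribution"
  by (rule prob_space_normal_density) simp

lemma sets_gauss [measurable_cong]: "sets (gauss J) = sets (Pi\<^sub>M J (\<lambda>_. borel))"
  unfolding gauss_def by (intro sets_PiM_cong) auto

lemma space_gauss: "space (gauss J) = extensional J"
  by (simp add: gauss_def space_PiM PiE_UNIV_domain) (simp add: PiE_def)

lemma product_prob_space_std_normal: "product_prob_space (\<lambda>_. std_normal_distribution)"
  by (intro product_prob_spaceI std_normal_prob_space)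

lemma prob_space_gauss: "prob_space (gauss J)"
  unfolding gauss_def by (intro prob_space_PiM std_normal_prob_space)

lemma product_sigma_finite_std_normal: "product_sigma_finite (\<lambda>_. std_normal_distribution)"
  using product_prob_space_std_normal by (rule product_prob_space.axioms)

lemma integral_gauss_iexp:
  assumes J: "finite J"
  shows "(CLINT z|gauss J. iexp (\<Sum>j\<in>J. u j * z j)) = exp (- (\<Sum>j\<in>J. (u j)\<^sup>2) / 2)"
proof -
  interpret product_sigma_finite "\<lambda>_. std_normal_distribution" by (rule product_sigma_finite_std_normal)
  interpret N: real_distribution std_normal_distribution by (rule real_dist_normal_dist)
  have "(CLINT z|gauss J. iexp (\<Sum>j\<in>J. u j * z j)) = (CLINT z|gauss J. (\<Prod>j\<in>J. iexp (u j * z j)))"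
    by (simp add: exp_sum[OF J, symmetric] sum_distrib_left)
  also have "\<dots> = (\<Prod>j\<in>J. (CLINT x|std_normal_distribution. iexp (u j * x)))"
    unfolding gauss_def
    by (rule product_integral_prod[OF J]) (rule N.integrable_iexp_comp, measurable)
  also have "\<dots> = (\<Prod>j\<in>J. complex_of_real (exp (- ((u j)\<^sup>2) / 2)))"
    using char_std_normal_distribution by (intro prod.cong refl) (simp add: char_def fun_eq_iff)
  also have "\<dots> = complex_of_real (exp (- (\<Sum>j\<in>J. (u j)\<^sup>2) / 2))"
    by (simp only: of_real_prod[symmetric] exp_sum[OF J, symmetric] sum_negf sum_divide_distrib[symmetric])
  finally show ?thesis .
qed

lemma nn_integral_gauss_insert:
  assumes "finite J" "i \<notin> J" and [measurable]: "f \<in> borel_measurable (Pi\<^sub>M (insert i J) (\<lambda>_. borel))"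
  shows "(\<integral>\<^sup>+z. f z \<partial>gauss (insert i J)) = (\<integral>\<^sup>+x. (\<integral>\<^sup>+y. f (x(i := y)) \<partial>std_normal_distribution) \<partial>gauss J)"
    and "(\<integral>\<^sup>+z. f z \<partial>gauss (insert i J)) = (\<integral>\<^sup>+y. (\<integral>\<^sup>+x. f (x(i := y)) \<partial>gauss J) \<partial>std_normal_distribution)"
proof -
  interpret product_sigma_finite "\<lambda>_. std_normal_distribution" by (rule product_sigma_finite_std_normal)
  have f: "f \<in> borel_measurable (Pi\<^sub>M (insert i J) (\<lambda>_. std_normal_distribution))"
    using assms(3) sets_gauss[of "insert i J"] by (simp add: gauss_def cong: measurable_cong_sets)
  show "(\<integral>\<^sup>+z. f z \<partial>gauss (insert i J)) = (\<integral>\<^sup>+x. (\<integral>\<^sup>+y. f (x(i := y)) \<partial>std_normal_distribution) \<partial>gauss J)"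
    unfolding gauss_def by (rule product_nn_integral_insert[OF assms(1,2) f])
  show "(\<integral>\<^sup>+z. f z \<partial>gauss (insert i J)) = (\<integral>\<^sup>+y. (\<integral>\<^sup>+x. f (x(i := y)) \<partial>gauss J) \<partial>std_normal_distribution)"
    unfolding gauss_def by (rule product_nn_integral_insert_rev[OF assms(1,2) f])
qed

lemma nn_integral_std_normal:
  "f \<in> borel_measurable borel \<Longrightarrow> (\<integral>\<^sup>+x. f x \<partial>std_normal_distribution) = (\<integral>\<^sup>+x. ennreal (std_normal_density x) * f x \<partial>lborel)"
  by (subst nn_integral_density) auto

lemma nn_integral_std_normal_shift:
  assumes [measurable]: "h \<in> borel_measurable borel"
  shows "(\<integral>\<^sup>+x. h (x + b) \<partial>std_normal_distribution) = (\<integral>\<^sup>+x. h x * ennreal (exp (b * x - b\<^sup>2 / 2)) \<partial>std_normal_distribution)"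
proof -
  have "(\<integral>\<^sup>+x. h (x + b) \<partial>std_normal_distribution) = (\<integral>\<^sup>+x. ennreal (std_normal_density x) * h (x + b) \<partial>lborel)"
    by (rule nn_integral_std_normal) measurable
  also have "\<dots> = (\<integral>\<^sup>+x. ennreal (std_normal_density (x - b)) * h x \<partial>lborel)"
    using nn_integral_real_affine[of "\<lambda>x. ennreal (std_normal_density (x - b)) * h x" 1 b]
    by (simp add: add.commute)
  also have "\<dots> = (\<integral>\<^sup>+x. ennreal (std_normal_density x) * (h x * ennreal (exp (b * x - b\<^sup>2 / 2))) \<partial>lborel)"
  proof (intro nn_integral_cong)
    fix x
    have "- (x - b)\<^sup>2 / 2 = - x\<^sup>2 / 2 + (b * x - b\<^sup>2 / 2)"
      by (simp add: power2_eq_square field_simps)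
    then have "std_normal_density (x - b) = std_normal_density x * exp (b * x - b\<^sup>2 / 2)"
      unfolding std_normal_density_def by (simp add: exp_add[symmetric])
    then show "ennreal (std_normal_density (x - b)) * h x = ennreal (std_normal_density x) * (h x * ennreal (exp (b * x - b\<^sup>2 / 2)))"
      by (simp add: ennreal_mult mult_ac)
  qed
  also have "\<dots> = (\<integral>\<^sup>+x. h x * ennreal (exp (b * x - b\<^sup>2 / 2)) \<partial>std_normal_distribution)"
    by (rule nn_integral_std_normal[symmetric]) measurable
  finally show ?thesis .
qed

lemma measurable_map_PiM:
  assumes [measurable]: "\<And>j. j \<in> J \<Longrightarrow> T j \<in> borel_measurable borel"
  shows "(\<lambda>z. \<lambda>j\<in>J. T j (z j :: real) :: real) \<in> Pi\<^sub>M J (\<lambda>_. borel) \<rightarrow>\<^sub>M Pi\<^sub>M J (\<lambda>_. borel)"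
  by (intro measurable_restrict) measurable

lemma restrict_fun_upd_insert:
  "i \<notin> J \<Longrightarrow> (\<lambda>j\<in>insert i J. T j ((x(i := y)) j)) = (\<lambda>j\<in>J. T j (x j))(i := T i y)"
  by (auto simp: fun_eq_iff)

text \<open>A one-dimensional inequality tensorizes by Fubini, one coordinate at a time. The set
  \<open>D\<close> localizes it: the inequality is required only for functions vanishing off
  \<open>D\<close>. Translations use the whole line, the crude scaling estimate of
  \<open>gauss_diff_base\<close> a bounded interval.\<close>

lemma nn_integral_gauss_map_le:
  fixes S T :: "'i \<Rightarrow> real \<Rightarrow> real" and w :: "'i \<Rightarrow> real \<Rightarrow> ennreal"
  assumes "finite J"
    and [measurable]: "\<And>j. j \<in> J \<Longrightarrow> S j \<in> borel_measurable borel" "\<And>j. j \<in> J \<Longrightarrow> T j \<in> borel_measurable borel"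
      "\<And>j. j \<in> J \<Longrightarrow> w j \<in> borel_measurable borel"
    and "\<And>j h. j \<in> J \<Longrightarrow> h \<in> borel_measurable borel \<Longrightarrow> (\<And>x. x \<notin> D \<Longrightarrow> h x = 0) \<Longrightarrow>
      (\<integral>\<^sup>+x. h (S j x) \<partial>std_normal_distribution) \<le> (\<integral>\<^sup>+x. h (T j x) * w j x \<partial>std_normal_distribution)"
    and "f \<in> borel_measurable (Pi\<^sub>M J (\<lambda>_. borel))"
    and "\<And>z j. j \<in> J \<Longrightarrow> z j \<notin> D \<Longrightarrow> f z = 0"
  shows "(\<integral>\<^sup>+z. f (\<lambda>j\<in>J. S j (z j)) \<partial>gauss J) \<le> (\<integral>\<^sup>+z. f (\<lambda>j\<in>J. T j (z j)) * (\<Prod>j\<in>J. w j (z j)) \<partial>gauss J)"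
  using assms
proof (induction J arbitrary: f rule: finite_induct)
  case empty
  then show ?case by simp
next
  case (insert i J)
  note [measurable] = insert.prems(1-3,5)
  have ST: "(\<lambda>z. \<lambda>j\<in>insert i J. S j (z j)) \<in> Pi\<^sub>M (insert i J) (\<lambda>_. borel) \<rightarrow>\<^sub>M Pi\<^sub>M (insert i J) (\<lambda>_. borel)"
    "(\<lambda>z. \<lambda>j\<in>insert i J. T j (z j)) \<in> Pi\<^sub>M (insert i J) (\<lambda>_. borel) \<rightarrow>\<^sub>M Pi\<^sub>M (insert i J) (\<lambda>_. borel)"
    "(\<lambda>z. \<lambda>j\<in>J. S j (z j)) \<in> Pi\<^sub>M J (\<lambda>_. borel) \<rightarrow>\<^sub>M Pi\<^sub>M J (\<lambda>_. borel)"
    "(\<lambda>z. \<lambda>j\<in>J. T j (z j)) \<in> Pi\<^sub>M J (\<lambda>_. borel) \<rightarrow>\<^sub>M Pi\<^sub>M J (\<lambda>_. borel)"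
    by (rule measurable_map_PiM; use insert.prems(1,2) in simp)+
  note [measurable] = ST
  have upd [measurable]: "(\<lambda>p. (fst p)(i := snd p)) \<in> Pi\<^sub>M J (\<lambda>_. borel) \<Otimes>\<^sub>M borel \<rightarrow>\<^sub>M Pi\<^sub>M (insert i J) (\<lambda>_. borel)"
    using measurable_add_dim[of i J "\<lambda>_. borel"] by (simp add: split_beta')
  have fu: "(\<lambda>p. f ((fst p)(i := snd p))) \<in> borel_measurable (Pi\<^sub>M J (\<lambda>_. borel) \<Otimes>\<^sub>M borel)" by measurable
  have fx: "(\<lambda>y. f (x(i := y))) \<in> borel_measurable borel" if "x \<in> extensional J" for x
    by (rule measurable_compose[OF measurable_component_update insert.prems(5)])
      (use that insert.hyps in \<open>auto simp: space_PiM PiE_def\<close>)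
  have fy: "(\<lambda>x. f (x(i := y))) \<in> borel_measurable (Pi\<^sub>M J (\<lambda>_. borel))" for y
    using measurable_compose[OF measurable_Pair2', OF _ fu, of y] by simp
  interpret N: prob_space std_normal_distribution by (rule std_normal_prob_space)
  interpret G: prob_space "gauss J" by (rule prob_space_gauss)
  interpret GN: pair_sigma_finite "gauss J" std_normal_distribution ..
  have "(\<integral>\<^sup>+z. f (\<lambda>j\<in>insert i J. S j (z j)) \<partial>gauss (insert i J))
    = (\<integral>\<^sup>+x. (\<integral>\<^sup>+y. f (\<lambda>j\<in>insert i J. S j ((x(i := y)) j)) \<partial>std_normal_distribution) \<partial>gauss J)"
    by (rule nn_integral_gauss_insert) (use insert.hyps in \<open>auto intro!: measurable_compose[OF ST(1)]\<close>)
  also have "\<dots> = (\<integral>\<^sup>+x. (\<integral>\<^sup>+y. f ((\<lambda>j\<in>J. S j (x j))(i := S i y)) \<partial>std_normal_distribution) \<partial>gauss J)"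
    by (simp only: restrict_fun_upd_insert[OF insert.hyps(2)])
  also have "\<dots> \<le> (\<integral>\<^sup>+x. (\<integral>\<^sup>+y. f ((\<lambda>j\<in>J. S j (x j))(i := T i y)) * w i y \<partial>std_normal_distribution) \<partial>gauss J)"
  proof (rule nn_integral_mono)
    fix x
    show "(\<integral>\<^sup>+y. f ((\<lambda>j\<in>J. S j (x j))(i := S i y)) \<partial>std_normal_distribution)
      \<le> (\<integral>\<^sup>+y. f ((\<lambda>j\<in>J. S j (x j))(i := T i y)) * w i y \<partial>std_normal_distribution)"
      by (rule insert.prems(4)[of i "\<lambda>y. f ((\<lambda>j\<in>J. S j (x j))(i := y))"])
        (use insert.prems(6)[of i] fx[of "\<lambda>j\<in>J. S j (x j)"] in auto)
  qed
  also have "\<dots> = (\<integral>\<^sup>+y. (\<integral>\<^sup>+x. f ((\<lambda>j\<in>J. S j (x j))(i := T i y)) * w i y \<partial>gauss J) \<partial>std_normal_distribution)"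
  proof (rule GN.Fubini'[symmetric])
    have "(\<lambda>p. f ((\<lambda>j\<in>J. S j ((fst p) j))(i := T i (snd p))) * w i (snd p)) \<in> borel_measurable (Pi\<^sub>M J (\<lambda>_. borel) \<Otimes>\<^sub>M borel)"
      using measurable_compose[OF _ fu, of "\<lambda>p. (\<lambda>j\<in>J. S j ((fst p) j), T i (snd p))"] by measurable
    then show "(\<lambda>(x, y). f ((\<lambda>j\<in>J. S j (x j))(i := T i y)) * w i y) \<in> borel_measurable (gauss J \<Otimes>\<^sub>M std_normal_distribution)"
      by (simp add: split_beta' cong: measurable_cong_sets)
  qed
  also have "\<dots> = (\<integral>\<^sup>+y. (\<integral>\<^sup>+x. f ((\<lambda>j\<in>J. S j (x j))(i := T i y)) \<partial>gauss J) * w i y \<partial>std_normal_distribution)"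
    by (intro nn_integral_cong nn_integral_multc measurable_compose[OF ST(3) fy, unfolded measurable_cong_sets[OF sets_gauss[symmetric] refl]])
  also have "\<dots> \<le> (\<integral>\<^sup>+y. (\<integral>\<^sup>+x. f ((\<lambda>j\<in>J. T j (x j))(i := T i y)) * (\<Prod>j\<in>J. w j (x j)) \<partial>gauss J) * w i y \<partial>std_normal_distribution)"
  proof (rule nn_integral_mono, rule mult_right_mono)
    fix y show "(\<integral>\<^sup>+x. f ((\<lambda>j\<in>J. S j (x j))(i := T i y)) \<partial>gauss J) \<le> (\<integral>\<^sup>+x. f ((\<lambda>j\<in>J. T j (x j))(i := T i y)) * (\<Prod>j\<in>J. w j (x j)) \<partial>gauss J)"
    proof (rule insert.IH)
      show "f (z(i := T i y)) = 0" if "j \<in> J" "z j \<notin> D" for z j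
        using that insert.hyps by (intro insert.prems(6)[of j]) auto
    qed (rule fy | (use insert.prems(1-4) in blast))+
  qed simp
  also have "\<dots> = (\<integral>\<^sup>+y. (\<integral>\<^sup>+x. f (\<lambda>j\<in>insert i J. T j ((x(i := y)) j)) * (\<Prod>j\<in>insert i J. w j ((x(i := y)) j)) \<partial>gauss J) \<partial>std_normal_distribution)"
  proof (intro nn_integral_cong)
    fix y
    have p: "(\<Prod>j\<in>insert i J. w j ((x(i := y)) j)) = (\<Prod>j\<in>J. w j (x j)) * w i y" for x
      using insert.hyps by (simp add: mult.commute cong: prod.cong) (intro prod.cong arg_cong2[where f="(*)"], auto)
    have "(\<lambda>x. f ((\<lambda>j\<in>J. T j (x j))(i := T i y)) * (\<Prod>j\<in>J. w j (x j))) \<in> borel_measurable (Pi\<^sub>M J (\<lambda>_. borel))"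
      using measurable_compose[OF ST(4) fy] by measurable
    then have "(\<lambda>x. f ((\<lambda>j\<in>J. T j (x j))(i := T i y)) * (\<Prod>j\<in>J. w j (x j))) \<in> borel_measurable (gauss J)"
      by (simp cong: measurable_cong_sets)
    then show "(\<integral>\<^sup>+x. f ((\<lambda>j\<in>J. T j (x j))(i := T i y)) * (\<Prod>j\<in>J. w j (x j)) \<partial>gauss J) * w i y
      = (\<integral>\<^sup>+x. f (\<lambda>j\<in>insert i J. T j ((x(i := y)) j)) * (\<Prod>j\<in>insert i J. w j ((x(i := y)) j)) \<partial>gauss J)"
      unfolding p restrict_fun_upd_insert[OF insert.hyps(2)] by (subst nn_integral_multc[symmetric]) (auto simp: mult.assoc)
  qed
  also have "\<dots> = (\<integral>\<^sup>+z. f (\<lambda>j\<in>insert i J. T j (z j)) * (\<Prod>j\<in>insert i J. w j (z j)) \<partial>gauss (insert i J))"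
    by (rule nn_integral_gauss_insert(2)[symmetric])
      (use insert.hyps in \<open>auto intro!: borel_measurable_times_ennreal borel_measurable_prod_ennreal measurable_compose[OF ST(2)] measurable_compose[OF measurable_component_singleton] insert.prems\<close>)
  finally show ?case .
qed

text \<open>The Cameron-Martin density of a translation factors over the coordinates; each factor
  comes from completing the square in one normal density.\<close>

lemma nn_integral_gauss_shift_le:
  assumes J: "finite J" and f: "f \<in> borel_measurable (Pi\<^sub>M J (\<lambda>_. borel))"
  shows "(\<integral>\<^sup>+z. f (\<lambda>j\<in>J. z j + b j) \<partial>gauss J)
    \<le> (\<integral>\<^sup>+z. f (\<lambda>j\<in>J. z j) * ennreal (exp ((\<Sum>j\<in>J. b j * z j) - (\<Sum>j\<in>J. (b j)\<^sup>2) / 2)) \<partial>gauss J)"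
proof -
  have "(\<integral>\<^sup>+z. f (\<lambda>j\<in>J. z j + b j) \<partial>gauss J)
    \<le> (\<integral>\<^sup>+z. f (\<lambda>j\<in>J. z j) * (\<Prod>j\<in>J. ennreal (exp (b j * z j - (b j)\<^sup>2 / 2))) \<partial>gauss J)"
    by (rule nn_integral_gauss_map_le[where D=UNIV, OF J])
      (use f in \<open>auto simp: nn_integral_std_normal_shift\<close>)
  also have "(\<lambda>z. (\<Prod>j\<in>J. ennreal (exp (b j * z j - (b j)\<^sup>2 / 2)))) = (\<lambda>z. ennreal (exp ((\<Sum>j\<in>J. b j * z j) - (\<Sum>j\<in>J. (b j)\<^sup>2) / 2)))"
    by (simp add: prod_ennreal exp_sum[OF J, symmetric] sum_subtractf sum_divide_distrib)
  finally show ?thesis .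
qed

section \<open>Anderson's inequality\<close>

definition rot_plus :: "'i set \<Rightarrow> ('i \<Rightarrow> real) \<Rightarrow> ('i \<Rightarrow> real) \<Rightarrow> 'i \<Rightarrow> real" where
  "rot_plus J u v = (\<lambda>j\<in>J. (v j + u j) / sqrt 2)"

definition rot_minus :: "'i set \<Rightarrow> ('i \<Rightarrow> real) \<Rightarrow> ('i \<Rightarrow> real) \<Rightarrow> 'i \<Rightarrow> real" where
  "rot_minus J u v = (\<lambda>j\<in>J. (v j - u j) / sqrt 2)"

lemma rot_measurable [measurable]:
  "(\<lambda>(u, v). rot_plus J u v) \<in> Pi\<^sub>M J (\<lambda>_. borel) \<Otimes>\<^sub>M Pi\<^sub>M J (\<lambda>_. borel) \<rightarrow>\<^sub>M Pi\<^sub>M J (\<lambda>_. borel)"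
  "(\<lambda>(u, v). rot_minus J u v) \<in> Pi\<^sub>M J (\<lambda>_. borel) \<Otimes>\<^sub>M Pi\<^sub>M J (\<lambda>_. borel) \<rightarrow>\<^sub>M Pi\<^sub>M J (\<lambda>_. borel)"
  unfolding rot_plus_def rot_minus_def split_beta' by (intro measurable_restrict; measurable)+

lemma integral_gauss_pair_iexp:
  assumes J: "finite J"
  shows "(CLINT p|gauss J \<Otimes>\<^sub>M gauss J. iexp (\<Sum>j\<in>J. a j * fst p j + b j * snd p j))
    = exp (- (\<Sum>j\<in>J. (a j)\<^sup>2 + (b j)\<^sup>2) / 2)"
proof -
  interpret G: prob_space "gauss J" by (rule prob_space_gauss)
  interpret GG: pair_prob_space "gauss J" "gauss J" ..
  have int: "complex_integrable (gauss J \<Otimes>\<^sub>M gauss J) (\<lambda>p. iexp (\<Sum>j\<in>J. a j * fst p j + b j * snd p j))"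
    by (rule GG.integrable_iexp_comp) measurable
  have "(CLINT p|gauss J \<Otimes>\<^sub>M gauss J. iexp (\<Sum>j\<in>J. a j * fst p j + b j * snd p j))
    = (CLINT u|gauss J. (CLINT v|gauss J. iexp (\<Sum>j\<in>J. a j * u j + b j * v j)))"
    using GG.integral_fst'[OF int] by simp
  also have "\<dots> = (CLINT u|gauss J. (CLINT v|gauss J. iexp (\<Sum>j\<in>J. a j * u j) * iexp (\<Sum>j\<in>J. b j * v j)))"
    by (simp add: sum.distrib ring_distribs exp_add)
  also have "\<dots> = (CLINT u|gauss J. iexp (\<Sum>j\<in>J. a j * u j)) * (CLINT v|gauss J. iexp (\<Sum>j\<in>J. b j * v j))"
    by (simp only: Bochner_Integration.integral_mult_right_zero Bochner_Integration.integral_mult_left_zero)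
  also have "\<dots> = exp (- (\<Sum>j\<in>J. (a j)\<^sup>2 + (b j)\<^sup>2) / 2)"
    unfolding integral_gauss_iexp[OF J]
    by (simp only: of_real_mult[symmetric] exp_add[symmetric] sum.distrib) (simp add: field_simps)
  finally show ?thesis .
qed

text \<open>The pair is flattened to a vector over \<open>J <+> J\<close>. There the rotated and the
  original coordinates have equal characteristic functions, because a rotation by 45 degrees
  preserves the sum of squares.\<close>

lemma emeasure_gauss_rotation:
  assumes J: "finite J" and [measurable]: "K \<in> sets (Pi\<^sub>M J (\<lambda>_. borel))"
  shows "emeasure (gauss J \<Otimes>\<^sub>M gauss J) {p \<in> space (gauss J \<Otimes>\<^sub>M gauss J).
      rot_plus J (fst p) (snd p) \<in> K \<and> rot_minus J (fst p) (snd p) \<in> K} = emeasure (gauss J) K * emeasure (gauss J) K"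
proof -
  interpret G: prob_space "gauss J" by (rule prob_space_gauss)
  interpret GG: pair_prob_space "gauss J" "gauss J" ..
  let ?P = "gauss J \<Otimes>\<^sub>M gauss J"
  let ?I = "J <+> J"
  have IJ [simp]: "Inl j \<in> ?I \<longleftrightarrow> j \<in> J" "Inr j \<in> ?I \<longleftrightarrow> j \<in> J" for j :: 'a by auto
  have fs: "(\<lambda>p. fst p j) \<in> borel_measurable ?P" "(\<lambda>p. snd p j) \<in> borel_measurable ?P" if "j \<in> J" for j
    using that by measurable
  define X where "X i p = (case i of Inl j \<Rightarrow> (snd p j + fst p j) / sqrt 2 | Inr j \<Rightarrow> (snd p j - fst p j) / sqrt 2)"
    for i :: "'a + 'a" and p :: "('a \<Rightarrow> real) \<times> ('a \<Rightarrow> real)"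
  define Y where "Y i p = (case i of Inl j \<Rightarrow> fst p j | Inr j \<Rightarrow> snd p j)"
    for i :: "'a + 'a" and p :: "('a \<Rightarrow> real) \<times> ('a \<Rightarrow> real)"
  have X: "X i \<in> borel_measurable ?P" if "i \<in> ?I" for i
    using that fs by (cases i) (auto simp: X_def[abs_def] intro!: borel_measurable_divide borel_measurable_add borel_measurable_diff)
  have Y: "Y i \<in> borel_measurable ?P" if "i \<in> ?I" for i
    using that fs by (cases i) (auto simp: Y_def[abs_def])
  have sumI: "(\<Sum>i\<in>?I. h i) = (\<Sum>j\<in>J. h (Inl j) + h (Inr j))" for h :: "_ \<Rightarrow> real"
    using J by (simp add: sum.Plus sum.distrib)
  have eq: "distr ?P (Pi\<^sub>M ?I (\<lambda>_. borel)) (\<lambda>\<omega>. \<lambda>i\<in>?I. X i \<omega>) = distr ?P (Pi\<^sub>M ?I (\<lambda>_. borel)) (\<lambda>\<omega>. \<lambda>i\<in>?I. Y i \<omega>)"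
  proof (rule distr_PiM_eq_of_iexp)
    fix u :: "'a + 'a \<Rightarrow> real"
    have 1: "(\<Sum>i\<in>?I. u i * X i p) = (\<Sum>j\<in>J. ((u (Inl j) - u (Inr j)) / sqrt 2) * fst p j + ((u (Inl j) + u (Inr j)) / sqrt 2) * snd p j)" for p
      unfolding sumI X_def by (intro sum.cong refl) (simp add: field_simps)
    have 2: "(\<Sum>i\<in>?I. u i * Y i p) = (\<Sum>j\<in>J. u (Inl j) * fst p j + u (Inr j) * snd p j)" for p
      unfolding sumI Y_def by simp
    have "((u (Inl j) - u (Inr j)) / sqrt 2)\<^sup>2 + ((u (Inl j) + u (Inr j)) / sqrt 2)\<^sup>2 = (u (Inl j))\<^sup>2 + (u (Inr j))\<^sup>2" for j
      by (simp add: power_divide power2_sum power2_diff field_simps)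
    then show "(CLINT p|?P. iexp (\<Sum>i\<in>?I. u i * X i p)) = (CLINT p|?P. iexp (\<Sum>i\<in>?I. u i * Y i p))"
      unfolding 1 2 integral_gauss_pair_iexp[OF J] by simp
  qed (use J X Y in \<open>auto intro: GG.finite_measure_axioms\<close>)
  define E where "E = {w \<in> space (Pi\<^sub>M ?I (\<lambda>_. borel :: real measure)). (\<lambda>j\<in>J. w (Inl j)) \<in> K \<and> (\<lambda>j\<in>J. w (Inr j)) \<in> K}"
  have proj [measurable]: "(\<lambda>w. \<lambda>j\<in>J. w (Inl j)) \<in> Pi\<^sub>M ?I (\<lambda>_. borel :: real measure) \<rightarrow>\<^sub>M Pi\<^sub>M J (\<lambda>_. borel)"
      "(\<lambda>w. \<lambda>j\<in>J. w (Inr j)) \<in> Pi\<^sub>M ?I (\<lambda>_. borel :: real measure) \<rightarrow>\<^sub>M Pi\<^sub>M J (\<lambda>_. borel)"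
    by (rule measurable_restrict, rule measurable_component_singleton, simp)+
  have E [measurable]: "E \<in> sets (Pi\<^sub>M ?I (\<lambda>_. borel))" unfolding E_def by measurable
  have mX: "(\<lambda>\<omega>. \<lambda>i\<in>?I. X i \<omega>) \<in> ?P \<rightarrow>\<^sub>M Pi\<^sub>M ?I (\<lambda>_. borel)" "(\<lambda>\<omega>. \<lambda>i\<in>?I. Y i \<omega>) \<in> ?P \<rightarrow>\<^sub>M Pi\<^sub>M ?I (\<lambda>_. borel)"
    by (intro measurable_restrict X Y; assumption)+
  have "emeasure ?P {p \<in> space ?P. rot_plus J (fst p) (snd p) \<in> K \<and> rot_minus J (fst p) (snd p) \<in> K}
    = emeasure (distr ?P (Pi\<^sub>M ?I (\<lambda>_. borel)) (\<lambda>\<omega>. \<lambda>i\<in>?I. X i \<omega>)) E"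
    unfolding emeasure_distr[OF mX(1) E]
    by (intro arg_cong[where f="emeasure ?P"])
      (auto simp: E_def X_def rot_plus_def rot_minus_def space_PiM cong: restrict_cong)
  also have "\<dots> = emeasure ?P (K \<times> K)"
    unfolding eq emeasure_distr[OF mX(2) E]
  proof (intro arg_cong[where f="emeasure ?P"])
    have Kext: "(\<lambda>j\<in>J. w j) = w" if "w \<in> extensional J" for w :: "'a \<Rightarrow> real" using that by (rule extensional_restrict)
    have "K \<subseteq> extensional J" using sets.sets_into_space[OF assms(2)] by (auto simp: space_PiM PiE_def)
    then show "(\<lambda>\<omega>. \<lambda>i\<in>?I. Y i \<omega>) -` E \<inter> space ?P = K \<times> K"
      by (auto simp: E_def Y_def space_PiM space_pair_measure space_gauss Kext cong: restrict_cong)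
  qed
  also have "\<dots> = emeasure (gauss J) K * emeasure (gauss J) K"
    by (rule G.emeasure_pair_measure_Times) (use assms(2) sets_gauss in auto)
  finally show ?thesis .
qed

text \<open>This generalizes Anderson's situation, in which \<open>K\<close> is a translate of the
  symmetric convex set \<open>K0\<close>. The condition that half-differences of \<open>K\<close>
  lie in \<open>K0\<close> survives the passage to sections in
  \<open>gauss_diff_step\<close>.\<close>

definition diff_admissible :: "'i set \<Rightarrow> ('i \<Rightarrow> real) set \<Rightarrow> ('i \<Rightarrow> real) set \<Rightarrow> bool" where
  "diff_admissible J K K0 \<longleftrightarrow> K \<in> sets (Pi\<^sub>M J (\<lambda>_. borel)) \<and> K0 \<in> sets (Pi\<^sub>M J (\<lambda>_. borel)) \<and>
     (\<forall>x\<in>K. \<forall>y\<in>K. (\<lambda>j\<in>J. (x j - y j) / 2) \<in> K0) \<and>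
     (\<forall>x\<in>K0. (\<lambda>j\<in>J. - x j) \<in> K0) \<and>
     (\<forall>x\<in>K0. \<forall>y\<in>K0. \<forall>s\<in>{0..1}. (\<lambda>j\<in>J. s * x j + (1 - s) * y j) \<in> K0)"

text \<open>A crude change of variables. The density at \<open>a + 2 * x\<close> is at most its
  maximum, and for x in \<open>{-l..l}\<close> the density at \<open>x / l\<close> is at least exp(-
  1/2) times the maximum; 2 and \<open>l\<close> are the Jacobians. The bound does not depend on
  \<open>a\<close>.\<close>

lemma nn_integral_std_normal_compare:
  assumes [measurable]: "h \<in> borel_measurable borel" and h: "\<And>x. x \<notin> {-l..l} \<Longrightarrow> h x = 0" and l: "l \<ge> 1"
  shows "(\<integral>\<^sup>+x. h ((x - a) / 2) \<partial>std_normal_distribution) \<le> (\<integral>\<^sup>+x. h (l * x) * ennreal (2 * exp (1/2) * l) \<partial>std_normal_distribution)"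
proof -
  have "(\<integral>\<^sup>+x. h ((x - a) / 2) \<partial>std_normal_distribution) = (\<integral>\<^sup>+x. ennreal (std_normal_density x) * h ((x - a) / 2) \<partial>lborel)"
    by (rule nn_integral_std_normal) measurable
  also have "\<dots> = (\<integral>\<^sup>+x. 2 * (ennreal (std_normal_density (a + 2 * x)) * h x) \<partial>lborel)"
    by (subst nn_integral_real_affine[where c=2 and t=a]) (auto simp: nn_integral_cmult)
  also have "\<dots> = (\<integral>\<^sup>+x. ennreal 2 * ennreal (std_normal_density (a + 2 * x)) * h x \<partial>lborel)"
    by (simp add: mult.assoc)
  also have "\<dots> \<le> (\<integral>\<^sup>+x. ennreal (1 / l) * (ennreal (std_normal_density (x / l)) * (h x * ennreal (2 * exp (1/2) * l))) \<partial>lborel)"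
  proof (intro nn_integral_mono)
    fix x
    show "ennreal 2 * ennreal (std_normal_density (a + 2 * x)) * h x \<le> ennreal (1 / l) * (ennreal (std_normal_density (x / l)) * (h x * ennreal (2 * exp (1/2) * l)))"
    proof (cases "x \<in> {-l..l}")
      case False then show ?thesis using h[of x] by simp
    next
      case True
      have "\<bar>x / l\<bar> \<le> 1" using True l by (simp add: abs_le_iff field_simps)
      then have "(x / l)\<^sup>2 \<le> 1" by (simp add: abs_square_le_1)
      then have "1 \<le> exp (1/2) * exp (- (x / l)\<^sup>2 / 2)" by (simp add: exp_add[symmetric])
      moreover have "exp (- (a + 2 * x)\<^sup>2 / 2) \<le> (1::real)" by simp
      ultimately have "exp (- (a + 2 * x)\<^sup>2 / 2) \<le> exp (1/2) * exp (- (x / l)\<^sup>2 / 2)" by linarith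
      then have "std_normal_density (a + 2 * x) \<le> exp (1/2) * std_normal_density (x / l)"
        unfolding std_normal_density_def by (simp add: divide_simps)
      then have "2 * std_normal_density (a + 2 * x) \<le> 1 / l * (std_normal_density (x / l) * (2 * exp (1/2) * l))"
        using l by (simp add: mult_ac)
      then have "ennreal 2 * ennreal (std_normal_density (a + 2 * x)) \<le> ennreal (1 / l) * (ennreal (std_normal_density (x / l)) * ennreal (2 * exp (1/2) * l))"
        using l by (simp add: ennreal_mult[symmetric] del: ennreal_numeral)
      then have "ennreal 2 * ennreal (std_normal_density (a + 2 * x)) * h x \<le> ennreal (1 / l) * (ennreal (std_normal_density (x / l)) * ennreal (2 * exp (1/2) * l)) * h x"
        by (rule mult_right_mono) simp
      then show ?thesis by (simp add: mult_ac)
    qed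
  qed
  also have "\<dots> = (\<integral>\<^sup>+x. ennreal (std_normal_density x) * (h (l * x) * ennreal (2 * exp (1/2) * l)) \<partial>lborel)"
    using l by (subst (2) nn_integral_real_affine[where c="1/l" and t=0]) (auto simp: nn_integral_cmult)
  also have "\<dots> = (\<integral>\<^sup>+x. h (l * x) * ennreal (2 * exp (1/2) * l) \<partial>std_normal_distribution)"
    by (rule nn_integral_std_normal[symmetric]) measurable
  finally show ?thesis .
qed

text \<open>For a fixed \<open>z0\<close> in \<open>K\<close>, every \<open>z\<close> in
  \<open>K\<close> has \<open>(z - z0) / 2\<close> in \<open>K0\<close>, which lies in a cube of
  radius \<open>l\<close>, so the one-dimensional comparison applies in each coordinate. The
  constant grows with the dimension and only starts the iteration.\<close>

lemma gauss_diff_base: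
  assumes J: "finite J" and adm: "diff_admissible J K K0" and l: "l \<ge> 1"
    and bound: "\<And>x j. x \<in> K0 \<Longrightarrow> j \<in> J \<Longrightarrow> \<bar>x j\<bar> \<le> l"
  shows "measure (gauss J) K \<le> (2 * exp (1/2) * l) ^ card J * measure (gauss J) K0"
proof (cases "K = {}")
  case True then show ?thesis using l by (simp add: mult_nonneg_nonneg)
next
  case False
  then obtain z0 where z0: "z0 \<in> K" by auto
  interpret G: prob_space "gauss J" by (rule prob_space_gauss)
  have [measurable]: "K \<in> sets (Pi\<^sub>M J (\<lambda>_. borel))" "K0 \<in> sets (Pi\<^sub>M J (\<lambda>_. borel))"
    using adm by (auto simp: diff_admissible_def)
  have bound': "- l \<le> x j" "x j \<le> l" if "x \<in> K0" "j \<in> J" for x j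
    using bound[OF that] by auto
  have "emeasure (gauss J) K = (\<integral>\<^sup>+z. indicator K z \<partial>gauss J)" by (simp add: sets_gauss)
  also have "\<dots> \<le> (\<integral>\<^sup>+z. indicator K0 (\<lambda>j\<in>J. (z j - z0 j) / 2) \<partial>gauss J)"
    using adm z0 by (intro nn_integral_mono) (auto simp: indicator_def diff_admissible_def)
  also have "\<dots> \<le> (\<integral>\<^sup>+z. indicator K0 (\<lambda>j\<in>J. l * z j) * (\<Prod>j\<in>J. ennreal (2 * exp (1/2) * l)) \<partial>gauss J)"
    by (rule nn_integral_gauss_map_le[where D="{-l..l}", OF J])
      (use l bound' in \<open>auto intro!: nn_integral_std_normal_compare simp: indicator_def\<close>)
  also have "\<dots> \<le> (\<integral>\<^sup>+z. ennreal ((2 * exp (1/2) * l) ^ card J) * indicator K0 z \<partial>gauss J)"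
  proof (intro nn_integral_mono)
    fix z :: "'a \<Rightarrow> real" assume z: "z \<in> space (gauss J)"
    have "z \<in> K0" if *: "(\<lambda>j\<in>J. l * z j) \<in> K0"
    proof -
      \<comment> \<open>A symmetric convex set is closed under shrinking: weighting l z and - l z
        with s and 1 - s gives (2 s - 1) l z = z.\<close>
      define s where "s = (1 + 1 / l) / 2"
      have s: "s \<in> {0..1}" using l by (auto simp: s_def field_simps)
      have "(\<lambda>j\<in>J. - (\<lambda>j\<in>J. l * z j) j) \<in> K0" using adm * unfolding diff_admissible_def by blast
      then have "(\<lambda>j\<in>J. s * (\<lambda>j\<in>J. l * z j) j + (1 - s) * (\<lambda>j\<in>J. - (\<lambda>j\<in>J. l * z j) j) j) \<in> K0"
        using adm * s unfolding diff_admissible_def by blast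
      also have "(\<lambda>j\<in>J. s * (\<lambda>j\<in>J. l * z j) j + (1 - s) * (\<lambda>j\<in>J. - (\<lambda>j\<in>J. l * z j) j) j) = (\<lambda>j\<in>J. z j)"
        using l by (intro restrict_ext) (simp add: s_def field_simps)
      also have "\<dots> = z" using z by (simp add: space_gauss extensional_restrict)
      finally show ?thesis .
    qed
    then show "indicator K0 (\<lambda>j\<in>J. l * z j) * (\<Prod>j\<in>J. ennreal (2 * exp (1/2) * l)) \<le> ennreal ((2 * exp (1/2) * l) ^ card J) * indicator K0 z"
      using l by (auto simp: indicator_def ennreal_power)
  qed
  also have "\<dots> = ennreal ((2 * exp (1/2) * l) ^ card J) * emeasure (gauss J) K0"
    by (subst nn_integral_cmult_indicator) (auto simp: sets_gauss)
  finally show ?thesis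
    using l by (simp add: G.emeasure_eq_measure ennreal_mult[symmetric])
qed

text \<open>For independent copies \<open>Z\<close>, \<open>Z'\<close> put \<open>U = (Z - Z') / \<surd>2\<close> and \<open>V = (Z + Z') / \<surd>2\<close>. Conditionally on
  \<open>U\<close>, the events \<open>Z, Z' \<in> K\<close> and \<open>Z, Z' \<in> K0\<close> become sections that are again admissible, so
  a bound \<open>\<gamma> K \<le> c \<cdot> \<gamma> K0\<close> improves itself to \<open>\<gamma> K \<le> \<surd>c \<cdot> \<gamma> K0\<close>, at the cost of a larger radius \<open>\<surd>2 l\<close>.\<close>

lemma gauss_diff_step:
  assumes J: "finite J" and adm: "diff_admissible J K K0"
    and bound: "\<And>x j. x \<in> K0 \<Longrightarrow> j \<in> J \<Longrightarrow> \<bar>x j\<bar> \<le> l" and c: "c \<ge> 0"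
    and IH: "\<And>K K0. diff_admissible J K K0 \<Longrightarrow> (\<And>x j. x \<in> K0 \<Longrightarrow> j \<in> J \<Longrightarrow> \<bar>x j\<bar> \<le> sqrt 2 * l) \<Longrightarrow>
      measure (gauss J) K \<le> c * measure (gauss J) K0"
  shows "measure (gauss J) K \<le> sqrt c * measure (gauss J) K0"
proof -
  interpret G: prob_space "gauss J" by (rule prob_space_gauss)
  interpret GG: pair_prob_space "gauss J" "gauss J" ..
  let ?P = "gauss J \<Otimes>\<^sub>M gauss J"
  have K [measurable]: "K \<in> sets (Pi\<^sub>M J (\<lambda>_. borel))" "K0 \<in> sets (Pi\<^sub>M J (\<lambda>_. borel))"
    using adm by (auto simp: diff_admissible_def)
  define S where "S A u = {v \<in> space (gauss J). rot_plus J u v \<in> A \<and> rot_minus J u v \<in> A}" for A u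
  have R: "{p \<in> space ?P. rot_plus J (fst p) (snd p) \<in> A \<and> rot_minus J (fst p) (snd p) \<in> A} \<in> sets ?P"
    if [measurable]: "A \<in> sets (Pi\<^sub>M J (\<lambda>_. borel))" for A
    using rot_measurable[of J] unfolding split_beta' by measurable
  have sec: "Pair u -` {p \<in> space ?P. rot_plus J (fst p) (snd p) \<in> A \<and> rot_minus J (fst p) (snd p) \<in> A} = S A u"
    if "u \<in> space (gauss J)" for A u
    using that by (auto simp: S_def space_pair_measure)
  have Smeas: "S A u \<in> sets (Pi\<^sub>M J (\<lambda>_. borel))" if "A \<in> sets (Pi\<^sub>M J (\<lambda>_. borel))" "u \<in> space (gauss J)" for A u
    using sets_Pair1[OF R[OF that(1)], of u] sec[OF that(2)] by (simp add: sets_gauss)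
  have double: "emeasure (gauss J) A * emeasure (gauss J) A = (\<integral>\<^sup>+u. emeasure (gauss J) (S A u) \<partial>gauss J)"
    if "A \<in> sets (Pi\<^sub>M J (\<lambda>_. borel))" for A
    unfolding emeasure_gauss_rotation[OF J that, symmetric] G.emeasure_pair_measure_alt[OF R[OF that]]
    by (intro nn_integral_cong) (simp only: sec)
  have Sadm: "diff_admissible J (S K u) (S K0 u)" if u: "u \<in> space (gauss J)" for u
    unfolding diff_admissible_def
  proof (intro conjI ballI)
    \<comment> \<open>Opposite signs have to be paired: (v + u) - (w - u) contains 2 u, so
      \<open>u\<close> reappears after halving, whereas equal signs would cancel it.\<close>
    fix v w assume "v \<in> S K u" "w \<in> S K u"
    then have *: "(\<lambda>j\<in>J. (rot_plus J u v j - rot_minus J u w j) / 2) \<in> K0" "(\<lambda>j\<in>J. (rot_minus J u v j - rot_plus J u w j) / 2) \<in> K0"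
      using adm unfolding S_def diff_admissible_def by blast+
    have e1: "(\<lambda>j\<in>J. (rot_plus J u v j - rot_minus J u w j) / 2) = rot_plus J u (\<lambda>j\<in>J. (v j - w j) / 2)"
      unfolding rot_plus_def rot_minus_def by (intro restrict_ext) (simp add: field_simps)
    have e2: "(\<lambda>j\<in>J. (rot_minus J u v j - rot_plus J u w j) / 2) = rot_minus J u (\<lambda>j\<in>J. (v j - w j) / 2)"
      unfolding rot_plus_def rot_minus_def by (intro restrict_ext) (simp add: field_simps)
    show "(\<lambda>j\<in>J. (v j - w j) / 2) \<in> S K0 u" using *[unfolded e1 e2] by (simp add: S_def space_gauss)
  next
    fix v assume "v \<in> S K0 u"
    then have *: "(\<lambda>j\<in>J. - rot_minus J u v j) \<in> K0" "(\<lambda>j\<in>J. - rot_plus J u v j) \<in> K0"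
      using adm unfolding S_def diff_admissible_def by blast+
    have e1: "(\<lambda>j\<in>J. - rot_minus J u v j) = rot_plus J u (\<lambda>j\<in>J. - v j)"
      unfolding rot_plus_def rot_minus_def by (intro restrict_ext) (simp add: field_simps)
    have e2: "(\<lambda>j\<in>J. - rot_plus J u v j) = rot_minus J u (\<lambda>j\<in>J. - v j)"
      unfolding rot_plus_def rot_minus_def by (intro restrict_ext) (simp add: field_simps)
    show "(\<lambda>j\<in>J. - v j) \<in> S K0 u" using *[unfolded e1 e2] by (simp add: S_def space_gauss)
  next
    fix v w and s :: real assume "v \<in> S K0 u" "w \<in> S K0 u" "s \<in> {0..1}"
    then have *: "(\<lambda>j\<in>J. s * rot_plus J u v j + (1 - s) * rot_plus J u w j) \<in> K0" "(\<lambda>j\<in>J. s * rot_minus J u v j + (1 - s) * rot_minus J u w j) \<in> K0"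
      using adm unfolding S_def diff_admissible_def by blast+
    have e1: "(\<lambda>j\<in>J. s * rot_plus J u v j + (1 - s) * rot_plus J u w j) = rot_plus J u (\<lambda>j\<in>J. s * v j + (1 - s) * w j)"
      unfolding rot_plus_def rot_minus_def by (intro restrict_ext) (simp add: field_simps)
    have e2: "(\<lambda>j\<in>J. s * rot_minus J u v j + (1 - s) * rot_minus J u w j) = rot_minus J u (\<lambda>j\<in>J. s * v j + (1 - s) * w j)"
      unfolding rot_plus_def rot_minus_def by (intro restrict_ext) (simp add: field_simps)
    show "(\<lambda>j\<in>J. s * v j + (1 - s) * w j) \<in> S K0 u" using *[unfolded e1 e2] by (simp add: S_def space_gauss)
  qed (use Smeas K u in auto)
  have Sbound: "\<bar>v j\<bar> \<le> sqrt 2 * l" if "v \<in> S K0 u" "j \<in> J" for u v j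
  proof -
    have "\<bar>(v j + u j) / sqrt 2\<bar> \<le> l" "\<bar>(v j - u j) / sqrt 2\<bar> \<le> l"
      using that bound[of "rot_plus J u v" j] bound[of "rot_minus J u v" j]
      by (auto simp: S_def rot_plus_def rot_minus_def)
    \<comment> \<open>The sum of the two rotated vectors is \<open>sqrt 2 * v\<close>, so the bound
      on \<open>v\<close> is independent of \<open>u\<close>.\<close>
    then have "\<bar>(v j + u j) / sqrt 2 + (v j - u j) / sqrt 2\<bar> \<le> 2 * l" by linarith
    also have "(v j + u j) / sqrt 2 + (v j - u j) / sqrt 2 = sqrt 2 * v j"
      by (simp add: field_simps)
    finally have "\<bar>v j\<bar> * sqrt 2 \<le> 2 * l" by (simp add: abs_mult mult.commute)
    then have "\<bar>v j\<bar> \<le> 2 * l / sqrt 2" by (subst pos_le_divide_eq) auto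
    also have "2 * l / sqrt 2 = sqrt 2 * l" by (simp add: real_div_sqrt field_simps)
    finally show ?thesis .
  qed
  have "emeasure (gauss J) K * emeasure (gauss J) K = (\<integral>\<^sup>+u. emeasure (gauss J) (S K u) \<partial>gauss J)" by (rule double) measurable
  also have "\<dots> \<le> (\<integral>\<^sup>+u. ennreal c * emeasure (gauss J) (S K0 u) \<partial>gauss J)"
  proof (intro nn_integral_mono)
    fix u assume u: "u \<in> space (gauss J)"
    have "measure (gauss J) (S K u) \<le> c * measure (gauss J) (S K0 u)"
      by (rule IH[OF Sadm[OF u]]) (rule Sbound)
    then show "emeasure (gauss J) (S K u) \<le> ennreal c * emeasure (gauss J) (S K0 u)"
      using c by (simp add: G.emeasure_eq_measure ennreal_mult[symmetric])
  qed
  also have "\<dots> = ennreal c * (\<integral>\<^sup>+u. emeasure (gauss J) (S K0 u) \<partial>gauss J)"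
  proof (rule nn_integral_cmult)
    have "(\<lambda>u. emeasure (gauss J) (Pair u -` {p \<in> space ?P. rot_plus J (fst p) (snd p) \<in> K0 \<and> rot_minus J (fst p) (snd p) \<in> K0})) \<in> borel_measurable (gauss J)"
      by (rule G.measurable_emeasure_Pair) (rule R[OF K(2)])
    then show "(\<lambda>u. emeasure (gauss J) (S K0 u)) \<in> borel_measurable (gauss J)"
      by (rule measurable_cong[THEN iffD1, rotated]) (simp only: sec)
  qed
  also have "\<dots> = ennreal c * (emeasure (gauss J) K0 * emeasure (gauss J) K0)" by (simp only: double[OF K(2)])
  finally have "(measure (gauss J) K)\<^sup>2 \<le> c * (measure (gauss J) K0)\<^sup>2"
    using c by (simp add: G.emeasure_eq_measure ennreal_mult[symmetric] power2_eq_square)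
  then have "sqrt ((measure (gauss J) K)\<^sup>2) \<le> sqrt (c * (measure (gauss J) K0)\<^sup>2)" by (rule real_sqrt_le_mono)
  then show ?thesis by (simp add: real_sqrt_mult)
qed

text \<open>Each step takes the square root of the constant at the price of enlarging the radius by
  \<open>sqrt 2\<close>. After \<open>k\<close> steps the constant is the root of order 2^k of the
  one in \<open>gauss_diff_base\<close> for the radius \<open>sqrt 2 ^ k * l\<close>.\<close>

lemma gauss_diff_iterate:
  assumes J: "finite J" and "diff_admissible J K K0" "l \<ge> 1"
    and "\<And>x j. x \<in> K0 \<Longrightarrow> j \<in> J \<Longrightarrow> \<bar>x j\<bar> \<le> l"
  shows "measure (gauss J) K \<le> (2 * exp (1/2) * (sqrt 2 ^ k * l)) powr (card J / 2 ^ k) * measure (gauss J) K0"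
  using assms(2-)
proof (induction k arbitrary: K K0 l)
  case 0
  then show ?case using gauss_diff_base[OF J 0(1,2)] by (simp add: powr_realpow)
next
  case (Suc k)
  define c where "c = (2 * exp (1/2) * (sqrt 2 ^ k * (sqrt 2 * l))) powr (card J / 2 ^ k)"
  have "measure (gauss J) K \<le> sqrt c * measure (gauss J) K0"
  proof (rule gauss_diff_step[OF J Suc.prems(1), where l=l])
    fix K K0 assume *: "diff_admissible J K K0" "\<And>x j. x \<in> K0 \<Longrightarrow> j \<in> J \<Longrightarrow> \<bar>x j\<bar> \<le> sqrt 2 * l"
    have "1 \<le> sqrt 2 * l" using mult_mono[of 1 "sqrt 2" 1 l] Suc.prems(2) by simp
    then show "measure (gauss J) K \<le> c * measure (gauss J) K0"
      unfolding c_def using *(2) by (rule Suc.IH[OF *(1)])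
  qed (use Suc.prems(3) in \<open>auto simp: c_def\<close>)
  moreover have "sqrt c = (2 * exp (1/2) * (sqrt 2 ^ Suc k * l)) powr (card J / 2 ^ Suc k)"
    by (simp add: c_def powr_half_sqrt[symmetric] powr_powr mult_ac)
  ultimately show ?case by simp
qed

lemma gauss_diff_bounded:
  assumes J: "finite J" and adm: "diff_admissible J K K0"
    and bound: "\<And>x j. x \<in> K0 \<Longrightarrow> j \<in> J \<Longrightarrow> \<bar>x j\<bar> \<le> l"
  shows "measure (gauss J) K \<le> measure (gauss J) K0"
proof -
  define m where "m = max 1 l"
  define D where "D = 2 * exp (1/2) * m"
  have D: "D > 0" and m: "m \<ge> 1" by (auto simp: D_def m_def)
  \<comment> \<open>The logarithm of the radius grows only linearly in \<open>k\<close> and loses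
    against the root of order 2^k.\<close>
  have lim: "(\<lambda>k. exp ((ln D + real k * ln (sqrt 2)) * (real (card J) / 2 ^ k))) \<longlonglongrightarrow> 1"
    by real_asymp
  have eq: "exp ((ln D + real k * ln (sqrt 2)) * (real (card J) / 2 ^ k)) = (2 * exp (1/2) * (sqrt 2 ^ k * m)) powr (card J / 2 ^ k)" for k
  proof -
    have e1: "2 * exp (1/2) * (sqrt 2 ^ k * m) = D * sqrt 2 ^ k" by (simp add: D_def)
    have ne: "(D * sqrt 2 ^ k = 0) = False" using D by simp
    have e2: "ln (D * sqrt 2 ^ k) = ln D + real k * ln (sqrt 2)" using D by (simp add: ln_mult ln_realpow)
    show ?thesis by (simp only: e1 powr_def e2 ne if_False) (rule arg_cong[where f=exp], rule mult.commute)
  qed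
  have "measure (gauss J) K \<le> exp ((ln D + real k * ln (sqrt 2)) * (real (card J) / 2 ^ k)) * measure (gauss J) K0" for k
    unfolding eq by (rule gauss_diff_iterate[OF J adm m]) (use bound in \<open>force simp: m_def\<close>)
  moreover have "(\<lambda>k. exp ((ln D + real k * ln (sqrt 2)) * (real (card J) / 2 ^ k)) * measure (gauss J) K0) \<longlonglongrightarrow> 1 * measure (gauss J) K0"
    by (intro tendsto_mult lim tendsto_const)
  ultimately show ?thesis using LIMSEQ_le_const by fastforce
qed

text \<open>Both sets are cut with the same cube. Cubes are symmetric and convex, so the pair stays
  admissible, and they exhaust the space.\<close>

lemma gauss_diff:
  assumes J: "finite J" and adm: "diff_admissible J K K0"
  shows "measure (gauss J) K \<le> measure (gauss J) K0"
proof -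
  interpret G: prob_space "gauss J" by (rule prob_space_gauss)
  define b where "b n = {z \<in> space (Pi\<^sub>M J (\<lambda>_. borel)). \<forall>j\<in>J. \<bar>z j\<bar> \<le> real n}" for n
  have K [measurable]: "K \<in> sets (Pi\<^sub>M J (\<lambda>_. borel))" "K0 \<in> sets (Pi\<^sub>M J (\<lambda>_. borel))"
    using adm by (auto simp: diff_admissible_def)
  have b [measurable]: "b n \<in> sets (Pi\<^sub>M J (\<lambda>_. borel))" for n unfolding b_def using J by measurable
  have sp: "space (Pi\<^sub>M J (\<lambda>_. borel :: real measure)) = extensional J" by (simp add: space_PiM PiE_UNIV_domain) (simp add: PiE_def)
  have "(\<lambda>n. measure (gauss J) (K \<inter> b n)) \<longlonglongrightarrow> measure (gauss J) (\<Union>n. K \<inter> b n)"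
  proof (rule G.finite_Lim_measure_incseq)
    show "incseq (\<lambda>n. K \<inter> b n)" by (force simp: incseq_def b_def)
  qed (auto simp: sets_gauss)
  moreover have "(\<Union>n. K \<inter> b n) = K"
  proof -
    have "\<exists>n. z \<in> b n" if "z \<in> K" for z
    proof -
      obtain n :: nat where n: "Max (insert 0 ((\<lambda>j. \<bar>z j\<bar>) ` J)) \<le> real n" using real_arch_simple by blast
      have "\<bar>z j\<bar> \<le> real n" if "j \<in> J" for j using n J that by (intro order_trans[OF Max_ge n]) auto
      then show ?thesis using that sets.sets_into_space[OF K(1)] by (auto simp: b_def)
    qed
    then show ?thesis by blast
  qed
  moreover have "measure (gauss J) (K \<inter> b n) \<le> measure (gauss J) K0" for n
  proof -
    have "diff_admissible J (K \<inter> b n) (K0 \<inter> b n)"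
      unfolding diff_admissible_def
    proof (intro conjI ballI)
      fix x y assume xy: "x \<in> K \<inter> b n" "y \<in> K \<inter> b n"
      have "\<bar>(x j - y j) / 2\<bar> \<le> real n" if "j \<in> J" for j
        using xy that abs_triangle_ineq4[of "x j" "y j"] by (fastforce simp: b_def)
      then show "(\<lambda>j\<in>J. (x j - y j) / 2) \<in> K0 \<inter> b n" using adm xy by (auto simp: diff_admissible_def b_def sp)
    next
      fix x assume "x \<in> K0 \<inter> b n" then show "(\<lambda>j\<in>J. - x j) \<in> K0 \<inter> b n" using adm by (auto simp: diff_admissible_def b_def sp)
    next
      fix x y and s :: real assume xy: "x \<in> K0 \<inter> b n" "y \<in> K0 \<inter> b n" "s \<in> {0..1}"
      have "\<bar>s * x j + (1 - s) * y j\<bar> \<le> real n" if "j \<in> J" for j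
      proof -
        have "\<bar>s * x j + (1 - s) * y j\<bar> \<le> s * \<bar>x j\<bar> + (1 - s) * \<bar>y j\<bar>"
          using xy abs_triangle_ineq[of "s * x j" "(1 - s) * y j"] by (simp add: abs_mult)
        also have "\<dots> \<le> s * real n + (1 - s) * real n"
          using xy that by (intro add_mono mult_left_mono) (auto simp: b_def)
        finally show ?thesis by (simp add: algebra_simps)
      qed
      then show "(\<lambda>j\<in>J. s * x j + (1 - s) * y j) \<in> K0 \<inter> b n" using adm xy by (auto simp: diff_admissible_def b_def sp)
    qed measurable
    then have "measure (gauss J) (K \<inter> b n) \<le> measure (gauss J) (K0 \<inter> b n)"
      by (rule gauss_diff_bounded[OF J]) (auto simp: b_def)
    also have "\<dots> \<le> measure (gauss J) K0" by (intro G.finite_measure_mono) (auto simp: sets_gauss)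
    finally show ?thesis .
  qed
  ultimately show ?thesis using LIMSEQ_le_const2 by metis
qed

section \<open>Finite-dimensional Gaussian vectors\<close>

text \<open>\<open>L\<close> may be singular or have more rows than columns, so degenerate
  covariances are included. The functional with weights \<open>a\<close> corresponds to the
  translation by \<open>b\<close>, the transpose of \<open>L\<close> applied to \<open>a\<close>; it
  moves each linear form by the covariance of that form with the functional.\<close>

lemma gauss_box_shift:
  fixes L :: "'t \<Rightarrow> 'j \<Rightarrow> real"
  assumes J: "finite J" and F: "finite F"
  shows "measure (gauss J) {z \<in> space (gauss J). \<forall>t\<in>F. \<bar>(\<Sum>j\<in>J. L t j * z j) + g t\<bar> \<le> r t}
    \<le> exp ((\<Sum>t\<in>F. \<bar>a t\<bar> * r t) - (\<Sum>t\<in>F. a t * g t) + (\<Sum>j\<in>J. (\<Sum>t\<in>F. a t * L t j)\<^sup>2) / 2)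
      * measure (gauss J) {z \<in> space (gauss J). \<forall>t\<in>F. \<bar>\<Sum>j\<in>J. L t j * z j\<bar> \<le> r t}"
proof -
  interpret G: prob_space "gauss J" by (rule prob_space_gauss)
  define box where "box g = {z \<in> space (gauss J). \<forall>t\<in>F. \<bar>(\<Sum>j\<in>J. L t j * z j) + g t\<bar> \<le> r t}" for g
  have lin: "(\<lambda>z. \<Sum>j\<in>J. L t j * z j) \<in> borel_measurable (Pi\<^sub>M J (\<lambda>_. borel))" for t
    by measurable
  have box_sets: "box g \<in> sets (gauss J)" for g
    unfolding box_def using F lin by measurable
  have box [measurable]: "box g \<in> sets (Pi\<^sub>M J (\<lambda>_. borel))" for g
    using box_sets by (simp add: sets_gauss)
  define b where "b j = (\<Sum>t\<in>F. a t * L t j)" for j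
  define g' where "g' t = g t - (\<Sum>j\<in>J. L t j * b j)" for t
  define A where "A = (\<Sum>t\<in>F. \<bar>a t\<bar> * r t) - (\<Sum>t\<in>F. a t * g t) + (\<Sum>j\<in>J. (b j)\<^sup>2) / 2"
  have swap: "(\<Sum>j\<in>J. b j * z j) = (\<Sum>t\<in>F. a t * (\<Sum>j\<in>J. L t j * z j))" for z
    unfolding b_def sum_distrib_right sum_distrib_left by (subst sum.swap) (simp add: mult.assoc)
  \<comment> \<open>On the box around the residual trend \<open>g'\<close>, each form plus
    \<open>g' t\<close> is bounded by \<open>r t\<close>, which bounds the exponent of the density
    by a constant.\<close>
  have expo: "(\<Sum>j\<in>J. b j * z j) - (\<Sum>j\<in>J. (b j)\<^sup>2) / 2 \<le> A" if z: "z \<in> box g'" for z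
  proof -
    have "(\<Sum>j\<in>J. b j * z j) = (\<Sum>t\<in>F. a t * ((\<Sum>j\<in>J. L t j * z j) + g' t)) - (\<Sum>t\<in>F. a t * g' t)"
      unfolding swap by (simp add: ring_distribs sum.distrib)
    moreover have "(\<Sum>t\<in>F. a t * ((\<Sum>j\<in>J. L t j * z j) + g' t)) \<le> (\<Sum>t\<in>F. \<bar>a t\<bar> * r t)"
    proof (intro sum_mono)
      fix t assume "t \<in> F"
      then have "\<bar>(\<Sum>j\<in>J. L t j * z j) + g' t\<bar> \<le> r t" using z by (simp add: box_def)
      then have "\<bar>a t * ((\<Sum>j\<in>J. L t j * z j) + g' t)\<bar> \<le> \<bar>a t\<bar> * r t"
        by (simp add: abs_mult mult_left_mono)
      then show "a t * ((\<Sum>j\<in>J. L t j * z j) + g' t) \<le> \<bar>a t\<bar> * r t" by linarith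
    qed
    moreover have "(\<Sum>t\<in>F. a t * g' t) = (\<Sum>t\<in>F. a t * g t) - (\<Sum>j\<in>J. (b j)\<^sup>2)"
      using swap[of b] by (simp add: g'_def ring_distribs sum_subtractf power2_eq_square)
    ultimately show ?thesis by (simp add: A_def)
  qed
  have "emeasure (gauss J) (box g) = (\<integral>\<^sup>+z. indicator (box g) z \<partial>gauss J)" using box_sets by simp
  also have "\<dots> = (\<integral>\<^sup>+z. indicator (box g') (\<lambda>j\<in>J. z j + b j) \<partial>gauss J)"
  proof (intro nn_integral_cong)
    fix z :: "'j \<Rightarrow> real" assume "z \<in> space (gauss J)"
    then have "z \<in> box g \<longleftrightarrow> (\<lambda>j\<in>J. z j + b j) \<in> box g'"
      by (simp add: box_def g'_def space_gauss ring_distribs sum.distrib)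
    then show "(indicator (box g) z :: ennreal) = indicator (box g') (\<lambda>j\<in>J. z j + b j)" by (simp add: indicator_def)
  qed
  also have "\<dots> \<le> (\<integral>\<^sup>+z. indicator (box g') (\<lambda>j\<in>J. z j) * ennreal (exp ((\<Sum>j\<in>J. b j * z j) - (\<Sum>j\<in>J. (b j)\<^sup>2) / 2)) \<partial>gauss J)"
    by (rule nn_integral_gauss_shift_le[OF J]) measurable
  also have "\<dots> \<le> (\<integral>\<^sup>+z. ennreal (exp A) * indicator (box g') z \<partial>gauss J)"
  proof (intro nn_integral_mono)
    fix z :: "'j \<Rightarrow> real" assume "z \<in> space (gauss J)"
    then have "(\<lambda>j\<in>J. z j) = z" by (simp add: space_gauss extensional_restrict)
    then show "indicator (box g') (\<lambda>j\<in>J. z j) * ennreal (exp ((\<Sum>j\<in>J. b j * z j) - (\<Sum>j\<in>J. (b j)\<^sup>2) / 2))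
      \<le> ennreal (exp A) * indicator (box g') z"
      using expo by (auto simp: indicator_def intro!: ennreal_leI)
  qed
  also have "\<dots> = ennreal (exp A) * emeasure (gauss J) (box g')"
    using box_sets by (rule nn_integral_cmult_indicator)
  finally have 1: "measure (gauss J) (box g) \<le> exp A * measure (gauss J) (box g')"
    by (simp add: G.emeasure_eq_measure ennreal_mult[symmetric])
  \<comment> \<open>Subtracting two points of \<open>box g'\<close> cancels the trend, so their
    half-difference lies in the centered box.\<close>
  have "diff_admissible J (box g') (box (\<lambda>_. 0))"
    unfolding diff_admissible_def
  proof (intro conjI ballI box)
    fix x y assume xy: "x \<in> box g'" "y \<in> box g'"
    have "\<bar>\<Sum>j\<in>J. L t j * ((x j - y j) / 2)\<bar> \<le> r t" if "t \<in> F" for t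
    proof -
      have "(\<Sum>j\<in>J. L t j * ((x j - y j) / 2)) = (((\<Sum>j\<in>J. L t j * x j) + g' t) - ((\<Sum>j\<in>J. L t j * y j) + g' t)) / 2"
        by (simp add: sum_subtractf[symmetric] sum_divide_distrib right_diff_distrib)
      moreover have "\<bar>(\<Sum>j\<in>J. L t j * x j) + g' t\<bar> \<le> r t" "\<bar>(\<Sum>j\<in>J. L t j * y j) + g' t\<bar> \<le> r t"
        using xy that by (auto simp: box_def)
      moreover have "\<bar>(p - q) / 2\<bar> \<le> c" if "\<bar>p\<bar> \<le> c" "\<bar>q\<bar> \<le> c" for p q c :: real
        using that by (auto simp: abs_le_iff field_simps)
      ultimately show ?thesis by (simp only:)
    qed
    then show "(\<lambda>j\<in>J. (x j - y j) / 2) \<in> box (\<lambda>_. 0)" by (simp add: box_def space_gauss)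
  next
    fix x assume "x \<in> box (\<lambda>_. 0)"
    then show "(\<lambda>j\<in>J. - x j) \<in> box (\<lambda>_. 0)" by (simp add: box_def space_gauss sum_negf)
  next
    fix x y and s :: real assume xy: "x \<in> box (\<lambda>_. 0)" "y \<in> box (\<lambda>_. 0)" "s \<in> {0..1}"
    have "\<bar>\<Sum>j\<in>J. L t j * (s * x j + (1 - s) * y j)\<bar> \<le> r t" if "t \<in> F" for t
    proof -
      have "(\<Sum>j\<in>J. L t j * (s * x j + (1 - s) * y j)) = s * (\<Sum>j\<in>J. L t j * x j) + (1 - s) * (\<Sum>j\<in>J. L t j * y j)"
        by (simp add: sum_distrib_left sum.distrib[symmetric] algebra_simps)
      also have "\<bar>\<dots>\<bar> \<le> s * \<bar>\<Sum>j\<in>J. L t j * x j\<bar> + (1 - s) * \<bar>\<Sum>j\<in>J. L t j * y j\<bar>"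
        using xy(3) by (intro order_trans[OF abs_triangle_ineq]) (simp add: abs_mult)
      also have "\<dots> \<le> s * r t + (1 - s) * r t"
        using xy that by (intro add_mono mult_left_mono) (auto simp: box_def)
      finally show ?thesis by (simp add: algebra_simps)
    qed
    then show "(\<lambda>j\<in>J. s * x j + (1 - s) * y j) \<in> box (\<lambda>_. 0)" by (simp add: box_def space_gauss)
  qed
  from gauss_diff[OF J this] have "exp A * measure (gauss J) (box g') \<le> exp A * measure (gauss J) (box (\<lambda>_. 0))"
    by (rule mult_left_mono) simp
  with 1 have "measure (gauss J) (box g) \<le> exp A * measure (gauss J) (box (\<lambda>_. 0))" by linarith
  then show ?thesis by (simp add: A_def box_def b_def)
qed

section \<open>Orthonormal coordinates of a square integrable vector\<close>

lemma integrable_mult_of_squares: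
  fixes X Y :: "'a \<Rightarrow> real"
  assumes [measurable]: "X \<in> borel_measurable M" "Y \<in> borel_measurable M"
    and "integrable M (\<lambda>\<omega>. (X \<omega>)\<^sup>2)" "integrable M (\<lambda>\<omega>. (Y \<omega>)\<^sup>2)"
  shows "integrable M (\<lambda>\<omega>. X \<omega> * Y \<omega>)"
proof (rule Bochner_Integration.integrable_bound)
  show "integrable M (\<lambda>\<omega>. (X \<omega>)\<^sup>2 + (Y \<omega>)\<^sup>2)" using assms by simp
  have "a * b \<le> a\<^sup>2 + b\<^sup>2" if "a \<ge> 0" "b \<ge> 0" for a b :: real
    using sum_squares_bound[of a b] mult_nonneg_nonneg[OF that] by linarith
  from this[of "\<bar>_\<bar>" "\<bar>_\<bar>"] have "\<bar>x * y\<bar> \<le> x\<^sup>2 + y\<^sup>2" for x y :: real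
    by (simp add: abs_mult)
  then show "AE \<omega> in M. norm (X \<omega> * Y \<omega>) \<le> norm ((X \<omega>)\<^sup>2 + (Y \<omega>)\<^sup>2)"
    by (intro AE_I2) (smt (verit) real_norm_def zero_le_power2)
qed measurable

lemma integrable_square_sum:
  fixes X :: "'t \<Rightarrow> 'a \<Rightarrow> real"
  assumes "\<And>t. t \<in> F \<Longrightarrow> X t \<in> borel_measurable M" "\<And>t. t \<in> F \<Longrightarrow> integrable M (\<lambda>\<omega>. (X t \<omega>)\<^sup>2)"
  shows "integrable M (\<lambda>\<omega>. (\<Sum>t\<in>F. c t * X t \<omega>)\<^sup>2)"
    and "(LINT \<omega>|M. (\<Sum>t\<in>F. c t * X t \<omega>)\<^sup>2) = (\<Sum>s\<in>F. \<Sum>t\<in>F. c s * c t * (LINT \<omega>|M. X s \<omega> * X t \<omega>))"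
proof -
  have eq: "(\<Sum>t\<in>F. c t * X t \<omega>)\<^sup>2 = (\<Sum>s\<in>F. \<Sum>t\<in>F. c s * c t * (X s \<omega> * X t \<omega>))" for \<omega>
    by (simp add: power2_eq_square sum_product mult_ac)
  have int: "integrable M (\<lambda>\<omega>. c s * c t * (X s \<omega> * X t \<omega>))" if "s \<in> F" "t \<in> F" for s t
    using that assms by (intro integrable_mult_right integrable_mult_of_squares) auto
  show "integrable M (\<lambda>\<omega>. (\<Sum>t\<in>F. c t * X t \<omega>)\<^sup>2)"
    unfolding eq by (intro Bochner_Integration.integrable_sum int)
  show "(LINT \<omega>|M. (\<Sum>t\<in>F. c t * X t \<omega>)\<^sup>2) = (\<Sum>s\<in>F. \<Sum>t\<in>F. c s * c t * (LINT \<omega>|M. X s \<omega> * X t \<omega>))"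
    unfolding eq using int
    by (subst Bochner_Integration.integral_sum; (intro Bochner_Integration.integrable_sum sum.cong refl)?)
       (auto intro!: sum.cong simp: Bochner_Integration.integral_sum)
qed

text \<open>Supplies the matrix \<open>L\<close> of \<open>gauss_box_shift\<close> for an arbitrary
  covariance. A variable that depends linearly on the earlier ones contributes no new
  \<open>Y\<close>, and its representation then holds only almost everywhere.\<close>

lemma gram_schmidt_L2:
  fixes X :: "'t \<Rightarrow> 'a \<Rightarrow> real"
  assumes "finite F"
    and "\<And>t. t \<in> F \<Longrightarrow> X t \<in> borel_measurable M" "\<And>t. t \<in> F \<Longrightarrow> integrable M (\<lambda>\<omega>. (X t \<omega>)\<^sup>2)"
  shows "\<exists>(m::nat) Y L. (\<forall>j<m. \<exists>c. \<forall>\<omega>. Y j \<omega> = (\<Sum>t\<in>F. c t * X t \<omega>)) \<and>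
     (\<forall>i<m. \<forall>j<m. (LINT \<omega>|M. Y i \<omega> * Y j \<omega>) = (if i = j then 1 else 0)) \<and>
     (\<forall>t\<in>F. AE \<omega> in M. X t \<omega> = (\<Sum>j<m. L t j * Y j \<omega>))"
  using assms
proof (induction F rule: finite_induct)
  case empty
  show ?case by (intro exI[of _ 0]) auto
next
  case (insert x F)
  then obtain m Y L where span: "\<And>j. j < m \<Longrightarrow> \<exists>c. \<forall>\<omega>. Y j \<omega> = (\<Sum>t\<in>F. c t * X t \<omega>)"
    and orth: "\<And>i j. i < (m::nat) \<Longrightarrow> j < m \<Longrightarrow> (LINT \<omega>|M. Y i \<omega> * Y j \<omega>) = (if i = j then 1 else 0)"
    and repr: "\<And>t. t \<in> F \<Longrightarrow> AE \<omega> in M. X t \<omega> = (\<Sum>j<m. L t j * Y j \<omega>)"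
    by (smt (verit) insert_iff)
  have Xm: "X t \<in> borel_measurable M" and Xi: "integrable M (\<lambda>\<omega>. (X t \<omega>)\<^sup>2)" if "t \<in> insert x F" for t
    using insert.prems that by auto
  have Ym: "Y j \<in> borel_measurable M" and Yi: "integrable M (\<lambda>\<omega>. (Y j \<omega>)\<^sup>2)" if j: "j < m" for j
  proof -
    obtain c where c: "Y j = (\<lambda>\<omega>. \<Sum>t\<in>F. c t * X t \<omega>)" using span[OF j] by (auto simp: fun_eq_iff)
    show "Y j \<in> borel_measurable M" unfolding c using Xm by measurable
    show "integrable M (\<lambda>\<omega>. (Y j \<omega>)\<^sup>2)" unfolding c by (rule integrable_square_sum) (auto intro: Xm Xi)
  qed
  define q where "q j = (LINT \<omega>|M. X x \<omega> * Y j \<omega>)" for j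
  define \<rho> where "\<rho> \<omega> = X x \<omega> - (\<Sum>j<m. q j * Y j \<omega>)" for \<omega>
  have \<rho>m: "\<rho> \<in> borel_measurable M" unfolding \<rho>_def[abs_def] using Xm Ym by measurable
  have \<rho>i: "integrable M (\<lambda>\<omega>. (\<rho> \<omega>)\<^sup>2)"
  proof -
    have "integrable M (\<lambda>\<omega>. (X x \<omega>)\<^sup>2 + (\<Sum>j<m. q j * Y j \<omega>)\<^sup>2 - 2 * (X x \<omega> * (\<Sum>j<m. q j * Y j \<omega>)))"
      using Xm Xi Ym Yi
      by (intro Bochner_Integration.integrable_diff Bochner_Integration.integrable_add integrable_mult_right
          integrable_mult_of_squares integrable_square_sum) auto
    then show ?thesis by (simp add: \<rho>_def power2_diff mult.assoc)
  qed
  have \<rho>Y: "(LINT \<omega>|M. \<rho> \<omega> * Y i \<omega>) = 0" if i: "i < m" for i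
  proof -
    have YY: "integrable M (\<lambda>\<omega>. Y j \<omega> * Y i \<omega>)" if "j < m" for j
      using that i by (intro integrable_mult_of_squares Ym Yi)
    have "(LINT \<omega>|M. \<rho> \<omega> * Y i \<omega>) = (LINT \<omega>|M. X x \<omega> * Y i \<omega> - (\<Sum>j<m. q j * (Y j \<omega> * Y i \<omega>)))"
      by (simp add: \<rho>_def left_diff_distrib sum_distrib_right mult.assoc)
    also have "\<dots> = q i - (\<Sum>j<m. q j * (LINT \<omega>|M. Y j \<omega> * Y i \<omega>))"
    proof (subst Bochner_Integration.integral_diff)
      show "integrable M (\<lambda>\<omega>. X x \<omega> * Y i \<omega>)" using i by (intro integrable_mult_of_squares Xm Xi Ym Yi) auto
      show "integrable M (\<lambda>\<omega>. \<Sum>j<m. q j * (Y j \<omega> * Y i \<omega>))"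
        by (intro Bochner_Integration.integrable_sum integrable_mult_right YY) simp
      have "(LINT \<omega>|M. (\<Sum>j<m. q j * (Y j \<omega> * Y i \<omega>))) = (\<Sum>j<m. q j * (LINT \<omega>|M. Y j \<omega> * Y i \<omega>))"
        by (subst Bochner_Integration.integral_sum) (auto intro!: integrable_mult_right YY)
      then show "(LINT \<omega>|M. X x \<omega> * Y i \<omega>) - (LINT \<omega>|M. (\<Sum>j<m. q j * (Y j \<omega> * Y i \<omega>)))
        = q i - (\<Sum>j<m. q j * (LINT \<omega>|M. Y j \<omega> * Y i \<omega>))" by (simp add: q_def)
    qed
    also have "(\<Sum>j<m. q j * (LINT \<omega>|M. Y j \<omega> * Y i \<omega>)) = (\<Sum>j<m. if j = i then q j else 0)"
      by (intro sum.cong refl) (use orth i in auto)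
    also have "\<dots> = q i" using i by simp
    finally show ?thesis by simp
  qed
  have spanF: "\<exists>c. \<forall>\<omega>. Y j \<omega> = (\<Sum>t\<in>insert x F. c t * X t \<omega>)" if j: "j < m" for j
  proof -
    obtain c where "\<forall>\<omega>. Y j \<omega> = (\<Sum>t\<in>F. c t * X t \<omega>)" using span[OF j] by auto
    then have "\<forall>\<omega>. Y j \<omega> = (\<Sum>t\<in>insert x F. (if t = x then 0 else c t) * X t \<omega>)"
      using insert.hyps by (auto intro!: sum.cong)
    then show ?thesis by (intro exI[of _ "\<lambda>t. if t = x then 0 else c t"])
  qed
  show ?case
  proof (cases "(LINT \<omega>|M. (\<rho> \<omega>)\<^sup>2) = 0")
    case True
    then have "AE \<omega> in M. (\<rho> \<omega>)\<^sup>2 = 0" by (subst (asm) integral_nonneg_eq_0_iff_AE) (auto intro: \<rho>i)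
    then have "AE \<omega> in M. X x \<omega> = (\<Sum>j<m. q j * Y j \<omega>)" by eventually_elim (simp add: \<rho>_def)
    then have "\<forall>t\<in>insert x F. AE \<omega> in M. X t \<omega> = (\<Sum>j<m. (L(x := q)) t j * Y j \<omega>)"
      using repr insert.hyps by auto
    then show ?thesis using spanF orth by (intro exI[of _ m] exI[of _ Y] exI[of _ "L(x := q)"]) auto
  next
    case False
    define s where "s = sqrt (LINT \<omega>|M. (\<rho> \<omega>)\<^sup>2)"
    have "(LINT \<omega>|M. (\<rho> \<omega>)\<^sup>2) > 0" using False by (simp add: less_le)
    then have s: "s > 0" "s\<^sup>2 = (LINT \<omega>|M. (\<rho> \<omega>)\<^sup>2)" by (auto simp: s_def)
    define Y' where "Y' j \<omega> = (if j < m then Y j \<omega> else \<rho> \<omega> / s)" for j \<omega>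
    define L' where "L' t j = (if j < m then (if t = x then q j else L t j) else if t = x then s else 0)" for t j
    have "\<exists>c. \<forall>\<omega>. Y' j \<omega> = (\<Sum>t\<in>insert x F. c t * X t \<omega>)" if "j < Suc m" for j
    proof (cases "j < m")
      case True then show ?thesis using spanF[OF True] by (simp add: Y'_def)
    next
      case False
      obtain c where c: "\<And>i \<omega>. i < m \<Longrightarrow> Y i \<omega> = (\<Sum>t\<in>F. c i t * X t \<omega>)" using span by metis
      have "Y' j \<omega> = (\<Sum>t\<in>insert x F. (if t = x then 1 / s else - (\<Sum>i<m. q i * c i t) / s) * X t \<omega>)" for \<omega>
      proof -
        have "(\<Sum>i<m. q i * Y i \<omega>) = (\<Sum>t\<in>F. (\<Sum>i<m. q i * c i t) * X t \<omega>)"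
          by (simp add: c sum_distrib_left sum_distrib_right mult.assoc) (rule sum.swap)
        then have "Y' j \<omega> = 1 / s * X x \<omega> + (\<Sum>t\<in>F. (- (\<Sum>i<m. q i * c i t) / s) * X t \<omega>)"
          using False by (simp add: Y'_def \<rho>_def diff_divide_distrib sum_negf flip: sum_divide_distrib)
        also have "(\<Sum>t\<in>F. (- (\<Sum>i<m. q i * c i t) / s) * X t \<omega>) = (\<Sum>t\<in>F. (if t = x then 1 / s else - (\<Sum>i<m. q i * c i t) / s) * X t \<omega>)"
          using insert.hyps by (intro sum.cong) auto
        finally show ?thesis using insert.hyps by simp
      qed
      then show ?thesis by (intro exI[of _ "\<lambda>t. if t = x then 1 / s else - (\<Sum>i<m. q i * c i t) / s"]) blast
    qed
    moreover have "(LINT \<omega>|M. Y' i \<omega> * Y' j \<omega>) = (if i = j then 1 else 0)" if "i < Suc m" "j < Suc m" for i j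
    proof -
      have "(LINT \<omega>|M. \<rho> \<omega> * \<rho> \<omega>) = s\<^sup>2" unfolding s by (simp add: power2_eq_square)
      moreover have "(LINT \<omega>|M. Y i \<omega> * \<rho> \<omega>) = 0" if "i < m" for i using \<rho>Y[OF that] by (simp add: mult.commute)
      ultimately show ?thesis using that s(1) orth \<rho>Y by (auto simp: Y'_def power2_eq_square less_Suc_eq)
    qed
    moreover have "AE \<omega> in M. X t \<omega> = (\<Sum>j<Suc m. L' t j * Y' j \<omega>)" if "t \<in> insert x F" for t
    proof (cases "t = x")
      case True
      have "X t \<omega> = (\<Sum>j<Suc m. L' t j * Y' j \<omega>)" for \<omega>
        using s(1) by (simp add: True L'_def Y'_def \<rho>_def)
      then show ?thesis by simp
    next
      case False
      then show ?thesis using repr[of t] that by (simp add: L'_def Y'_def)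
    qed
    ultimately show ?thesis by (intro exI[of _ "Suc m"] exI[of _ Y'] exI[of _ L']) blast
  qed
qed

text \<open>The characteristic function of a linear combination depends only on its variance. Hence
  the orthonormal coordinates from \<open>gram_schmidt_L2\<close> have the law \<open>gauss\<close>,
  and the finite-dimensional bound can be pulled back.\<close>

lemma (in prob_space) gaussian_box_shift:
  fixes X :: "'t \<Rightarrow> 'a \<Rightarrow> real"
  assumes F: "finite F"
    and Xm: "\<And>t. t \<in> F \<Longrightarrow> X t \<in> borel_measurable M" and Xi: "\<And>t. t \<in> F \<Longrightarrow> integrable M (\<lambda>\<omega>. (X t \<omega>)\<^sup>2)"
    and char: "\<And>u. (CLINT \<omega>|M. iexp (\<Sum>t\<in>F. u t * X t \<omega>)) = exp (- (LINT \<omega>|M. (\<Sum>t\<in>F. u t * X t \<omega>)\<^sup>2) / 2)"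
  shows "prob {\<omega> \<in> space M. \<forall>t\<in>F. \<bar>X t \<omega> + g t\<bar> \<le> r t}
    \<le> exp ((\<Sum>t\<in>F. \<bar>a t\<bar> * r t) - (\<Sum>t\<in>F. a t * g t) + (LINT \<omega>|M. (\<Sum>t\<in>F. a t * X t \<omega>)\<^sup>2) / 2)
      * prob {\<omega> \<in> space M. \<forall>t\<in>F. \<bar>X t \<omega>\<bar> \<le> r t}"
proof -
  obtain m :: nat and Y L where span': "\<forall>j<m. \<exists>c. \<forall>\<omega>. Y j \<omega> = (\<Sum>t\<in>F. c t * X t \<omega>)"
    and orth': "\<forall>i<m. \<forall>j<m. (LINT \<omega>|M. Y i \<omega> * Y j \<omega>) = (if i = j then 1 else 0)"
    and repr': "\<forall>t\<in>F. AE \<omega> in M. X t \<omega> = (\<Sum>j<m. L t j * Y j \<omega>)"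
    using gram_schmidt_L2[of F X M, OF F Xm Xi] by blast
  note span = span'[rule_format] and orth = orth'[rule_format] and repr = repr'[rule_format]
  obtain c where c: "\<And>j \<omega>. j < m \<Longrightarrow> Y j \<omega> = (\<Sum>t\<in>F. c j t * X t \<omega>)" using span by metis
  have Ym: "Y j \<in> borel_measurable M" and Yi: "integrable M (\<lambda>\<omega>. (Y j \<omega>)\<^sup>2)" if j: "j < m" for j
  proof -
    have c: "Y j = (\<lambda>\<omega>. \<Sum>t\<in>F. c j t * X t \<omega>)" using c[OF j] by (auto simp: fun_eq_iff)
    show "Y j \<in> borel_measurable M" unfolding c using Xm by measurable
    show "integrable M (\<lambda>\<omega>. (Y j \<omega>)\<^sup>2)" unfolding c by (rule integrable_square_sum) (auto intro: Xm Xi)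
  qed
  have var: "(LINT \<omega>|M. (\<Sum>j<m. w j * Y j \<omega>)\<^sup>2) = (\<Sum>j<m. (w j)\<^sup>2)" for w
  proof -
    have "(LINT \<omega>|M. (\<Sum>j<m. w j * Y j \<omega>)\<^sup>2) = (\<Sum>i<m. \<Sum>j<m. w i * w j * (LINT \<omega>|M. Y i \<omega> * Y j \<omega>))"
      by (rule integrable_square_sum) (auto intro: Ym Yi)
    also have "\<dots> = (\<Sum>i<m. \<Sum>j<m. if j = i then w i * w j else 0)"
      by (intro sum.cong refl) (auto simp: orth)
    finally show ?thesis by (simp add: power2_eq_square)
  qed
  have law: "distr M (Pi\<^sub>M {..<m} (\<lambda>_. borel)) (\<lambda>\<omega>. \<lambda>j\<in>{..<m}. Y j \<omega>) = gauss {..<m}"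
  proof -
    have "distr M (Pi\<^sub>M {..<m} (\<lambda>_. borel)) (\<lambda>\<omega>. \<lambda>j\<in>{..<m}. Y j \<omega>)
      = distr (gauss {..<m}) (Pi\<^sub>M {..<m} (\<lambda>_. borel)) (\<lambda>z. \<lambda>j\<in>{..<m}. z j)"
    proof (rule distr_PiM_eq_of_iexp)
      fix w
      have *: "(\<Sum>j<m. w j * Y j \<omega>) = (\<Sum>t\<in>F. (\<Sum>j<m. w j * c j t) * X t \<omega>)" for \<omega>
        by (simp add: c sum_distrib_left sum_distrib_right mult.assoc) (rule sum.swap)
      have "(CLINT \<omega>|M. iexp (\<Sum>j<m. w j * Y j \<omega>)) = exp (- (\<Sum>j<m. (w j)\<^sup>2) / 2)"
        using char[of "\<lambda>t. \<Sum>j<m. w j * c j t"] var[of w] unfolding * by simp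
      then show "(CLINT \<omega>|M. iexp (\<Sum>j<m. w j * Y j \<omega>)) = (CLINT z|gauss {..<m}. iexp (\<Sum>j<m. w j * z j))"
        by (simp only: integral_gauss_iexp[OF finite_lessThan])
    qed (auto intro: Ym prob_space.finite_measure[OF prob_space_gauss] finite_measure_axioms)
    also have "\<dots> = distr (gauss {..<m}) (gauss {..<m}) (\<lambda>z. z)"
      by (rule distr_cong) (auto simp: sets_gauss space_gauss extensional_restrict)
    finally show ?thesis by simp
  qed
  have eq: "prob {\<omega> \<in> space M. \<forall>t\<in>F. \<bar>X t \<omega> + h t\<bar> \<le> r t} =
    measure (gauss {..<m}) {z \<in> space (gauss {..<m}). \<forall>t\<in>F. \<bar>(\<Sum>j<m. L t j * z j) + h t\<bar> \<le> r t}" for h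
  proof -
    let ?B = "{z \<in> space (gauss {..<m}). \<forall>t\<in>F. \<bar>(\<Sum>j<m. L t j * z j) + h t\<bar> \<le> r t}"
    have lin: "(\<lambda>z. \<Sum>j<m. L t j * z j) \<in> borel_measurable (Pi\<^sub>M {..<m} (\<lambda>_. borel))" for t
      by measurable
    have B: "?B \<in> sets (Pi\<^sub>M {..<m} (\<lambda>_. borel))"
      unfolding sets_gauss[symmetric] using F lin by measurable
    have mY: "(\<lambda>\<omega>. \<lambda>j\<in>{..<m}. Y j \<omega>) \<in> M \<rightarrow>\<^sub>M Pi\<^sub>M {..<m} (\<lambda>_. borel)"
      by (intro measurable_restrict Ym) simp
    have ae: "AE \<omega> in M. \<forall>t\<in>F. X t \<omega> = (\<Sum>j<m. L t j * Y j \<omega>)"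
      using F repr by (rule AE_finite_allI)
    have "measure (gauss {..<m}) ?B = prob ((\<lambda>\<omega>. \<lambda>j\<in>{..<m}. Y j \<omega>) -` ?B \<inter> space M)"
      by (subst law[symmetric]) (rule measure_distr[OF mY B])
    also have "\<dots> = prob {\<omega> \<in> space M. \<forall>t\<in>F. \<bar>X t \<omega> + h t\<bar> \<le> r t}"
    proof (rule finite_measure_eq_AE)
      show "AE \<omega> in M. (\<omega> \<in> (\<lambda>\<omega>. \<lambda>j\<in>{..<m}. Y j \<omega>) -` ?B \<inter> space M) = (\<omega> \<in> {\<omega> \<in> space M. \<forall>t\<in>F. \<bar>X t \<omega> + h t\<bar> \<le> r t})"
        using ae by eventually_elim (auto simp: space_gauss)
      show "{\<omega> \<in> space M. \<forall>t\<in>F. \<bar>X t \<omega> + h t\<bar> \<le> r t} \<in> sets M" using F Xm by measurable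
    qed (rule measurable_sets[OF mY B])
    finally show ?thesis by simp
  qed
  have "(LINT \<omega>|M. (\<Sum>t\<in>F. a t * X t \<omega>)\<^sup>2) = (LINT \<omega>|M. (\<Sum>j<m. (\<Sum>t\<in>F. a t * L t j) * Y j \<omega>)\<^sup>2)"
  proof (rule integral_cong_AE)
    have ae: "AE \<omega> in M. \<forall>t\<in>F. X t \<omega> = (\<Sum>j<m. L t j * Y j \<omega>)"
      using F repr by (rule AE_finite_allI)
    then show "AE \<omega> in M. (\<Sum>t\<in>F. a t * X t \<omega>)\<^sup>2 = (\<Sum>j<m. (\<Sum>t\<in>F. a t * L t j) * Y j \<omega>)\<^sup>2"
    proof eventually_elim
      case (elim \<omega>)
      have "(\<Sum>t\<in>F. a t * X t \<omega>) = (\<Sum>t\<in>F. \<Sum>j<m. a t * L t j * Y j \<omega>)"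
        using elim by (intro sum.cong refl) (simp add: sum_distrib_left mult.assoc)
      also have "\<dots> = (\<Sum>j<m. (\<Sum>t\<in>F. a t * L t j) * Y j \<omega>)"
        by (subst sum.swap) (simp add: sum_distrib_right)
      finally show ?case by simp
    qed
  qed (use Xm Ym in measurable)
  also have "\<dots> = (\<Sum>j<m. (\<Sum>t\<in>F. a t * L t j)\<^sup>2)" by (rule var)
  finally have v: "(LINT \<omega>|M. (\<Sum>t\<in>F. a t * X t \<omega>)\<^sup>2) = (\<Sum>j<m. (\<Sum>t\<in>F. a t * L t j)\<^sup>2)" .
  show ?thesis
    using gauss_box_shift[OF finite_lessThan F, of m L g r a] eq[of g] eq[of "\<lambda>_. 0"] v by simp
qed

section \<open>The mixed process\<close>

lemma (in prob_space) distr_eq_std_normal_moments: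
  assumes [measurable]: "Z \<in> borel_measurable M" and Z: "distr M borel Z = std_normal_distribution"
  shows "integrable M Z" "integrable M (\<lambda>\<omega>. (Z \<omega>)\<^sup>2)" "expectation Z = 0" "expectation (\<lambda>\<omega>. (Z \<omega>)\<^sup>2) = 1"
    and "(CLINT \<omega>|M. iexp (\<theta> * Z \<omega>)) = exp (- \<theta>\<^sup>2 / 2)"
proof -
  have i: "integrable (distr M borel Z) (\<lambda>x. x ^ k)" for k
    unfolding Z by (rule integrable_std_normal_distribution_moment)
  show "integrable M Z" using i[of 1] by (subst (asm) integrable_distr_eq) auto
  show "integrable M (\<lambda>\<omega>. (Z \<omega>)\<^sup>2)" using i[of 2] by (subst (asm) integrable_distr_eq) auto
  have "integral\<^sup>L (distr M borel Z) (\<lambda>x. x ^ 1) = 0"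
    unfolding Z by (rule integral_std_normal_distribution_moment_odd) simp
  then show "expectation Z = 0" by (subst (asm) integral_distr) auto
  have "integral\<^sup>L (distr M borel Z) (\<lambda>x. x ^ (2 * 1)) = 1"
    unfolding Z using std_normal_distribution_even_moments[of 1] by (simp add: has_bochner_integral_iff)
  then show "expectation (\<lambda>\<omega>. (Z \<omega>)\<^sup>2) = 1" by (subst (asm) integral_distr) auto
  have "char (distr M borel Z) \<theta> = exp (- \<theta>\<^sup>2 / 2)" unfolding Z char_std_normal_distribution by simp
  then show "(CLINT \<omega>|M. iexp (\<theta> * Z \<omega>)) = exp (- \<theta>\<^sup>2 / 2)"
    unfolding char_def by (subst (asm) integral_distr) auto
qed

lemma (in prob_space) distributed_normal_distr:
  assumes s: "0 < \<sigma>" and X: "distributed M lborel X (normal_density \<mu> \<sigma>)"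
  shows "(\<lambda>\<omega>. (X \<omega> - \<mu>) / \<sigma>) \<in> borel_measurable M" "distr M borel (\<lambda>\<omega>. (X \<omega> - \<mu>) / \<sigma>) = std_normal_distribution"
proof -
  have d: "distributed M lborel (\<lambda>\<omega>. (X \<omega> - \<mu>) / \<sigma>) std_normal_density"
    using X normal_standard_normal_convert[OF s, of X \<mu>] by simp
  show "(\<lambda>\<omega>. (X \<omega> - \<mu>) / \<sigma>) \<in> borel_measurable M" using distributed_measurable[OF d] by simp
  show "distr M borel (\<lambda>\<omega>. (X \<omega> - \<mu>) / \<sigma>) = std_normal_distribution"
    using distributed_distr_eq_density[OF d] distr_cong[OF refl sets_lborel[symmetric], of M "\<lambda>\<omega>. (X \<omega> - \<mu>) / \<sigma>"]
    by simp
qed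

text \<open>A point mass has no density and is treated separately; with mean zero it sits at 0,
  where the formula holds with variance 0.\<close>

lemma (in prob_space) gaussian_rv_square_integrable:
  assumes X: "gaussian_rv M X"
  shows "integrable M X" "integrable M (\<lambda>\<omega>. (X \<omega>)\<^sup>2)"
    and "expectation X = 0 \<Longrightarrow> (CLINT \<omega>|M. iexp (X \<omega>)) = exp (- expectation (\<lambda>\<omega>. (X \<omega>)\<^sup>2) / 2)"
proof -
  have [measurable]: "X \<in> borel_measurable M" using X by (simp add: gaussian_rv_def)
  consider (n) \<mu> \<sigma> where "\<sigma> > 0" "distributed M lborel X (normal_density \<mu> \<sigma>)" | (c) \<mu> where "AE \<omega> in M. X \<omega> = \<mu>"
    using X by (auto simp: gaussian_rv_def)
  then have "integrable M X \<and> integrable M (\<lambda>\<omega>. (X \<omega>)\<^sup>2) \<and>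
    (expectation X = 0 \<longrightarrow> (CLINT \<omega>|M. iexp (X \<omega>)) = exp (- expectation (\<lambda>\<omega>. (X \<omega>)\<^sup>2) / 2))"
  proof cases
    case n
    define Z where "Z \<omega> = (X \<omega> - \<mu>) / \<sigma>" for \<omega>
    note Z = distr_eq_std_normal_moments[OF distributed_normal_distr[OF n], folded Z_def]
    have XZ: "X = (\<lambda>\<omega>. \<mu> + \<sigma> * Z \<omega>)" using n(1) by (auto simp: Z_def fun_eq_iff)
    have Z2: "(\<mu> + \<sigma> * Z \<omega>)\<^sup>2 = \<mu>\<^sup>2 + (2 * \<mu> * \<sigma>) * Z \<omega> + \<sigma>\<^sup>2 * (Z \<omega>)\<^sup>2" for \<omega>
      by (simp add: power2_sum power_mult_distrib)
    have i: "integrable M X" "integrable M (\<lambda>\<omega>. (X \<omega>)\<^sup>2)" unfolding XZ Z2 using Z(1,2) by simp_all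
    have "expectation X = \<mu>" unfolding XZ using Z(1,3) by (simp add: prob_space)
    moreover have "(CLINT \<omega>|M. iexp (X \<omega>)) = exp (- expectation (\<lambda>\<omega>. (X \<omega>)\<^sup>2) / 2)" if "\<mu> = 0"
    proof -
      have "expectation (\<lambda>\<omega>. (X \<omega>)\<^sup>2) = \<sigma>\<^sup>2" unfolding XZ using that Z(4) by (simp add: power_mult_distrib)
      moreover have "(CLINT \<omega>|M. iexp (X \<omega>)) = exp (- \<sigma>\<^sup>2 / 2)" using Z(5)[of \<sigma>] that by (simp add: XZ)
      ultimately show ?thesis by simp
    qed
    ultimately show ?thesis using i by auto
  next
    case c
    from c have c2: "AE \<omega> in M. (X \<omega>)\<^sup>2 = \<mu>\<^sup>2" and c3: "AE \<omega> in M. iexp (X \<omega>) = iexp \<mu>"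
      by (eventually_elim, simp)+
    have "integrable M X" by (rule integrable_cong_AE[THEN iffD2, OF _ _ c]) auto
    moreover have "integrable M (\<lambda>\<omega>. (X \<omega>)\<^sup>2)" by (rule integrable_cong_AE[THEN iffD2, OF _ _ c2]) auto
    moreover have "expectation X = \<mu>" using integral_cong_AE[OF _ _ c] by (simp add: prob_space)
    moreover have "expectation (\<lambda>\<omega>. (X \<omega>)\<^sup>2) = \<mu>\<^sup>2" using integral_cong_AE[OF _ _ c2] by (simp add: prob_space)
    moreover have "(CLINT \<omega>|M. iexp (X \<omega>)) = iexp \<mu>" using integral_cong_AE[OF _ _ c3] by (simp add: prob_space)
    ultimately show ?thesis by simp
  qed
  then show "integrable M X" "integrable M (\<lambda>\<omega>. (X \<omega>)\<^sup>2)"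
    "expectation X = 0 \<Longrightarrow> (CLINT \<omega>|M. iexp (X \<omega>)) = exp (- expectation (\<lambda>\<omega>. (X \<omega>)\<^sup>2) / 2)" by auto
qed

text \<open>Linear functionals of the sum of the two processes are reached through their
  characteristic functions. Comparison with the standard normal law recovers the second moment from
  these.\<close>

lemma (in prob_space) variance_of_gaussian_iexp:
  assumes [measurable]: "Y \<in> borel_measurable M"
    and char: "\<And>\<theta>. (CLINT \<omega>|M. iexp (\<theta> * Y \<omega>)) = exp (- (\<theta>\<^sup>2 * c) / 2)"
  shows "integrable M (\<lambda>\<omega>. (Y \<omega>)\<^sup>2)" "expectation (\<lambda>\<omega>. (Y \<omega>)\<^sup>2) = c"
proof -
  have rd: "real_distribution (distr M borel Z)" if "Z \<in> borel_measurable M" for Z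
    using that by (rule real_distribution_distr)
  have charZ: "char (distr M borel Z) \<theta> = (CLINT \<omega>|M. iexp (\<theta> * Z \<omega>))" if "Z \<in> borel_measurable M" for Z \<theta>
    unfolding char_def using that by (subst integral_distr) auto
  \<comment> \<open>Characteristic functions are bounded by 1, which forces \<open>c\<close> to be
    nonnegative.\<close>
  have "cmod (exp (- (1\<^sup>2 * c) / 2)) \<le> 1"
    using real_distribution.cmod_char_le_1[OF rd, of Y 1] charZ[of Y 1] char[of 1] by simp
  then have "c \<ge> 0" by simp
  then consider "c = 0" | "c > 0" by linarith
  then have "integrable M (\<lambda>\<omega>. (Y \<omega>)\<^sup>2) \<and> expectation (\<lambda>\<omega>. (Y \<omega>)\<^sup>2) = c"
  proof cases
    case 1
    have "distr M borel Y = distr M borel (\<lambda>_. 0)"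
      by (rule Levy_uniqueness[OF rd rd ext]; (simp only: charZ[OF assms(1)] charZ[OF borel_measurable_const] char 1)?)
        (simp_all add: prob_space)
    moreover have "AE x in distr M borel (\<lambda>_. 0 :: real). x = 0" by (subst AE_distr_iff) auto
    ultimately have "AE x in distr M borel Y. x = 0" by (simp only:)
    then have "AE \<omega> in M. Y \<omega> = 0" by (subst (asm) AE_distr_iff) auto
    then have ae: "AE \<omega> in M. (Y \<omega>)\<^sup>2 = 0" by eventually_elim simp
    have "integrable M (\<lambda>\<omega>. (Y \<omega>)\<^sup>2)" by (rule integrable_cong_AE[THEN iffD2, OF _ _ ae]) auto
    moreover have "expectation (\<lambda>\<omega>. (Y \<omega>)\<^sup>2) = 0" using integral_cong_AE[OF _ _ ae] by simp
    ultimately show ?thesis using 1 by simp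
  next
    case 2
    define Z where "Z \<omega> = Y \<omega> / sqrt c" for \<omega>
    have Zm [measurable]: "Z \<in> borel_measurable M" unfolding Z_def[abs_def] by measurable
    have "char (distr M borel Z) \<theta> = char std_normal_distribution \<theta>" for \<theta>
      using 2 char[of "\<theta> / sqrt c"] unfolding charZ[OF Zm] char_std_normal_distribution
      by (simp add: Z_def power_divide)
    then have "distr M borel Z = std_normal_distribution"
      by (intro Levy_uniqueness rd real_dist_normal_dist ext) auto
    note Z = distr_eq_std_normal_moments[OF Zm this]
    have "(Y \<omega>)\<^sup>2 = c * (Z \<omega>)\<^sup>2" for \<omega> using 2 by (simp add: Z_def power_divide)
    then show ?thesis using Z(2,4) by simp
  qed
  then show "integrable M (\<lambda>\<omega>. (Y \<omega>)\<^sup>2)" "expectation (\<lambda>\<omega>. (Y \<omega>)\<^sup>2) = c" by auto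
qed

lemma (in prob_space) fractional_brownian_motion_iexp:
  assumes B: "fractional_brownian_motion M I H B" and F: "finite F" "F \<subseteq> I"
  shows "(CLINT \<omega>|M. iexp (\<Sum>t\<in>F. u t * B t \<omega>)) =
    exp (- (\<Sum>s\<in>F. \<Sum>t\<in>F. u s * u t * ((s powr (2 * H) + t powr (2 * H) - \<bar>s - t\<bar> powr (2 * H)) / 2)) / 2)"
proof -
  have c: "centered_gaussian_process M I B" using B by (simp add: fractional_brownian_motion_def)
  have g: "gaussian_rv M (\<lambda>\<omega>. \<Sum>t\<in>J. a t * B t \<omega>)" if "finite J" "J \<subseteq> I" for J a
    using c that by (simp add: centered_gaussian_process_def)
  have g1: "gaussian_rv M (B t)" if "t \<in> I" for t
    using g[of "{t}" "\<lambda>_. 1"] that by simp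
  note sq = gaussian_rv_square_integrable[OF g1]
  have Bm: "B t \<in> borel_measurable M" if "t \<in> I" for t
    using g1[OF that] by (simp add: gaussian_rv_def)
  have "expectation (\<lambda>\<omega>. \<Sum>t\<in>F. u t * B t \<omega>) = (\<Sum>t\<in>F. u t * expectation (B t))"
    using F sq(1) by (subst Bochner_Integration.integral_sum) auto
  also have "\<dots> = 0"
  proof (intro sum.neutral ballI)
    fix t assume "t \<in> F"
    then have "expectation (B t) = 0" using c F(2) unfolding centered_gaussian_process_def by blast
    then show "u t * expectation (B t) = 0" by simp
  qed
  finally have "(CLINT \<omega>|M. iexp (\<Sum>t\<in>F. u t * B t \<omega>)) = exp (- expectation (\<lambda>\<omega>. (\<Sum>t\<in>F. u t * B t \<omega>)\<^sup>2) / 2)"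
    by (rule gaussian_rv_square_integrable(3)[OF g[OF F]])
  also have "expectation (\<lambda>\<omega>. (\<Sum>t\<in>F. u t * B t \<omega>)\<^sup>2) = (\<Sum>s\<in>F. \<Sum>t\<in>F. u s * u t * expectation (\<lambda>\<omega>. B s \<omega> * B t \<omega>))"
    by (rule integrable_square_sum) (use F Bm sq in auto)
  also have "\<dots> = (\<Sum>s\<in>F. \<Sum>t\<in>F. u s * u t * ((s powr (2 * H) + t powr (2 * H) - \<bar>s - t\<bar> powr (2 * H)) / 2))"
    using B F by (intro sum.cong refl) (auto simp: fractional_brownian_motion_def subset_iff)
  finally show ?thesis .
qed

text \<open>Summation by parts rewrites the functional in independent increments, with the tail sums
  of \<open>v\<close> as coefficients \<open>d\<close>. The lengths \<open>\<tau> j\<close> of the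
  intervals below two times add up to the smaller of them, which produces
  \<open>min\<close>.\<close>

lemma (in prob_space) wiener_process_iexp_sorted:
  fixes t :: "nat \<Rightarrow> real"
  assumes W: "wiener_process M I W" and t: "\<And>i. i \<le> n \<Longrightarrow> t i \<in> I" "\<And>i. i < n \<Longrightarrow> t i < t (Suc i)" and t0: "t 0 = 0"
  shows "(CLINT \<omega>|M. iexp (\<Sum>i\<le>n. v i * W (t i) \<omega>)) = exp (- (\<Sum>i\<le>n. \<Sum>k\<le>n. v i * v k * min (t i) (t k)) / 2)"
proof -
  define D where "D j \<omega> = W (t (Suc j)) \<omega> - W (t j) \<omega>" for j \<omega>
  define d where "d j = (\<Sum>i\<le>n. if j < i then v i else 0)" for j
  define \<tau> where "\<tau> j = t (Suc j) - t j" for j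
  have Wm: "W s \<in> borel_measurable M" if "s \<in> I" for s using W that by (simp add: wiener_process_def)
  have [measurable]: "W (t i) \<in> borel_measurable M" if "i \<le> n" for i using Wm t(1)[OF that] .
  have Dm: "D j \<in> borel_measurable M" if "j < n" for j
    unfolding D_def[abs_def] using that by (intro borel_measurable_diff Wm t) auto
  have \<tau>: "\<tau> j > 0" if "j < n" for j using t(2)[OF that] by (simp add: \<tau>_def)
  have ind: "indep_vars (\<lambda>_. borel) D {..<n}"
    using W t unfolding wiener_process_def D_def[abs_def] by blast
  have "AE \<omega> in M. W 0 \<omega> = 0" using W by (simp add: wiener_process_def)
  then have ae: "AE \<omega> in M. (\<Sum>i\<le>n. v i * W (t i) \<omega>) = (\<Sum>j<n. d j * D j \<omega>)"
  proof eventually_elim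
    case (elim \<omega>)
    have "W (t i) \<omega> = (\<Sum>j<i. D j \<omega>)" for i
      using elim t0 sum_lessThan_telescope[of "\<lambda>j. W (t j) \<omega>" i] by (simp add: D_def)
    then have *: "W (t i) \<omega> = (\<Sum>j<n. if j < i then D j \<omega> else 0)" if "i \<le> n" for i
      using that by (simp add: sum.If_cases) (intro sum.cong, auto)
    have "(\<Sum>i\<le>n. v i * W (t i) \<omega>) = (\<Sum>i\<le>n. \<Sum>j<n. if j < i then v i * D j \<omega> else 0)"
      by (intro sum.cong refl) (auto simp: * sum_distrib_left intro!: sum.cong)
    also have "\<dots> = (\<Sum>j<n. \<Sum>i\<le>n. if j < i then v i * D j \<omega> else 0)" by (rule sum.swap)
    also have "\<dots> = (\<Sum>j<n. d j * D j \<omega>)"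
      unfolding d_def sum_distrib_right by (intro sum.cong refl) auto
    finally show ?case .
  qed
  have charD: "(CLINT \<omega>|M. iexp (d j * D j \<omega>)) = exp (- ((d j)\<^sup>2 * \<tau> j) / 2)" if j: "j < n" for j
  proof -
    have dist: "distributed M lborel (D j) (normal_density 0 (sqrt (\<tau> j)))"
      using W t(1)[of j] t(1)[of "Suc j"] t(2)[of j] j unfolding wiener_process_def D_def[abs_def] \<tau>_def by simp
    have s: "sqrt (\<tau> j) > 0" using \<tau>[OF j] by simp
    show ?thesis
      using distr_eq_std_normal_moments(5)[OF distributed_normal_distr[OF s dist], of "d j * sqrt (\<tau> j)"] s \<tau>[OF j]
      by (simp add: power_mult_distrib)
  qed
  have ind': "indep_vars (\<lambda>_. borel) (\<lambda>j \<omega>. d j * D j \<omega>) {..<n}"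
    by (rule indep_vars_compose2[OF ind]) measurable
  have "(CLINT \<omega>|M. iexp (\<Sum>i\<le>n. v i * W (t i) \<omega>)) = (CLINT \<omega>|M. iexp (\<Sum>j<n. d j * D j \<omega>))"
  proof (rule integral_cong_AE)
    show "AE \<omega> in M. iexp (\<Sum>i\<le>n. v i * W (t i) \<omega>) = iexp (\<Sum>j<n. d j * D j \<omega>)"
      using ae by eventually_elim simp
  qed (use Dm in measurable)
  also have "\<dots> = char (distr M borel (\<lambda>\<omega>. \<Sum>j<n. d j * D j \<omega>)) 1"
    unfolding char_def using Dm by (subst integral_distr) auto
  also have "\<dots> = (\<Prod>j<n. char (distr M borel (\<lambda>\<omega>. d j * D j \<omega>)) 1)"
    by (rule char_distr_sum[OF ind'])
  also have "\<dots> = (\<Prod>j<n. complex_of_real (exp (- ((d j)\<^sup>2 * \<tau> j) / 2)))"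
  proof (intro prod.cong refl)
    fix j assume "j \<in> {..<n}"
    then show "char (distr M borel (\<lambda>\<omega>. d j * D j \<omega>)) 1 = complex_of_real (exp (- ((d j)\<^sup>2 * \<tau> j) / 2))"
      unfolding char_def using Dm charD[of j] by (subst integral_distr) auto
  qed
  also have "\<dots> = exp (- (\<Sum>j<n. (d j)\<^sup>2 * \<tau> j) / 2)"
    by (simp only: of_real_prod[symmetric] exp_sum[OF finite_lessThan, symmetric] sum_negf sum_divide_distrib[symmetric])
  also have "(\<Sum>j<n. (d j)\<^sup>2 * \<tau> j) = (\<Sum>i\<le>n. \<Sum>k\<le>n. v i * v k * min (t i) (t k))"
  proof -
    have mono: "t i \<le> t k" if "i \<le> k" "k \<le> n" for i k
      using that
    proof (induction k rule: dec_induct)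
      case (step m)
      then show ?case using t(2)[of m] by simp
    qed simp
    have tm: "t i = (\<Sum>j<n. if j < i then \<tau> j else 0)" if "i \<le> n" for i
    proof -
      have "(\<Sum>j<n. if j < i then \<tau> j else 0) = (\<Sum>j<i. \<tau> j)"
        using that by (simp add: sum.If_cases) (intro sum.cong, auto)
      then show ?thesis using t0 by (simp add: \<tau>_def sum_lessThan_telescope)
    qed
    have min: "min (t i) (t k) = (\<Sum>j<n. if j < i \<and> j < k then \<tau> j else 0)" if "i \<le> n" "k \<le> n" for i k
    proof (cases "i \<le> k")
      case True
      then have "min (t i) (t k) = t i" using mono that by simp
      also have "\<dots> = (\<Sum>j<n. if j < i \<and> j < k then \<tau> j else 0)"
        unfolding tm[OF that(1)] using True by (intro sum.cong) auto
      finally show ?thesis .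
    next
      case False
      then have "min (t i) (t k) = t k" using mono[of k i] that by simp
      also have "\<dots> = (\<Sum>j<n. if j < i \<and> j < k then \<tau> j else 0)"
        unfolding tm[OF that(2)] using False by (intro sum.cong) auto
      finally show ?thesis .
    qed
    have "(\<Sum>i\<le>n. \<Sum>k\<le>n. v i * v k * min (t i) (t k)) = (\<Sum>i\<le>n. \<Sum>k\<le>n. \<Sum>j<n. v i * v k * (if j < i \<and> j < k then \<tau> j else 0))"
      by (intro sum.cong refl) (simp add: min sum_distrib_left)
    also have "\<dots> = (\<Sum>i\<le>n. \<Sum>j<n. \<Sum>k\<le>n. v i * v k * (if j < i \<and> j < k then \<tau> j else 0))"
      by (intro sum.cong refl sum.swap)
    also have "\<dots> = (\<Sum>j<n. \<Sum>i\<le>n. \<Sum>k\<le>n. v i * v k * (if j < i \<and> j < k then \<tau> j else 0))"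
      by (rule sum.swap)
    also have "\<dots> = (\<Sum>j<n. (d j)\<^sup>2 * \<tau> j)"
    proof (intro sum.cong refl)
      fix j
      show "(\<Sum>i\<le>n. \<Sum>k\<le>n. v i * v k * (if j < i \<and> j < k then \<tau> j else 0)) = (d j)\<^sup>2 * \<tau> j"
      proof -
        have "(d j)\<^sup>2 * \<tau> j = (\<Sum>i\<le>n. \<Sum>k\<le>n. (if j < i then v i else 0) * (if j < k then v k else 0)) * \<tau> j"
          by (simp only: d_def power2_eq_square sum_product)
        also have "\<dots> = (\<Sum>i\<le>n. \<Sum>k\<le>n. v i * v k * (if j < i \<and> j < k then \<tau> j else 0))"
          unfolding sum_distrib_right by (intro sum.cong refl) auto
        finally show ?thesis by simp
      qed
    qed
    finally show ?thesis by simp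
  qed
  finally show ?thesis .
qed

lemma (in prob_space) wiener_process_iexp:
  assumes W: "wiener_process M {0..T} W" and F: "finite F" "F \<subseteq> {0..T}" and T: "T \<ge> 0"
  shows "(CLINT \<omega>|M. iexp (\<Sum>t\<in>F. u t * W t \<omega>)) = exp (- (\<Sum>s\<in>F. \<Sum>t\<in>F. u s * u t * min s t) / 2)"
proof -
  \<comment> \<open>The time 0 is included, with weight 0 if it is new, so that each value of
    \<open>W\<close> is a sum of increments from the first node.\<close>
  define G where "G = insert 0 F"
  define l where "l = sorted_list_of_set G"
  define n where "n = length l - 1"
  have G: "finite G" "G \<subseteq> {0..T}" "G \<noteq> {}" using F T by (auto simp: G_def)
  have l: "set l = G" "sorted_wrt (<) l" "distinct l" unfolding l_def using G by auto
  have len: "length l = Suc n" using l(1) G(3) by (cases l) (auto simp: n_def)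
  have bij: "bij_betw (\<lambda>i. l ! i) {..n} G"
  proof -
    have "{..n} = {..<length l}" using len by auto
    then show ?thesis using bij_betw_nth[OF l(3), of "{..n}" G] l(1) by simp
  qed
  have t0: "l ! 0 = 0"
  proof -
    have "0 \<in> (\<lambda>i. l ! i) ` {..n}" using bij by (simp add: bij_betw_def G_def)
    then obtain i where i: "i \<le> n" "l ! i = 0" by auto
    have "l ! 0 \<in> G" using len l(1) by (metis nth_mem zero_less_Suc)
    then have "0 \<le> l ! 0" using G by auto
    moreover have "l ! 0 \<le> l ! i" using sorted_wrt_nth_less[OF l(2), of 0 i] i(1) len by (cases "i = 0") auto
    ultimately show ?thesis using i by simp
  qed
  define v where "v s = (if s \<in> F then u s else 0)" for s
  have lin: "(\<Sum>t\<in>F. u t * f t) = (\<Sum>i\<le>n. v (l ! i) * f (l ! i))" for f :: "real \<Rightarrow> real"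
  proof -
    have "(\<Sum>t\<in>F. u t * f t) = (\<Sum>t\<in>G. v t * f t)"
      unfolding v_def G_def using F by (intro sum.mono_neutral_cong_left) auto
    also have "\<dots> = (\<Sum>i\<le>n. v (l ! i) * f (l ! i))" by (rule sum.reindex_bij_betw[OF bij, symmetric])
    finally show ?thesis .
  qed
  have "(CLINT \<omega>|M. iexp (\<Sum>t\<in>F. u t * W t \<omega>)) = (CLINT \<omega>|M. iexp (\<Sum>i\<le>n. v (l ! i) * W (l ! i) \<omega>))"
    unfolding lin ..
  also have "\<dots> = exp (- (\<Sum>i\<le>n. \<Sum>k\<le>n. v (l ! i) * v (l ! k) * min (l ! i) (l ! k)) / 2)"
  proof (rule wiener_process_iexp_sorted[OF W, where t="\<lambda>i. l ! i"])
    show "l ! i \<in> {0..T}" if "i \<le> n" for i using that len l(1) G(2) by (metis nth_mem subsetD less_Suc_eq_le)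
    show "l ! i < l ! Suc i" if "i < n" for i using that len l(2) by (simp add: sorted_wrt_iff_nth_less)
  qed (rule t0)
  also have "(\<Sum>i\<le>n. \<Sum>k\<le>n. v (l ! i) * v (l ! k) * min (l ! i) (l ! k)) = (\<Sum>s\<in>F. \<Sum>t\<in>F. u s * u t * min s t)"
  proof -
    have "(\<Sum>s\<in>F. \<Sum>t\<in>F. u s * u t * min s t) = (\<Sum>s\<in>F. u s * (\<Sum>t\<in>F. u t * min s t))"
      by (simp add: sum_distrib_left mult.assoc)
    also have "\<dots> = (\<Sum>i\<le>n. v (l ! i) * (\<Sum>k\<le>n. v (l ! k) * min (l ! i) (l ! k)))" unfolding lin ..
    finally show ?thesis by (simp add: sum_distrib_left mult.assoc)
  qed
  finally show ?thesis .
qed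

text \<open>The covariance function of \<open>B + W\<close>.\<close>

definition mixed_cov :: "real \<Rightarrow> real \<Rightarrow> real \<Rightarrow> real" where
  "mixed_cov H s t = (s powr (2 * H) + t powr (2 * H) - \<bar>s - t\<bar> powr (2 * H)) / 2 + min s t"

text \<open>Independence is given for whole paths in the product sigma-algebra. A finite functional
  is a measurable function of the path, so the functionals of \<open>B\<close> and \<open>W\<close>
  are independent and their variances add.\<close>

lemma (in prob_space) mixed_process_iexp:
  assumes B: "fractional_brownian_motion M {0..T} H B" and W: "wiener_process M {0..T} W"
    and ind: "independent_processes M {0..T} B W" and F: "finite F" "F \<subseteq> {0..T}" and T: "T \<ge> 0"
  shows "(CLINT \<omega>|M. iexp (\<Sum>t\<in>F. u t * (B t \<omega> + W t \<omega>))) = exp (- (\<Sum>s\<in>F. \<Sum>t\<in>F. u s * u t * mixed_cov H s t) / 2)"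
proof -
  define L where "L x = (\<Sum>t\<in>F. u t * x t)" for x :: "real \<Rightarrow> real"
  have Lm: "L \<in> Pi\<^sub>M {0..T} (\<lambda>_. borel) \<rightarrow>\<^sub>M borel"
    unfolding L_def[abs_def] using F by (intro borel_measurable_sum borel_measurable_times borel_measurable_const measurable_component_singleton) auto
  have "indep_var borel (L \<circ> (\<lambda>\<omega>. \<lambda>t\<in>{0..T}. B t \<omega>)) borel (L \<circ> (\<lambda>\<omega>. \<lambda>t\<in>{0..T}. W t \<omega>))"
    using ind unfolding independent_processes_def by (rule indep_var_compose[OF _ Lm Lm])
  moreover have "L \<circ> (\<lambda>\<omega>. \<lambda>t\<in>{0..T}. Y t \<omega>) = (\<lambda>\<omega>. \<Sum>t\<in>F. u t * Y t \<omega>)" for Y :: "real \<Rightarrow> 'a \<Rightarrow> real"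
    using F by (auto simp: L_def fun_eq_iff intro!: sum.cong)
  ultimately have iv: "indep_var borel (\<lambda>\<omega>. \<Sum>t\<in>F. u t * B t \<omega>) borel (\<lambda>\<omega>. \<Sum>t\<in>F. u t * W t \<omega>)" by simp
  note [measurable] = indep_var_rv1[OF iv] indep_var_rv2[OF iv]
  have "(CLINT \<omega>|M. iexp (\<Sum>t\<in>F. u t * (B t \<omega> + W t \<omega>)))
    = char (distr M borel (\<lambda>\<omega>. (\<Sum>t\<in>F. u t * B t \<omega>) + (\<Sum>t\<in>F. u t * W t \<omega>))) 1"
    unfolding char_def by (subst integral_distr) (auto simp: ring_distribs sum.distrib)
  also have "\<dots> = char (distr M borel (\<lambda>\<omega>. \<Sum>t\<in>F. u t * B t \<omega>)) 1 * char (distr M borel (\<lambda>\<omega>. \<Sum>t\<in>F. u t * W t \<omega>)) 1"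
    by (rule char_distr_add[OF iv])
  also have "\<dots> = (CLINT \<omega>|M. iexp (\<Sum>t\<in>F. u t * B t \<omega>)) * (CLINT \<omega>|M. iexp (\<Sum>t\<in>F. u t * W t \<omega>))"
    unfolding char_def by (simp add: integral_distr)
  also have "\<dots> = exp (- (\<Sum>s\<in>F. \<Sum>t\<in>F. u s * u t * mixed_cov H s t) / 2)"
    unfolding fractional_brownian_motion_iexp[OF B F] wiener_process_iexp[OF W F T] of_real_mult[symmetric] exp_add[symmetric] mixed_cov_def
    by (simp add: ring_distribs sum.distrib add_divide_distrib)
  finally show ?thesis .
qed

lemma (in prob_space) mixed_process_box_shift:
  assumes B: "fractional_brownian_motion M {0..T} H B" and W: "wiener_process M {0..T} W"
    and ind: "independent_processes M {0..T} B W" and F: "finite F" "F \<subseteq> {0..T}" and T: "T \<ge> 0"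
  shows "prob {\<omega> \<in> space M. \<forall>t\<in>F. \<bar>B t \<omega> + W t \<omega> + g t\<bar> \<le> r t}
    \<le> exp ((\<Sum>t\<in>F. \<bar>a t\<bar> * r t) - (\<Sum>t\<in>F. a t * g t) + (\<Sum>s\<in>F. \<Sum>t\<in>F. a s * a t * mixed_cov H s t) / 2)
      * prob {\<omega> \<in> space M. \<forall>t\<in>F. \<bar>B t \<omega> + W t \<omega>\<bar> \<le> r t}"
proof -
  have m: "(\<lambda>\<omega>. B t \<omega> + W t \<omega>) \<in> borel_measurable M" if "t \<in> F" for t
  proof (rule borel_measurable_add)
    have t: "t \<in> {0..T}" using that F by blast
    show "B t \<in> borel_measurable M"
      using B t unfolding fractional_brownian_motion_def centered_gaussian_process_def by blast
    show "W t \<in> borel_measurable M" using W t unfolding wiener_process_def by blast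
  qed
  have var: "integrable M (\<lambda>\<omega>. (\<Sum>t\<in>F. u t * (B t \<omega> + W t \<omega>))\<^sup>2)"
     "expectation (\<lambda>\<omega>. (\<Sum>t\<in>F. u t * (B t \<omega> + W t \<omega>))\<^sup>2) = (\<Sum>s\<in>F. \<Sum>t\<in>F. u s * u t * mixed_cov H s t)" for u
  proof -
    have m': "(\<lambda>\<omega>. \<Sum>t\<in>F. u t * (B t \<omega> + W t \<omega>)) \<in> borel_measurable M" using m by measurable
    have c: "(CLINT \<omega>|M. iexp (\<theta> * (\<Sum>t\<in>F. u t * (B t \<omega> + W t \<omega>)))) = exp (- (\<theta>\<^sup>2 * (\<Sum>s\<in>F. \<Sum>t\<in>F. u s * u t * mixed_cov H s t)) / 2)" for \<theta>
    proof -
      have 1: "\<theta> * (\<Sum>t\<in>F. u t * f t) = (\<Sum>t\<in>F. (\<theta> * u t) * f t)" for f :: "real \<Rightarrow> real"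
        by (simp add: sum_distrib_left mult.assoc)
      have 2: "\<theta>\<^sup>2 * (\<Sum>s\<in>F. \<Sum>t\<in>F. u s * u t * mixed_cov H s t) = (\<Sum>s\<in>F. \<Sum>t\<in>F. (\<theta> * u s) * (\<theta> * u t) * mixed_cov H s t)"
        by (simp add: sum_distrib_left power2_eq_square mult_ac)
      show ?thesis unfolding 1 2 by (rule mixed_process_iexp[OF B W ind F T])
    qed
    show "integrable M (\<lambda>\<omega>. (\<Sum>t\<in>F. u t * (B t \<omega> + W t \<omega>))\<^sup>2)"
      "expectation (\<lambda>\<omega>. (\<Sum>t\<in>F. u t * (B t \<omega> + W t \<omega>))\<^sup>2) = (\<Sum>s\<in>F. \<Sum>t\<in>F. u s * u t * mixed_cov H s t)"
      by (rule variance_of_gaussian_iexp[OF m' c])+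
  qed
  have int: "integrable M (\<lambda>\<omega>. (B t \<omega> + W t \<omega>)\<^sup>2)" if "t \<in> F" for t
  proof -
    have "(\<Sum>s\<in>F. (if s = t then 1 else 0) * (B s \<omega> + W s \<omega>)) = B t \<omega> + W t \<omega>" for \<omega>
      using that F by (simp add: if_distrib[where f="\<lambda>x. x * _"] cong: if_cong)
    then show ?thesis using var(1)[of "\<lambda>s. if s = t then 1 else 0"] by simp
  qed
  show ?thesis
    unfolding var(2)[symmetric]
    by (rule gaussian_box_shift[of F "\<lambda>t \<omega>. B t \<omega> + W t \<omega>", OF F(1) m int])
      (assumption | simp only: mixed_process_iexp[OF B W ind F T] var(2))+
qed

text \<open>A countable dense subset of the graph of \<open>F\<close> determines whether a continuous function stays below \<open>F\<close>,
  although \<open>F\<close> itself may be discontinuous everywhere.\<close>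

lemma countable_determining_set:
  fixes F :: "real \<Rightarrow> real" and A :: "real set"
  obtains S where "countable S" "S \<subseteq> A"
    "\<And>y. continuous_on A y \<Longrightarrow> (\<And>t. t \<in> S \<Longrightarrow> \<bar>y t\<bar> \<le> F t) \<Longrightarrow> (\<forall>t\<in>A. \<bar>y t\<bar> \<le> F t)"
proof -
  define gr where "gr = (\<lambda>t. (t, F t)) ` A"
  obtain D where D: "countable D" "D \<subseteq> gr" "gr \<subseteq> closure D" using separable[of gr] by blast
  show thesis
  proof (rule that[of "fst ` D"])
    show "countable (fst ` D)" using D(1) by simp
    show "fst ` D \<subseteq> A" using D(2) by (auto simp: gr_def)
    fix y :: "real \<Rightarrow> real" assume y: "continuous_on A y" and le: "\<And>t. t \<in> fst ` D \<Longrightarrow> \<bar>y t\<bar> \<le> F t"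
    show "\<forall>t\<in>A. \<bar>y t\<bar> \<le> F t"
    proof
      fix t assume t: "t \<in> A"
      then have "(t, F t) \<in> closure D" using D(3) by (auto simp: gr_def)
      then obtain p where p: "\<And>n. p n \<in> D" "p \<longlonglongrightarrow> (t, F t)" unfolding closure_sequential by blast
      have snd: "snd (p n) = F (fst (p n))" "fst (p n) \<in> A" for n using p(1)[of n] D(2) by (auto simp: gr_def)
      have "(\<lambda>n. fst (p n)) \<longlonglongrightarrow> t" "(\<lambda>n. snd (p n)) \<longlonglongrightarrow> F t"
        using tendsto_fst[OF p(2)] tendsto_snd[OF p(2)] by auto
      then have "(\<lambda>n. y (fst (p n))) \<longlonglongrightarrow> y t"
        using y t snd(2) by (auto intro!: continuous_on_tendsto_compose[of A y])
      then have "(\<lambda>n. \<bar>y (fst (p n))\<bar>) \<longlonglongrightarrow> \<bar>y t\<bar>" by (rule tendsto_rabs)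
      moreover have "\<bar>y (fst (p n))\<bar> \<le> snd (p n)" for n using le[of "fst (p n)"] p(1)[of n] snd by force
      ultimately show "\<bar>y t\<bar> \<le> F t" using \<open>(\<lambda>n. snd (p n)) \<longlonglongrightarrow> F t\<close> by (intro LIMSEQ_le) auto
    qed
  qed
qed

text \<open>The event over all times need not belong to \<open>sets M\<close>; the completion makes
  it measurable once it differs from an event by a null set.\<close>

lemma (in prob_space) measure_completion_eq_AE:
  assumes E: "E \<in> sets M" and A: "A \<subseteq> space M" and ae: "AE \<omega> in M. \<omega> \<in> E \<longleftrightarrow> \<omega> \<in> A"
  shows "measure (completion M) A = prob E"
proof -
  have ae': "AE \<omega> in completion M. \<omega> \<in> E \<longleftrightarrow> \<omega> \<in> A" using ae by (rule AE_completion)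
  have A': "A \<in> sets (completion M)" by (rule completion.in_sets_AE[OF ae']) (use E A in auto)
  have "emeasure (completion M) A = emeasure (completion M) E"
    by (rule emeasure_eq_AE) (use ae' A' E in auto)
  then show ?thesis using E by (simp add: measure_def)
qed

text \<open>All the finite sets \<open>G k\<close> contain \<open>F\<close>, so the weights on
  \<open>F\<close>, extended by zero, serve every \<open>k\<close> with the same constant, and the
  bound passes to the limit of the decreasing events.\<close>

lemma (in prob_space) small_ball_prob_shift:
  assumes B: "fractional_brownian_motion M {0..T} H B" "continuous_paths M {0..T} B"
    and W: "wiener_process M {0..T} W"
    and ind: "independent_processes M {0..T} B W" and F: "finite F" "F \<subseteq> {0..T}" and T: "T \<ge> 0"
    and g: "continuous_on {0..T} g"
  shows "small_ball_prob M B W f T g \<epsilon>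
    \<le> exp (\<epsilon> * (\<Sum>t\<in>F. \<bar>a t\<bar> * f t) - ((\<Sum>t\<in>F. a t * g t) - (\<Sum>s\<in>F. \<Sum>t\<in>F. a s * a t * mixed_cov H s t) / 2))
      * small_ball_prob M B W f T (\<lambda>_. 0) \<epsilon>"
proof -
  obtain S where S: "countable S" "S \<subseteq> {0..T}"
    "\<And>y. continuous_on {0..T} y \<Longrightarrow> (\<And>t. t \<in> S \<Longrightarrow> \<bar>y t\<bar> \<le> \<epsilon> * f t) \<Longrightarrow> (\<forall>t\<in>{0..T}. \<bar>y t\<bar> \<le> \<epsilon> * f t)"
    by (rule countable_determining_set[of "{0..T}" "\<lambda>t. \<epsilon> * f t"], rule that, blast+)
  have m: "(\<lambda>\<omega>. B t \<omega> + W t \<omega>) \<in> borel_measurable M" if "t \<in> {0..T}" for t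
  proof (rule borel_measurable_add)
    show "B t \<in> borel_measurable M"
      using B that unfolding fractional_brownian_motion_def centered_gaussian_process_def by blast
    show "W t \<in> borel_measurable M" using W that unfolding wiener_process_def by blast
  qed
  \<comment> \<open>Inserting 0 makes the set nonempty, as an enumeration by
    \<open>from_nat_into\<close> requires.\<close>
  define N where "N = insert 0 S"
  define G where "G k = F \<union> from_nat_into N ` {..k}" for k :: nat
  have N: "countable N" "N \<noteq> {}" "N \<subseteq> {0..T}" using S T by (auto simp: N_def)
  have G: "finite (G k)" "G k \<subseteq> {0..T}" "F \<subseteq> G k" for k
    using F N from_nat_into[OF N(2)] by (auto simp: G_def)
  have UG: "(\<Union>k. G k) = F \<union> N"
  proof -
    have "(\<Union>k. from_nat_into N ` {..k}) = range (from_nat_into N)" by auto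
    then show ?thesis using range_from_nat_into[OF N(2,1)] by (auto simp: G_def)
  qed
  define E where "E g A = {\<omega> \<in> space M. \<forall>t\<in>A. \<bar>B t \<omega> + W t \<omega> + g t\<bar> \<le> \<epsilon> * f t}" for g and A :: "real set"
  have Esets: "E g A \<in> sets M" if "countable A" "A \<subseteq> {0..T}" for g A
  proof -
    have "{\<omega> \<in> space M. \<bar>B t \<omega> + W t \<omega> + g t\<bar> \<le> \<epsilon> * f t} \<in> sets M" if "t \<in> A" for t
      using m[of t] that \<open>A \<subseteq> {0..T}\<close> by (intro borel_measurable_le borel_measurable_abs borel_measurable_add[OF _ borel_measurable_const]) auto
    then show ?thesis unfolding E_def by (rule sets.sets_Collect_countable_All'[OF _ that(1)])
  qed
  have ball: "small_ball_prob M B W f T g \<epsilon> = prob (E g (F \<union> N))" if g: "continuous_on {0..T} g" for g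
    unfolding small_ball_prob_def
  proof (rule measure_completion_eq_AE)
    show "E g (F \<union> N) \<in> sets M" using F N by (intro Esets) (auto intro: countable_finite)
    show "small_ball_event M B W f T g \<epsilon> \<subseteq> space M" by (auto simp: small_ball_event_def)
    have "AE \<omega> in M. continuous_on {0..T} (\<lambda>t. B t \<omega>)" "AE \<omega> in M. continuous_on {0..T} (\<lambda>t. W t \<omega>)"
      using B(2) W by (auto simp: continuous_paths_def wiener_process_def)
    then show "AE \<omega> in M. (\<omega> \<in> E g (F \<union> N)) = (\<omega> \<in> small_ball_event M B W f T g \<epsilon>)"
    proof eventually_elim
      case (elim \<omega>)
      have "continuous_on {0..T} (\<lambda>t. B t \<omega> + W t \<omega> + g t)" by (intro continuous_on_add elim g)
      note det = S(3)[OF this]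
      show ?case
      proof
        assume *: "\<omega> \<in> E g (F \<union> N)"
        then have "\<forall>t\<in>{0..T}. \<bar>B t \<omega> + W t \<omega> + g t\<bar> \<le> \<epsilon> * f t"
          by (intro det) (simp add: E_def N_def)
        with * show "\<omega> \<in> small_ball_event M B W f T g \<epsilon>" by (simp add: E_def small_ball_event_def)
      next
        assume "\<omega> \<in> small_ball_event M B W f T g \<epsilon>"
        then show "\<omega> \<in> E g (F \<union> N)"
          using F(2) N(3) unfolding E_def small_ball_event_def by blast
      qed
    qed
  qed
  define c where "c = exp (\<epsilon> * (\<Sum>t\<in>F. \<bar>a t\<bar> * f t) - ((\<Sum>t\<in>F. a t * g t) - (\<Sum>s\<in>F. \<Sum>t\<in>F. a s * a t * mixed_cov H s t) / 2))"
  define b where "b t = (if t \<in> F then a t else 0)" for t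
  have bs: "(\<Sum>t\<in>G k. h (b t) t) = (\<Sum>t\<in>F. h (a t) t)" if "\<And>t. h 0 t = 0" for h :: "real \<Rightarrow> real \<Rightarrow> real" and k
    using G[of k] that by (intro sum.mono_neutral_cong_right) (auto simp: b_def)
  have step: "prob (E g (G k)) \<le> c * prob (E (\<lambda>_. 0) (G k))" for k
  proof -
    have "(\<Sum>t\<in>G k. \<bar>b t\<bar> * (\<epsilon> * f t)) = \<epsilon> * (\<Sum>t\<in>F. \<bar>a t\<bar> * f t)"
      using bs[of "\<lambda>x t. \<bar>x\<bar> * (\<epsilon> * f t)" k] by (simp add: sum_distrib_left mult_ac)
    moreover have "(\<Sum>t\<in>G k. b t * g t) = (\<Sum>t\<in>F. a t * g t)"
      using bs[of "\<lambda>x t. x * g t" k] by simp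
    moreover have "(\<Sum>s\<in>G k. \<Sum>t\<in>G k. b s * b t * mixed_cov H s t) = (\<Sum>s\<in>F. \<Sum>t\<in>F. a s * a t * mixed_cov H s t)"
    proof -
      have "(\<Sum>s\<in>G k. \<Sum>t\<in>G k. b s * b t * mixed_cov H s t) = (\<Sum>s\<in>G k. \<Sum>t\<in>F. b s * a t * mixed_cov H s t)"
      proof (rule sum.cong[OF refl])
        fix s show "(\<Sum>t\<in>G k. b s * b t * mixed_cov H s t) = (\<Sum>t\<in>F. b s * a t * mixed_cov H s t)"
          using bs[of "\<lambda>x t. b s * x * mixed_cov H s t" k] by simp
      qed
      also have "\<dots> = (\<Sum>s\<in>F. \<Sum>t\<in>F. a s * a t * mixed_cov H s t)"
        using bs[of "\<lambda>x s. \<Sum>t\<in>F. x * a t * mixed_cov H s t" k] by simp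
      finally show ?thesis .
    qed
    ultimately show ?thesis
      using mixed_process_box_shift[OF B(1) W ind G(1,2) T, of k g "\<lambda>t. \<epsilon> * f t" b]
      by (simp add: E_def c_def algebra_simps)
  qed
  have dec: "decseq (\<lambda>k. E g (G k))" for g
    unfolding decseq_def E_def G_def by (auto simp: Ball_def)
  have INT: "(\<Inter>k. E g (G k)) = E g (F \<union> N)" for g
    unfolding UG[symmetric] E_def by auto
  have lim: "(\<lambda>k. prob (E g (G k))) \<longlonglongrightarrow> prob (E g (F \<union> N))" for g
    unfolding INT[symmetric] using G dec by (intro finite_Lim_measure_decseq) (auto intro!: Esets countable_finite)
  have "prob (E g (F \<union> N)) \<le> c * prob (E (\<lambda>_. 0) (F \<union> N))"
    using lim[of g] tendsto_mult_left[OF lim[of "\<lambda>_. 0"], of c] step by (intro LIMSEQ_le) auto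
  then show ?thesis unfolding ball[OF g] ball[OF continuous_on_const] c_def .
qed

section \<open>From finite linear functionals to integrals\<close>

text \<open>The weight of a node is the integral of \<open>\<psi>\<close> over the times rounded to
  it. The finite sum is then exactly the integral with \<open>f\<close> evaluated at rounded times,
  so limits reduce to dominated convergence.\<close>

lemma sum_weights_eq_integral:
  fixes \<psi> r f :: "real \<Rightarrow> real"
  assumes F: "finite F" and r [measurable]: "r \<in> borel_measurable borel" and rF: "\<And>t. t \<in> {0..T} \<Longrightarrow> r t \<in> F"
    and \<psi>: "integrable lborel \<psi>" and supp: "\<And>t. t \<notin> {0..T} \<Longrightarrow> \<psi> t = 0"
  shows "integrable lborel (\<lambda>t. f (r t) * \<psi> t)"
    and "(\<Sum>y\<in>F. (LINT t|lborel. indicator {t. r t = y} t * \<psi> t) * f y) = (LINT t|lborel. f (r t) * \<psi> t)"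
proof -
  have eq: "f (r t) * \<psi> t = (\<Sum>y\<in>F. f y * (indicator {t. r t = y} t * \<psi> t))" for t
  proof (cases "t \<in> {0..T}")
    case True
    have "(\<Sum>y\<in>F. f y * (indicator {t. r t = y} t * \<psi> t)) = (\<Sum>y\<in>F. if y = r t then f y * \<psi> t else 0)"
      by (intro sum.cong refl) (auto simp: indicator_def)
    then show ?thesis using F rF[OF True] by simp
  qed (simp add: supp)
  have int: "integrable lborel (\<lambda>t. indicator {t. r t = y} t * \<psi> t)" for y
    using integrable_mult_indicator[OF _ \<psi>, of "{t. r t = y}"] by simp
  show "integrable lborel (\<lambda>t. f (r t) * \<psi> t)"
    unfolding eq by (intro Bochner_Integration.integrable_sum integrable_mult_right int)
  show "(\<Sum>y\<in>F. (LINT t|lborel. indicator {t. r t = y} t * \<psi> t) * f y) = (LINT t|lborel. f (r t) * \<psi> t)"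
  proof -
    have "(LINT t|lborel. f (r t) * \<psi> t) = (\<Sum>y\<in>F. (LINT t|lborel. f y * (indicator {t. r t = y} t * \<psi> t)))"
      unfolding eq by (intro Bochner_Integration.integral_sum integrable_mult_right int)
    then show ?thesis by (simp add: mult.commute)
  qed
qed

lemma double_integral_bound:
  fixes q \<psi> :: "real \<Rightarrow> real"
  assumes \<psi>: "integrable lborel \<psi>" and C: "\<And>t. \<bar>q t\<bar> \<le> C"
  shows "\<bar>LINT t|lborel. q t * \<psi> t\<bar> \<le> C * (LINT t|lborel. \<bar>\<psi> t\<bar>)"
proof -
  have "\<bar>LINT t|lborel. q t * \<psi> t\<bar> \<le> (LINT t|lborel. C * \<bar>\<psi> t\<bar>)"
  proof (cases "integrable lborel (\<lambda>t. q t * \<psi> t)")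
    case True
    show ?thesis
      by (rule integral_abs_bound_integral[OF True]) (use \<psi> C in \<open>auto simp: abs_mult mult_right_mono\<close>)
  next
    \<comment> \<open>A non-integrable function has Bochner integral 0, and the bound holds because
      \<open>C\<close> is nonnegative.\<close>
    case False
    have "0 \<le> C" using C[of 0] by linarith
    then have "0 \<le> (LINT t|lborel. C * \<bar>\<psi> t\<bar>)" by (intro integral_nonneg_AE) auto
    then show ?thesis using False by (simp add: not_integrable_integral_eq)
  qed
  also have "\<dots> = C * (LINT t|lborel. \<bar>\<psi> t\<bar>)" by (rule Bochner_Integration.integral_mult_right_zero)
  finally show ?thesis .
qed

text \<open>Both limits use the same nodes and weights, so value and variance converge along one
  sequence of functionals. In the double sum, dominated convergence is applied to the inner integral
  first and then to the outer one.\<close>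

lemma discretization:
  fixes \<psi> g :: "real \<Rightarrow> real" and Q :: "real \<Rightarrow> real \<Rightarrow> real"
  assumes T: "T > 0" and \<psi>: "integrable lborel \<psi>" and supp: "\<And>t. t \<notin> {0..T} \<Longrightarrow> \<psi> t = 0"
    and g: "continuous_on {0..T} g" and Q: "continuous_on ({0..T} \<times> {0..T}) (\<lambda>(s, t). Q s t)"
  shows "\<exists>F a. (\<forall>n. finite (F n) \<and> F n \<subseteq> {0..T}) \<and>
    (\<lambda>n. \<Sum>t\<in>F n. a n t * g t) \<longlonglongrightarrow> (LINT t|lborel. g t * \<psi> t) \<and>
    (\<lambda>n. \<Sum>s\<in>F n. \<Sum>t\<in>F n. a n s * a n t * Q s t) \<longlonglongrightarrow> (LINT s|lborel. (LINT t|lborel. Q s t * \<psi> t) * \<psi> s)"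
proof -
  \<comment> \<open>\<open>p\<close> clamps to the interval and \<open>r n\<close> rounds down to
    the grid of mesh T / (n + 1). Rounded times thus stay where \<open>g\<close> and
    \<open>Q\<close> are continuous and bounded.\<close>
  define p where "p t = max 0 (min T t)" for t
  define r where "r n t = T * real_of_int \<lfloor>real (Suc n) * p t / T\<rfloor> / real (Suc n)" for n t
  define F where "F n = (\<lambda>i. T * real i / real (Suc n)) ` {..Suc n}" for n
  define a where "a n y = (LINT t|lborel. indicator {t. r n t = y} t * \<psi> t)" for n y
  have p: "p t \<in> {0..T}" "t \<in> {0..T} \<Longrightarrow> p t = t" for t using T by (auto simp: p_def)
  have Fn: "finite (F n)" "F n \<subseteq> {0..T}" for n
    using T by (auto simp: F_def field_simps simp del: of_nat_Suc)
  have rF: "r n t \<in> F n" for n t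
  proof -
    have "0 \<le> \<lfloor>real (Suc n) * p t / T\<rfloor>" using p[of t] T by simp
    moreover have "real (Suc n) * p t / T \<le> real (Suc n)"
      using mult_left_mono[of "p t / T" 1 "real (Suc n)"] p[of t] T by simp
    then have "\<lfloor>real (Suc n) * p t / T\<rfloor> \<le> int (Suc n)" using floor_mono by (metis floor_of_nat)
    ultimately have "nat \<lfloor>real (Suc n) * p t / T\<rfloor> \<in> {..Suc n}" "real (nat \<lfloor>real (Suc n) * p t / T\<rfloor>) = real_of_int \<lfloor>real (Suc n) * p t / T\<rfloor>"
      by auto
    then show ?thesis unfolding F_def r_def by (intro image_eqI[of _ _ "nat \<lfloor>real (Suc n) * p t / T\<rfloor>"]) (simp_all only:)
  qed
  have rI: "r n t \<in> {0..T}" for n t using rF Fn by blast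
  have rm [measurable]: "r n \<in> borel_measurable borel" for n unfolding r_def p_def by measurable
  have rlim: "(\<lambda>n. r n t) \<longlonglongrightarrow> p t" for t
  proof -
    have b: "p t - T / real (Suc n) \<le> r n t \<and> r n t \<le> p t" for n
    proof -
      define x where "x = real (Suc n) * p t / T"
      have "x - 1 \<le> real_of_int \<lfloor>x\<rfloor>" "real_of_int \<lfloor>x\<rfloor> \<le> x" by linarith+
      then have "T / real (Suc n) * (x - 1) \<le> T / real (Suc n) * real_of_int \<lfloor>x\<rfloor>" "T / real (Suc n) * real_of_int \<lfloor>x\<rfloor> \<le> T / real (Suc n) * x"
        using T by (intro mult_left_mono; simp)+
      moreover have "T / real (Suc n) * x = p t" using T by (simp add: x_def)
      ultimately show ?thesis unfolding r_def x_def[symmetric] by (simp add: right_diff_distrib del: of_nat_Suc)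
    qed
    have "(\<lambda>n. p t - T / real (Suc n)) \<longlonglongrightarrow> p t" by real_asymp
    from tendsto_sandwich[OF _ _ this tendsto_const] show ?thesis using b by simp
  qed
  have gr: "(\<lambda>n. g (r n t)) \<longlonglongrightarrow> g (p t)" for t
    by (rule continuous_on_tendsto_compose[OF g rlim]) (use p rI in auto)
  have Qr: "(\<lambda>n. Q (r n s) (r n t)) \<longlonglongrightarrow> Q (p s) (p t)" for s t
  proof -
    have "(\<lambda>n. (\<lambda>(s, t). Q s t) (r n s, r n t)) \<longlonglongrightarrow> (\<lambda>(s, t). Q s t) (p s, p t)"
      by (rule continuous_on_tendsto_compose[OF Q tendsto_Pair[OF rlim rlim]]) (use p rI in auto)
    then show ?thesis by simp
  qed
  obtain Cg where Cg: "\<And>t. t \<in> {0..T} \<Longrightarrow> \<bar>g t\<bar> \<le> Cg"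
    using compact_imp_bounded[OF compact_continuous_image[OF g]] unfolding bounded_iff by force
  obtain C where C: "\<And>s t. s \<in> {0..T} \<Longrightarrow> t \<in> {0..T} \<Longrightarrow> \<bar>Q s t\<bar> \<le> C"
    using compact_imp_bounded[OF compact_continuous_image[OF Q compact_Times]] unfolding bounded_iff by force
  note wi = sum_weights_eq_integral[OF Fn(1) rm rF \<psi> supp]
  have gp: "g (p t) * \<psi> t = g t * \<psi> t" for t using p(2)[of t] supp[of t] by fastforce
  have Qp: "(LINT t|lborel. Q (p s) (p t) * \<psi> t) * \<psi> s = (LINT t|lborel. Q s t * \<psi> t) * \<psi> s" for s
  proof (cases "s \<in> {0..T}")
    case True
    have "Q s (p t) * \<psi> t = Q s t * \<psi> t" for t using p(2)[of t] supp[of t] by fastforce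
    then have "(LINT t|lborel. Q s (p t) * \<psi> t) = (LINT t|lborel. Q s t * \<psi> t)"
      by (simp only:)
    then show ?thesis using True p(2) by simp
  qed (simp add: supp)
  have [measurable]: "\<psi> \<in> borel_measurable borel" using \<psi> by auto
  have eq1: "(\<Sum>t\<in>F n. a n t * g t) = (LINT t|lborel. g (r n t) * \<psi> t)" for n
    unfolding a_def by (rule wi(2))
  have lim1: "(\<lambda>n. \<Sum>t\<in>F n. a n t * g t) \<longlonglongrightarrow> (LINT t|lborel. g t * \<psi> t)"
    unfolding eq1 gp[symmetric]
  proof (rule integral_dominated_convergence[where w="\<lambda>t. Cg * \<bar>\<psi> t\<bar>"])
    show s: "(\<lambda>t. g (r n t) * \<psi> t) \<in> borel_measurable lborel" for n using wi(1)[where f=g] by (rule borel_measurable_integrable)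
    have l: "(\<lambda>n. g (r n t) * \<psi> t) \<longlonglongrightarrow> g (p t) * \<psi> t" for t by (intro tendsto_mult_right gr)
    then show "(\<lambda>t. g (p t) * \<psi> t) \<in> borel_measurable lborel" by (rule borel_measurable_LIMSEQ_real[OF _ s])
    show "AE t in lborel. (\<lambda>n. g (r n t) * \<psi> t) \<longlonglongrightarrow> g (p t) * \<psi> t" using l by simp
    show "AE t in lborel. norm (g (r n t) * \<psi> t) \<le> Cg * \<bar>\<psi> t\<bar>" for n
      using Cg[OF rI] by (simp add: abs_mult mult_right_mono)
  qed (use \<psi> in simp)
  define h where "h n s = (LINT t|lborel. Q s (r n t) * \<psi> t)" for n s
  have eq2: "(\<Sum>s\<in>F n. \<Sum>t\<in>F n. a n s * a n t * Q s t) = (LINT s|lborel. h n (r n s) * \<psi> s)" for n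
  proof -
    have "(\<Sum>s\<in>F n. \<Sum>t\<in>F n. a n s * a n t * Q s t) = (\<Sum>s\<in>F n. a n s * (\<Sum>t\<in>F n. a n t * Q s t))"
      by (simp add: sum_distrib_left mult.assoc)
    also have "\<dots> = (\<Sum>s\<in>F n. a n s * h n s)" unfolding h_def a_def by (simp only: wi(2))
    also have "\<dots> = (LINT s|lborel. h n (r n s) * \<psi> s)" unfolding a_def by (rule wi(2))
    finally show ?thesis .
  qed
  have hlim: "(\<lambda>n. h n (r n s)) \<longlonglongrightarrow> (LINT t|lborel. Q (p s) (p t) * \<psi> t)" for s
    unfolding h_def
  proof (rule integral_dominated_convergence[where w="\<lambda>t. C * \<bar>\<psi> t\<bar>"])
    show m: "(\<lambda>t. Q (r n s) (r n t) * \<psi> t) \<in> borel_measurable lborel" for n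
      using wi(1)[where f="Q (r n s)"] by (rule borel_measurable_integrable)
    have l: "(\<lambda>n. Q (r n s) (r n t) * \<psi> t) \<longlonglongrightarrow> Q (p s) (p t) * \<psi> t" for t by (intro tendsto_mult_right Qr)
    then show "(\<lambda>t. Q (p s) (p t) * \<psi> t) \<in> borel_measurable lborel" by (rule borel_measurable_LIMSEQ_real[OF _ m])
    show "AE t in lborel. (\<lambda>n. Q (r n s) (r n t) * \<psi> t) \<longlonglongrightarrow> Q (p s) (p t) * \<psi> t" using l by simp
    show "AE t in lborel. norm (Q (r n s) (r n t) * \<psi> t) \<le> C * \<bar>\<psi> t\<bar>" for n
      using C[OF rI rI] by (simp add: abs_mult mult_right_mono)
  qed (use \<psi> in simp)
  have hbound: "\<bar>h n (r n s)\<bar> \<le> C * (LINT t|lborel. \<bar>\<psi> t\<bar>)" for n s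
    unfolding h_def by (rule double_integral_bound[OF \<psi>]) (rule C[OF rI rI])
  have lim2: "(\<lambda>n. \<Sum>s\<in>F n. \<Sum>t\<in>F n. a n s * a n t * Q s t) \<longlonglongrightarrow> (LINT s|lborel. (LINT t|lborel. Q s t * \<psi> t) * \<psi> s)"
    unfolding eq2 Qp[symmetric]
  proof (rule integral_dominated_convergence[where w="\<lambda>t. C * (LINT t|lborel. \<bar>\<psi> t\<bar>) * \<bar>\<psi> t\<bar>"])
    show m: "(\<lambda>s. h n (r n s) * \<psi> s) \<in> borel_measurable lborel" for n
      using wi(1)[where f="h n"] by (rule borel_measurable_integrable)
    have l: "(\<lambda>n. h n (r n s) * \<psi> s) \<longlonglongrightarrow> (LINT t|lborel. Q (p s) (p t) * \<psi> t) * \<psi> s" for s by (intro tendsto_mult_right hlim)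
    then show "(\<lambda>s. (LINT t|lborel. Q (p s) (p t) * \<psi> t) * \<psi> s) \<in> borel_measurable lborel" by (rule borel_measurable_LIMSEQ_real[OF _ m])
    show "AE s in lborel. (\<lambda>n. h n (r n s) * \<psi> s) \<longlonglongrightarrow> (LINT t|lborel. Q (p s) (p t) * \<psi> t) * \<psi> s" using l by simp
    show "AE s in lborel. norm (h n (r n s) * \<psi> s) \<le> C * (LINT t|lborel. \<bar>\<psi> t\<bar>) * \<bar>\<psi> s\<bar>" for n
      using hbound[of n] by (simp add: abs_mult mult_right_mono)
  qed (use \<psi> in simp)
  show ?thesis using Fn lim1 lim2 by (intro exI[of _ F] exI[of _ a]) auto
qed

lemma integrable_pair_product:
  fixes f g :: "real \<Rightarrow> real"
  assumes f: "integrable lborel f" and g: "integrable lborel g"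
    and q [measurable]: "(\<lambda>(s, t). q s t) \<in> borel_measurable (lborel \<Otimes>\<^sub>M lborel)" and C: "\<And>s t. \<bar>q s t\<bar> \<le> C"
  shows "integrable (lborel \<Otimes>\<^sub>M lborel) (\<lambda>(s, t). q s t * (f s * g t))"
proof -
  have [measurable]: "f \<in> borel_measurable borel" "g \<in> borel_measurable borel" using f g by auto
  have 1: "integrable (lborel \<Otimes>\<^sub>M lborel) (\<lambda>(s, t). f s * g t)"
  proof (rule lborel_pair.Fubini_integrable)
    show "integrable lborel (\<lambda>x. LINT y|lborel. norm (case (x, y) of (s, t) \<Rightarrow> f s * g t))"
      using f by (simp add: abs_mult)
    show "AE x in lborel. integrable lborel (\<lambda>y. case (x, y) of (s, t) \<Rightarrow> f s * g t)" using g by simp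
  qed measurable
  show ?thesis
  proof (rule Bochner_Integration.integrable_bound)
    show "integrable (lborel \<Otimes>\<^sub>M lborel) (\<lambda>p. C * (case p of (s, t) \<Rightarrow> f s * g t))" using 1 by simp
    have "\<bar>q s t\<bar> * \<bar>f s * g t\<bar> \<le> \<bar>C\<bar> * \<bar>f s * g t\<bar>" for s t
      using C[of s t] by (intro mult_right_mono) auto
    then show "AE p in lborel \<Otimes>\<^sub>M lborel. norm (case p of (s, t) \<Rightarrow> q s t * (f s * g t)) \<le> norm (C * (case p of (s, t) \<Rightarrow> f s * g t))"
      by (auto simp: abs_mult split: prod.split)
  qed measurable
qed

text \<open>Fubini on the region 0 < s <= t. If \<open>\<psi>\<close> is minus the derivative of a
  function that vanishes at the right end, the inner integral on the right is that function.\<close>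

lemma integral_by_parts_Fubini:
  fixes G \<psi> :: "real \<Rightarrow> real"
  assumes G: "integrable lborel G" and \<psi>: "integrable lborel \<psi>" and supp: "\<And>t. t \<notin> {0..T} \<Longrightarrow> \<psi> t = 0"
    and g: "\<And>t. t \<in> {0..T} \<Longrightarrow> g t = (LINT s|lborel. indicator {s. 0 < s \<and> s \<le> t} s * G s)"
  shows "(LINT t|lborel. g t * \<psi> t) = (LINT s|lborel. G s * (indicator {0<..} s * (LINT t|lborel. indicator {s..} t * \<psi> t)))"
proof -
  have int: "integrable (lborel \<Otimes>\<^sub>M lborel) (\<lambda>(s, t). (indicator {0<..} s * indicator {s..} t :: real) * (G s * \<psi> t))"
  proof (rule integrable_pair_product[OF G \<psi>, where C=1])
    have "(\<lambda>p :: real \<times> real. if 0 < fst p \<and> fst p \<le> snd p then 1 else 0 :: real) \<in> borel_measurable (lborel \<Otimes>\<^sub>M lborel)"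
      by measurable
    also have "(\<lambda>p :: real \<times> real. if 0 < fst p \<and> fst p \<le> snd p then 1 else 0 :: real) = (\<lambda>(s :: real, t :: real). indicator {0<..} s * indicator {s..} t)"
      by (auto simp: indicator_def fun_eq_iff)
    finally show "(\<lambda>(s :: real, t :: real). indicator {0<..} s * indicator {s..} t :: real) \<in> borel_measurable (lborel \<Otimes>\<^sub>M lborel)" by (simp add: split_beta')
  qed (simp add: indicator_def)
  have "(LINT t|lborel. g t * \<psi> t) = (LINT t|lborel. (LINT s|lborel. (indicator {0<..} s * indicator {s..} t) * (G s * \<psi> t)))"
  proof (rule Bochner_Integration.integral_cong[OF refl])
    fix t
    have "g t * \<psi> t = (LINT s|lborel. indicator {s. 0 < s \<and> s \<le> t} s * G s) * \<psi> t"
      using g[of t] supp[of t] by (cases "t \<in> {0..T}") auto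
    also have "\<dots> = (LINT s|lborel. indicator {s. 0 < s \<and> s \<le> t} s * G s * \<psi> t)" by simp
    also have "\<dots> = (LINT s|lborel. (indicator {0<..} s * indicator {s..} t) * (G s * \<psi> t))"
      by (intro Bochner_Integration.integral_cong refl) (auto simp: indicator_def)
    finally show "g t * \<psi> t = (LINT s|lborel. (indicator {0<..} s * indicator {s..} t) * (G s * \<psi> t))" .
  qed
  also have "\<dots> = (LINT s|lborel. (LINT t|lborel. (indicator {0<..} s * indicator {s..} t) * (G s * \<psi> t)))"
    by (rule lborel_pair.Fubini_integral[OF int])
  also have "\<dots> = (LINT s|lborel. G s * (indicator {0<..} s * (LINT t|lborel. indicator {s..} t * \<psi> t)))"
  proof (rule Bochner_Integration.integral_cong[OF refl])
    fix s
    have "(LINT t|lborel. (indicator {0<..} s * indicator {s..} t) * (G s * \<psi> t)) = (LINT t|lborel. (G s * indicator {0<..} s) * (indicator {s..} t * \<psi> t))"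
      by (intro Bochner_Integration.integral_cong refl) simp
    also have "\<dots> = (G s * indicator {0<..} s) * (LINT t|lborel. indicator {s..} t * \<psi> t)" by simp
    finally show "(LINT t|lborel. (indicator {0<..} s * indicator {s..} t) * (G s * \<psi> t)) = G s * (indicator {0<..} s * (LINT t|lborel. indicator {s..} t * \<psi> t))"
      by (simp add: mult.assoc)
  qed
  finally show ?thesis .
qed

section \<open>Kernels of the fundamental martingales\<close>

lemma integrable_lborel_imp_absolutely_integrable_on:
  fixes f :: "real \<Rightarrow> real"
  assumes f: "integrable lborel f" and S: "S \<in> sets borel"
  shows "f absolutely_integrable_on S" "(LINT t|lborel. indicator S t * f t) = integral S f"
proof -
  have si: "set_integrable lborel S f"
    unfolding set_integrable_def using integrable_mult_indicator[OF _ f, of S] S by simp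
  show "(LINT t|lborel. indicator S t * f t) = integral S f"
    using set_borel_integral_eq_integral(2)[OF si] by (simp add: set_lebesgue_integral_def)
  show "f absolutely_integrable_on S"
    using si by (simp add: set_integrable_def integrable_completion)
qed

lemma has_bochner_integral_of_has_integral_nonneg:
  fixes f :: "real \<Rightarrow> real"
  assumes f: "f \<in> borel_measurable borel" and S: "S \<in> sets borel" and nn: "\<And>t. t \<in> S \<Longrightarrow> 0 \<le> f t"
    and hi: "(f has_integral r) S"
  shows "has_bochner_integral lborel (\<lambda>t. indicator S t * f t) r"
proof -
  have m: "(\<lambda>t. indicator S t * f t) \<in> borel_measurable borel" using f S by measurable
  have hi': "((\<lambda>t. indicator S t * f t) has_integral r) UNIV"
  proof -
    have "(\<lambda>t. indicator S t * f t) = (\<lambda>t. if t \<in> S then f t else 0)" by (auto simp: indicator_def)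
    then show ?thesis using hi by (simp only: has_integral_restrict_UNIV)
  qed
  have nn': "0 \<le> indicator S t * f t" for t using nn by (simp add: indicator_def)
  have "r \<ge> 0" using has_integral_nonneg[OF hi nn] .
  then show ?thesis
    using nn_integral_has_integral_lborel[OF m nn' hi'] m nn'
    by (intro has_bochner_integral_nn_integral) auto
qed

lemma has_bochner_integral_Beta:
  assumes "a > 0" "b > 0"
  shows "has_bochner_integral lborel (\<lambda>t. indicator {0<..<1} t * (t powr (a - 1) * (1 - t) powr (b - 1))) (Beta a b :: real)"
  by (rule has_bochner_integral_of_has_integral_nonneg)
    (use has_integral_Beta_real[OF assms] in \<open>auto simp: has_integral_Icc_iff_Ioo\<close>)

text \<open>Substitution of t = x r in the symmetric Beta integral; the two powers contribute 2 (a -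
  1) to the exponent of x and the Jacobian contributes 1.\<close>

lemma has_bochner_integral_Beta_scaled:
  fixes a x :: real
  assumes a: "a > 0" and x: "x > 0"
  shows "has_bochner_integral lborel (\<lambda>t. indicator {0<..<x} t * (t * (x - t)) powr (a - 1)) (x powr (2 * a - 1) * Beta a a)"
proof -
  have "has_bochner_integral lborel (\<lambda>t. indicator {0<..<1} (0 + 1 / x * t) * ((0 + 1 / x * t) powr (a - 1) * (1 - (0 + 1 / x * t)) powr (a - 1))) (Beta a a /\<^sub>R \<bar>1 / x\<bar>)"
    using x has_bochner_integral_Beta[OF a a] by (intro lborel_has_bochner_integral_real_affine_iff[THEN iffD1]) auto
  then have "has_bochner_integral lborel (\<lambda>t. x powr (2 * (a - 1)) * (indicator {0<..<1} (0 + 1 / x * t) * ((0 + 1 / x * t) powr (a - 1) * (1 - (0 + 1 / x * t)) powr (a - 1))))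
    (x powr (2 * (a - 1)) * (Beta a a /\<^sub>R \<bar>1 / x\<bar>))"
    by (rule has_bochner_integral_mult_right)
  moreover have "x powr (2 * (a - 1)) * (indicator {0<..<1} (0 + 1 / x * t) * ((0 + 1 / x * t) powr (a - 1) * (1 - (0 + 1 / x * t)) powr (a - 1)))
    = indicator {0<..<x} t * (t * (x - t)) powr (a - 1)" for t
  proof (cases "t \<in> {0<..<x}")
    case True
    have "x powr (2 * (a - 1)) = x powr (a - 1) * x powr (a - 1)" using x by (simp add: powr_add[symmetric])
    moreover have "x powr (a - 1) * (t / x) powr (a - 1) = t powr (a - 1)" using x True by (simp add: powr_mult[symmetric])
    moreover have "x powr (a - 1) * (1 - t / x) powr (a - 1) = (x - t) powr (a - 1)"
      using x True by (simp add: powr_mult[symmetric] right_diff_distrib)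
    ultimately have "x powr (2 * (a - 1)) * ((t / x) powr (a - 1) * (1 - t / x) powr (a - 1)) = t powr (a - 1) * (x - t) powr (a - 1)"
      by (metis (no_types, opaque_lifting) mult.assoc mult.left_commute)
    then show ?thesis using x True by (simp add: powr_mult indicator_def)
  next
    case False
    then show ?thesis using x by (simp add: indicator_def field_simps)
  qed
  moreover have "x powr (2 * (a - 1)) * (Beta a a /\<^sub>R \<bar>1 / x\<bar>) = x powr (2 * a - 1) * Beta a a"
  proof -
    have "x powr (2 * (a - 1)) * x = x powr (2 * a - 1)" using x by (simp add: powr_mult_base mult.commute)
    then show ?thesis using x by (simp add: mult_ac)
  qed
  ultimately show ?thesis by (simp only:)
qed

text \<open>The integrands of the fundamental martingales of fractional Brownian motion, and minus their derivatives.\<close>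

definition mart_fn :: "real \<Rightarrow> real \<Rightarrow> real \<Rightarrow> real" where
  "mart_fn a x t = (if 0 < t \<and> t < x then (t * (x - t)) powr a else 0)"

definition mart_fn_deriv :: "real \<Rightarrow> real \<Rightarrow> real \<Rightarrow> real" where
  "mart_fn_deriv a x t = (if 0 < t \<and> t < x then a * (t * (x - t)) powr (a - 1) * (2 * t - x) else 0)"

lemma mart_fn_measurable [measurable]: "mart_fn a x \<in> borel_measurable borel" "mart_fn_deriv a x \<in> borel_measurable borel"
  unfolding mart_fn_def[abs_def] mart_fn_deriv_def[abs_def] by measurable

lemma integral_mart_fn:
  assumes "a > 0" "x > 0"
  shows "has_bochner_integral lborel (mart_fn a x) (x powr (2 * a + 1) * Beta (a + 1) (a + 1))"
proof -
  have "mart_fn a x = (\<lambda>t. indicator {0<..<x} t * (t * (x - t)) powr ((a + 1) - 1))"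
    by (auto simp: mart_fn_def fun_eq_iff)
  moreover have "2 * (a + 1) - 1 = 2 * a + 1" by simp
  ultimately show ?thesis using has_bochner_integral_Beta_scaled[of "a + 1" x] assms by (simp add: add.commute)
qed

lemma integrable_mart_fn_deriv:
  assumes "a > 0" "x > 0"
  shows "integrable lborel (mart_fn_deriv a x)"
proof (rule Bochner_Integration.integrable_bound)
  show "integrable lborel (\<lambda>t. a * x * (indicator {0<..<x} t * (t * (x - t)) powr (a - 1)))"
    using has_bochner_integral_Beta_scaled[OF assms] by (intro integrable_mult_right) (auto simp: has_bochner_integral_iff)
  have "\<bar>mart_fn_deriv a x t\<bar> \<le> a * x * (indicator {0<..<x} t * (t * (x - t)) powr (a - 1))" for t
  proof (cases "0 < t \<and> t < x")
    case True
    then have "\<bar>2 * t - x\<bar> \<le> x" by auto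
    then have "a * (t * (x - t)) powr (a - 1) * \<bar>2 * t - x\<bar> \<le> a * (t * (x - t)) powr (a - 1) * x"
      using assms by (intro mult_left_mono) auto
    then show ?thesis using True assms by (simp add: mart_fn_deriv_def abs_mult mult_ac)
  qed (auto simp: mart_fn_deriv_def)
  then show "AE t in lborel. norm (mart_fn_deriv a x t) \<le> norm (a * x * (indicator {0<..<x} t * (t * (x - t)) powr (a - 1)))"
    using assms by (auto simp: abs_mult)
qed measurable

text \<open>\<open>mart_fn\<close> vanishes at the right end, so no boundary term remains. For a < 1
  the derivative is unbounded at both ends, hence the interior form of the fundamental
  theorem.\<close>

lemma integral_mart_fn_deriv:
  assumes a: "a > 0" and x: "x > 0" and s: "s \<ge> 0"
  shows "(LINT t|lborel. indicator {s..} t * mart_fn_deriv a x t) = mart_fn a x s"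
proof (cases "s < x")
  case False
  then have "indicator {s..} t * mart_fn_deriv a x t = 0" for t by (auto simp: mart_fn_deriv_def indicator_def)
  then have "(LINT t|lborel. indicator {s..} t * mart_fn_deriv a x t) = (LINT t::real|lborel. 0)" by (simp only:)
  then show ?thesis using False by (simp add: mart_fn_def)
next
  case True
  have "(mart_fn_deriv a x has_integral (- ((x * (x - x)) powr a) - (- ((s * (x - s)) powr a)))) {s..x}"
  proof (rule fundamental_theorem_of_calculus_interior)
    show "continuous_on {s..x} (\<lambda>t. - ((t * (x - t)) powr a))"
      using a s by (intro continuous_intros continuous_on_powr') (auto simp: mult_nonneg_nonneg)
    fix t assume t: "t \<in> {s<..<x}"
    then have "t * (x - t) > 0" using s by simp
    then have "((\<lambda>t. - ((t * (x - t)) powr a)) has_real_derivative - (a * (t * (x - t)) powr (a - 1) * (x - 2 * t))) (at t)"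
      by (auto intro!: derivative_eq_intros simp: powr_diff field_simps)
    then show "((\<lambda>t. - ((t * (x - t)) powr a)) has_vector_derivative mart_fn_deriv a x t) (at t)"
      using t s by (simp add: has_real_derivative_iff_has_vector_derivative mart_fn_deriv_def algebra_simps)
  qed (use True in simp)
  then have "integral {s..x} (mart_fn_deriv a x) = mart_fn a x s"
    using True s by (auto simp: mart_fn_def integral_unique)
  moreover have "(LINT t|lborel. indicator {s..x} t * mart_fn_deriv a x t) = integral {s..x} (mart_fn_deriv a x)"
    by (rule integrable_lborel_imp_absolutely_integrable_on[OF integrable_mart_fn_deriv[OF a x]]) simp
  moreover have "indicator {s..} t * mart_fn_deriv a x t = indicator {s..x} t * mart_fn_deriv a x t" for t
    by (auto simp: mart_fn_deriv_def indicator_def)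
  ultimately show ?thesis by (simp only:)
qed

section \<open>Singular power kernels\<close>

lemma has_bochner_integral_powr_0:
  fixes c L :: real
  assumes "c > -1" "L \<ge> 0"
  shows "has_bochner_integral lborel (\<lambda>s. indicator {0..L} s * s powr c) (L powr (c + 1) / (c + 1))"
  by (rule has_bochner_integral_of_has_integral_nonneg) (use assms has_integral_powr_from_0 in auto)

lemma integrable_abs_powr:
  fixes c L u :: real
  assumes c: "c > -1" and L: "L \<ge> 0"
  shows "integrable lborel (\<lambda>s. indicator {u - L..u + L} s * \<bar>s - u\<bar> powr c)"
    and "(LINT s|lborel. indicator {u - L..u + L} s * \<bar>s - u\<bar> powr c) = 2 * L powr (c + 1) / (c + 1)"
proof -
  note h = has_bochner_integral_powr_0[OF assms]
  have 1: "has_bochner_integral lborel (\<lambda>s. indicator {0..L} (-u + 1 * s) * (-u + 1 * s) powr c) (L powr (c + 1) / (c + 1) /\<^sub>R \<bar>1\<bar>)"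
    by (rule lborel_has_bochner_integral_real_affine_iff[THEN iffD1, OF _ h]) simp
  have 2: "has_bochner_integral lborel (\<lambda>s. indicator {0..L} (u + (-1) * s) * (u + (-1) * s) powr c) (L powr (c + 1) / (c + 1) /\<^sub>R \<bar>-1\<bar>)"
    by (rule lborel_has_bochner_integral_real_affine_iff[THEN iffD1, OF _ h]) simp
  have eq: "indicator {0..L} (-u + 1 * s) * (-u + 1 * s) powr c + indicator {0..L} (u + (-1) * s) * (u + (-1) * s) powr c
    = indicator {u - L..u + L} s * \<bar>s - u\<bar> powr c" for s
    by (auto simp: indicator_def abs_if)
  have "has_bochner_integral lborel (\<lambda>s. indicator {u - L..u + L} s * \<bar>s - u\<bar> powr c) (2 * L powr (c + 1) / (c + 1))"
    using has_bochner_integral_add[OF 1 2] unfolding eq by simp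
  then show "integrable lborel (\<lambda>s. indicator {u - L..u + L} s * \<bar>s - u\<bar> powr c)"
    "(LINT s|lborel. indicator {u - L..u + L} s * \<bar>s - u\<bar> powr c) = 2 * L powr (c + 1) / (c + 1)"
    by (auto simp: has_bochner_integral_iff)
qed

text \<open>Enlarging the interval to one symmetric around \<open>u\<close> gives a bound
  independent of \<open>u\<close>; this uniformity is used for Fubini and for Schur's test.\<close>

lemma integrable_abs_powr_Icc:
  fixes c T u :: real
  assumes c: "c > -1" and u: "u \<in> {0..T}"
  shows "integrable lborel (\<lambda>s. indicator {0..T} s * \<bar>s - u\<bar> powr c)"
    and "(LINT s|lborel. indicator {0..T} s * \<bar>s - u\<bar> powr c) \<le> 2 * T powr (c + 1) / (c + 1)"
proof -
  have T: "T \<ge> 0" using u by auto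
  have le: "indicator {0..T} s * \<bar>s - u\<bar> powr c \<le> indicator {u - T..u + T} s * \<bar>s - u\<bar> powr c" for s
    using u by (auto simp: indicator_def)
  show i: "integrable lborel (\<lambda>s. indicator {0..T} s * \<bar>s - u\<bar> powr c)"
    by (rule Bochner_Integration.integrable_bound[OF integrable_abs_powr(1)[OF c T, of u]]) (use le in auto)
  have "(LINT s|lborel. indicator {0..T} s * \<bar>s - u\<bar> powr c) \<le> (LINT s|lborel. indicator {u - T..u + T} s * \<bar>s - u\<bar> powr c)"
    by (rule integral_mono[OF i integrable_abs_powr(1)[OF c T] le])
  then show "(LINT s|lborel. indicator {0..T} s * \<bar>s - u\<bar> powr c) \<le> 2 * T powr (c + 1) / (c + 1)"
    unfolding integrable_abs_powr(2)[OF c T] .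
qed

text \<open>The right-hand side is the increment of an antiderivative over [0, t]; with c = 2 H it
  contains the term of the fractional covariance in which the two times interact. For c < 1 the
  integrand is singular at s = u, so that point is excepted in the fundamental theorem.\<close>

lemma integral_sgn_powr:
  fixes c t u :: real
  assumes c: "c > 0" and t: "t \<ge> 0" and u: "u > 0"
  shows "(LINT s|lborel. indicator {0..t} s * (sgn (s - u) * \<bar>s - u\<bar> powr (c - 1))) = (\<bar>t - u\<bar> powr c - u powr c) / c"
proof -
  \<comment> \<open>The longer interval contains \<open>u\<close>, as
    \<open>integrable_abs_powr_Icc\<close> requires, even when \<open>u > t\<close>.\<close>
  have "integrable lborel (\<lambda>s. indicator {0..t + u} s * \<bar>s - u\<bar> powr (c - 1))"
    by (rule integrable_abs_powr_Icc) (use c t u in auto)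
  then have int: "integrable lborel (\<lambda>s. indicator {0..t + u} s * (sgn (s - u) * \<bar>s - u\<bar> powr (c - 1)))"
    by (rule Bochner_Integration.integrable_bound) (auto simp: abs_mult indicator_def abs_sgn_eq)
  have "((\<lambda>s. indicator {0..t + u} s * (sgn (s - u) * \<bar>s - u\<bar> powr (c - 1))) has_integral (\<bar>t - u\<bar> powr c / c - \<bar>0 - u\<bar> powr c / c)) {0..t}"
  proof (rule fundamental_theorem_of_calculus_interior_strong[of "{u}"])
    show "continuous_on {0..t} (\<lambda>s. \<bar>s - u\<bar> powr c / c)"
      using c by (intro continuous_intros continuous_on_powr') auto
    fix s assume s: "s \<in> {0<..<t} - {u}"
    have "((\<lambda>s. \<bar>s - u\<bar> powr c / c) has_real_derivative (sgn (s - u) * \<bar>s - u\<bar> powr (c - 1))) (at s)"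
    proof (cases "s > u")
      case True
      have "((\<lambda>s. (s - u) powr c / c) has_real_derivative (s - u) powr (c - 1)) (at s)"
        using True c by (auto intro!: derivative_eq_intros)
      then have "((\<lambda>s. \<bar>s - u\<bar> powr c / c) has_real_derivative (s - u) powr (c - 1)) (at s)"
        by (rule has_field_derivative_transform_within_open[where S="{u<..}"]) (use True in auto)
      then show ?thesis using True by simp
    next
      case False
      then have us: "s < u" using s by auto
      have "((\<lambda>s. (u - s) powr c / c) has_real_derivative - ((u - s) powr (c - 1))) (at s)"
        using us c by (auto intro!: derivative_eq_intros)
      then have "((\<lambda>s. \<bar>s - u\<bar> powr c / c) has_real_derivative - ((u - s) powr (c - 1))) (at s)"
        by (rule has_field_derivative_transform_within_open[where S="{..<u}"]) (use us in auto)
      then show ?thesis using us by simp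
    qed
    then show "((\<lambda>s. \<bar>s - u\<bar> powr c / c) has_vector_derivative indicator {0..t + u} s * (sgn (s - u) * \<bar>s - u\<bar> powr (c - 1))) (at s)"
      using s u by (simp add: has_real_derivative_iff_has_vector_derivative)
  qed (use t in auto)
  then have "integral {0..t} (\<lambda>s. indicator {0..t + u} s * (sgn (s - u) * \<bar>s - u\<bar> powr (c - 1))) = (\<bar>t - u\<bar> powr c - u powr c) / c"
    using u by (simp add: integral_unique diff_divide_distrib)
  moreover have "(LINT s|lborel. indicator {0..t} s * (indicator {0..t + u} s * (sgn (s - u) * \<bar>s - u\<bar> powr (c - 1))))
    = integral {0..t} (\<lambda>s. indicator {0..t + u} s * (sgn (s - u) * \<bar>s - u\<bar> powr (c - 1)))"
    by (rule integrable_lborel_imp_absolutely_integrable_on[OF int]) simp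
  moreover have "indicator {0..t} s * (indicator {0..t + u} s * (sgn (s - u) * \<bar>s - u\<bar> powr (c - 1)))
     = indicator {0..t} s * (sgn (s - u) * \<bar>s - u\<bar> powr (c - 1))" for s
    using u by (auto simp: indicator_def)
  ultimately show ?thesis by simp
qed

text \<open>The key identity. The Moebius involution \<open>\<sigma> u = t\<^sup>2 (x - u) / (t\<^sup>2 + (x - 2 t) u)\<close> fixes \<open>t\<close> and
  exchanges \<open>0\<close> and \<open>x\<close>; it transports the integral over \<open>(t, x)\<close> to \<open>(0, t)\<close>. The sum of the two
  integrands is then \<open>- 2 a v\<^sup>a\<^sup>-\<^sup>1 (1 - v)\<^sup>-\<^sup>a v'\<close> with \<open>v u = u (x - u) / (t\<^sup>2 + (x - 2 t) u)\<close>, which increases from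
  \<open>0\<close> to \<open>1\<close>, so the integral is a Beta integral that depends neither on \<open>t\<close> nor on \<open>x\<close>.\<close>

lemma integral_singular_mart_fn_deriv:
  fixes a x t :: real
  assumes a: "0 < a" "a < 1" and t: "0 < t" "t < x"
    and int: "integrable lborel (\<lambda>u. sgn (t - u) * \<bar>t - u\<bar> powr (- 2 * a) * mart_fn_deriv a x u)"
  shows "(LINT u|lborel. sgn (t - u) * \<bar>t - u\<bar> powr (- 2 * a) * mart_fn_deriv a x u) = - 2 * a * Beta a (1 - a)"
proof -
  define f where "f u = sgn (t - u) * \<bar>t - u\<bar> powr (- 2 * a) * mart_fn_deriv a x u" for u
  define N where "N u = t\<^sup>2 + (x - 2 * t) * u" for u
  define \<sigma> where "\<sigma> u = t\<^sup>2 * (x - u) / N u" for u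
  define b where "b = t * (x - t)"
  define v where "v u = u * (x - u) / N u" for u
  define S where "S = {0<..<t}"
  have b: "b > 0" using t by (simp add: b_def)
  \<comment> \<open>\<open>N\<close> is affine with the values t^2 at 0 and (x - t)^2 at x, hence
    positive in between.\<close>
  have Npos: "N u > 0" if "0 \<le> u" "u \<le> x" for u
  proof -
    have "x * N u = t\<^sup>2 * (x - u) + (x - t)\<^sup>2 * u"
      unfolding N_def by (simp add: power2_eq_square algebra_simps)
    moreover have "t\<^sup>2 * (x - u) + (x - t)\<^sup>2 * u > 0"
    proof (cases "u = x")
      case True then show ?thesis using t by simp
    next
      case False
      then have "t\<^sup>2 * (x - u) > 0" using that t by simp
      moreover have "(x - t)\<^sup>2 * u \<ge> 0" using that by simp
      ultimately show ?thesis by linarith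
    qed
    ultimately have "x * N u > 0" by simp
    then show ?thesis using t by (simp add: zero_less_mult_iff)
  qed
  have s1: "\<sigma> u - t = b * (t - u) / N u" if "0 \<le> u" "u \<le> x" for u
    using Npos[OF that] unfolding \<sigma>_def b_def by (simp add: field_simps) (simp add: N_def power2_eq_square algebra_simps)
  have s2: "x - \<sigma> u = u * (x - t)\<^sup>2 / N u" if "0 \<le> u" "u \<le> x" for u
    using Npos[OF that] unfolding \<sigma>_def by (simp add: field_simps) (simp add: N_def power2_eq_square algebra_simps)
  have s3: "\<sigma> u * (x - \<sigma> u) = b\<^sup>2 * (u * (x - u)) / (N u)\<^sup>2" if "0 \<le> u" "u \<le> x" for u
    unfolding s2[OF that] unfolding \<sigma>_def b_def by (simp add: power2_eq_square field_simps)
  have s4: "(\<sigma> has_field_derivative (- b\<^sup>2 / (N u)\<^sup>2)) (at u within A)" if "0 \<le> u" "u \<le> x" for u A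
  proof -
    have "(\<sigma> has_field_derivative ((- t\<^sup>2 * N u - t\<^sup>2 * (x - u) * (x - 2 * t)) / (N u * N u))) (at u within A)"
      unfolding \<sigma>_def[abs_def] using Npos[OF that] unfolding N_def by (auto intro!: derivative_eq_intros)
    moreover have "- t\<^sup>2 * N u - t\<^sup>2 * (x - u) * (x - 2 * t) = - b\<^sup>2"
      unfolding N_def b_def by (simp add: power2_eq_square algebra_simps)
    ultimately show ?thesis by (simp add: power2_eq_square)
  qed
  have v1: "1 - v u = (t - u)\<^sup>2 / N u" if "0 \<le> u" "u \<le> x" for u
    using Npos[OF that] unfolding v_def by (simp add: field_simps) (simp add: N_def power2_eq_square algebra_simps)
  have v2: "(v has_field_derivative ((\<sigma> u - u) / N u)) (at u within A)" if "0 \<le> u" "u \<le> x" for u A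
  proof -
    have "(v has_field_derivative (((x - 2 * u) * N u - u * (x - u) * (x - 2 * t)) / (N u * N u))) (at u within A)"
      unfolding v_def[abs_def] using Npos[OF that] unfolding N_def
      by (auto intro!: derivative_eq_intros simp: algebra_simps)
    moreover have "((x - 2 * u) * N u - u * (x - u) * (x - 2 * t)) = (\<sigma> u - u) * N u"
      using Npos[OF that] unfolding \<sigma>_def by (simp add: field_simps) (simp add: N_def power2_eq_square algebra_simps)
    ultimately show ?thesis using Npos[OF that] by simp
  qed
  have \<sigma>t: "\<sigma> u > t" "\<sigma> u < x" if "u \<in> S" for u
  proof -
    have u: "0 \<le> u" "u \<le> x" using that t by (auto simp: S_def)
    have "b * (t - u) / N u > 0" using that b Npos[OF u] by (simp add: S_def)
    then show "\<sigma> u > t" using s1[OF u] by linarith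
    have "u * (x - t)\<^sup>2 / N u > 0" using that t Npos[OF u] by (simp add: S_def)
    then show "\<sigma> u < x" using s2[OF u] by linarith
  qed
  have Su: "0 \<le> u" "u \<le> x" "0 < u" "u < t" if "u \<in> S" for u using that t by (auto simp: S_def)
  \<comment> \<open>Since \<sigma> is an involution, a point of (t, x) is the image of its own
    image, and the latter lies in (0, t).\<close>
  have \<sigma>img: "\<sigma> ` S = {t<..<x}"
  proof (intro equalityI subsetI)
    fix w assume "w \<in> {t<..<x}"
    then have w: "t < w" "w < x" "0 \<le> w" "w \<le> x" using t by auto
    have Nw: "N w > 0" by (rule Npos[OF w(3,4)])
    have "b * (t - w) / N w < 0" using w b Nw by (simp add: divide_neg_pos mult_pos_neg)
    then have lt: "\<sigma> w < t" using s1[OF w(3,4)] by linarith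
    have gt: "\<sigma> w > 0" using w t Nw by (simp add: \<sigma>_def)
    have "\<sigma> (\<sigma> w) = w"
    proof -
      have n: "N (\<sigma> w) = b\<^sup>2 / N w"
      proof -
        have "N (\<sigma> w) = t\<^sup>2 + (x - 2 * t) * (t\<^sup>2 * (x - w) / N w)"
          by (simp only: N_def[of "\<sigma> w"]) (simp only: \<sigma>_def)
        also have "\<dots> = (t\<^sup>2 * N w + (x - 2 * t) * (t\<^sup>2 * (x - w))) / N w"
          using Nw by (simp add: add_divide_distrib)
        also have "t\<^sup>2 * N w + (x - 2 * t) * (t\<^sup>2 * (x - w)) = b\<^sup>2"
          unfolding N_def b_def by (simp add: power2_eq_square algebra_simps)
        finally show ?thesis .
      qed
      have "\<sigma> (\<sigma> w) = t\<^sup>2 * (w * (x - t)\<^sup>2 / N w) / (b\<^sup>2 / N w)"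
        unfolding \<sigma>_def[of "\<sigma> w"] n s2[OF w(3,4)] ..
      also have "\<dots> = w" using Nw t unfolding b_def by (simp add: power2_eq_square)
      finally show ?thesis .
    qed
    then show "w \<in> \<sigma> ` S" using lt gt by (intro image_eqI[of _ _ "\<sigma> w"]) (auto simp: S_def)
  qed (use \<sigma>t in auto)
  have \<sigma>inj: "inj_on \<sigma> S"
  proof (rule linorder_inj_onI')
    fix u w assume uw: "u \<in> S" "w \<in> S" "u < w"
    have "\<sigma> w < \<sigma> u"
    proof (rule DERIV_neg_imp_decreasing[OF uw(3)])
      fix z assume "u \<le> z" "z \<le> w"
      then have z: "0 \<le> z" "z \<le> x" using Su[OF uw(1)] Su[OF uw(2)] by auto
      have "- b\<^sup>2 / (N z)\<^sup>2 < 0" using b Npos[OF z] by simp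
      then show "\<exists>y. (\<sigma> has_real_derivative y) (at z) \<and> y < 0" using s4[OF z] by blast
    qed
    then show "\<sigma> u \<noteq> \<sigma> w" by simp
  qed
  have vpos: "(\<sigma> u - u) / N u > 0" if "u \<in> S" for u
    using \<sigma>t[OF that] Su[OF that] Npos[OF Su(1,2)[OF that]] by simp
  have vinc: "v u < v w" if uw: "0 \<le> u" "u < w" "w \<le> t" for u w
  proof (rule DERIV_pos_imp_increasing_open[OF uw(2)])
    fix z assume "u < z" "z < w"
    then have z: "z \<in> S" using uw by (auto simp: S_def)
    show "\<exists>y. (v has_real_derivative y) (at z) \<and> y > 0" using v2[OF Su(1,2)[OF z]] vpos[OF z] by blast
  next
    show "continuous_on {u..w} v"
      by (rule DERIV_continuous_on[OF v2]) (use uw t in auto)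
  qed
  have v0: "v 0 = 0" by (simp add: v_def)
  have vt: "v t = 1" using v1[of t] t by simp
  have vimg: "v ` S = {0<..<1}"
  proof (intro equalityI subsetI)
    fix w assume "w \<in> v ` S"
    then obtain u where u: "u \<in> S" "w = v u" by auto
    then show "w \<in> {0<..<1}" using vinc[of 0 u] vinc[of u t] v0 vt Su[OF u(1)] by auto
  next
    fix w :: real assume w: "w \<in> {0<..<1}"
    have "continuous_on {0..t} v" by (rule DERIV_continuous_on[OF v2]) (use t in auto)
    then obtain u where u: "0 \<le> u" "u \<le> t" "v u = w"
      using IVT'[of v 0 w t] v0 vt w t by auto
    moreover have "u \<noteq> 0" "u \<noteq> t" using u v0 vt w by auto
    ultimately show "w \<in> v ` S" by (auto simp: S_def)
  qed
  have vinj: "inj_on v S"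
  proof (rule linorder_inj_onI')
    fix u w assume "u \<in> S" "w \<in> S" "u < w"
    then show "v u \<noteq> v w" using vinc[of u w] Su[of u] Su[of w] by simp
  qed
  have f: "f = (\<lambda>u. sgn (t - u) * \<bar>t - u\<bar> powr (- 2 * a) * mart_fn_deriv a x u)" by (simp add: f_def fun_eq_iff)
  have fi: "integrable lborel f" using int by (simp add: f)
  note f1 = integrable_lborel_imp_absolutely_integrable_on[OF fi, of S]
  note f2 = integrable_lborel_imp_absolutely_integrable_on[OF fi, of "\<sigma> ` S"]
  have Sm: "S \<in> sets borel" "\<sigma> ` S \<in> sets borel"
    by (simp add: S_def) (simp only: \<sigma>img greaterThanLessThan_borel)
  have sq_powr: "(z\<^sup>2) powr c = z powr (2 * c)" if "z > 0" for z c :: real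
    using powr_powr[of z 2 c] that by simp
  have split: "(LINT u|lborel. f u) = integral S f + integral (\<sigma> ` S) f"
  proof -
    have "f u = indicator S u * f u + indicator (\<sigma> ` S) u * f u" for u
      unfolding \<sigma>img by (auto simp: S_def f_def mart_fn_deriv_def indicator_def)
    then have "(LINT u|lborel. f u) = (LINT u|lborel. indicator S u * f u + indicator (\<sigma> ` S) u * f u)" by simp
    also have "\<dots> = (LINT u|lborel. indicator S u * f u) + (LINT u|lborel. indicator (\<sigma> ` S) u * f u)"
      using integrable_mult_indicator[OF _ fi] Sm by (intro Bochner_Integration.integral_add) auto
    finally show ?thesis using f1(2) f2(2) Sm by simp
  qed
  have "(\<lambda>u. \<bar>- b\<^sup>2 / (N u)\<^sup>2\<bar> * f (\<sigma> u)) absolutely_integrable_on S \<and> integral S (\<lambda>u. \<bar>- b\<^sup>2 / (N u)\<^sup>2\<bar> * f (\<sigma> u)) = integral (\<sigma> ` S) f"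
    using f2(1) Sm s4 Su \<sigma>inj
    by (subst has_absolute_integral_change_of_variables_1'[where g=\<sigma>]) auto
  then have F2: "(\<lambda>u. \<bar>- b\<^sup>2 / (N u)\<^sup>2\<bar> * f (\<sigma> u)) absolutely_integrable_on S"
    "integral (\<sigma> ` S) f = integral S (\<lambda>u. \<bar>- b\<^sup>2 / (N u)\<^sup>2\<bar> * f (\<sigma> u))" by auto
  have "integral S f + integral (\<sigma> ` S) f = integral S (\<lambda>u. f u + \<bar>- b\<^sup>2 / (N u)\<^sup>2\<bar> * f (\<sigma> u))"
    unfolding F2(2) using f1(1) F2(1) Sm
    by (intro Henstock_Kurzweil_Integration.integral_add[symmetric] set_lebesgue_integral_eq_integral(1)) auto
  also have "\<dots> = integral S (\<lambda>u. - 2 * a * (\<bar>(\<sigma> u - u) / N u\<bar> * (v u powr (a - 1) * (1 - v u) powr ((1 - a) - 1))))"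
  proof (rule Henstock_Kurzweil_Integration.integral_cong)
    fix u assume u: "u \<in> S"
    note u' = Su[OF u]
    have Nu: "N u > 0" by (rule Npos[OF u'(1,2)])
    have xu: "x - u > 0" using u' t by simp
    define p where "p = (t - u) powr (- 2 * a)"
    define q where "q = (u * (x - u)) powr (a - 1)"
    have fu: "f u = p * (a * q * (2 * u - x))"
      using u' t by (simp add: f_def mart_fn_deriv_def p_def q_def)
    have "f (\<sigma> u) = - ((\<sigma> u - t) powr (- 2 * a)) * (a * (\<sigma> u * (x - \<sigma> u)) powr (a - 1) * (2 * \<sigma> u - x))"
      using \<sigma>t[OF u] t by (simp add: f_def mart_fn_deriv_def)
    also have "(\<sigma> u - t) powr (- 2 * a) = (b / N u) powr (- 2 * a) * p"
    proof -
      have "\<sigma> u - t = (b / N u) * (t - u)" using s1[OF u'(1,2)] by simp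
      then show ?thesis using b Nu u' unfolding p_def by (simp only: powr_mult)
    qed
    also have "(\<sigma> u * (x - \<sigma> u)) powr (a - 1) = (b / N u) powr (2 * a - 2) * q"
    proof -
      have "\<sigma> u * (x - \<sigma> u) = (b / N u)\<^sup>2 * (u * (x - u))" using s3[OF u'(1,2)] by (simp add: power_divide)
      then have "(\<sigma> u * (x - \<sigma> u)) powr (a - 1) = ((b / N u)\<^sup>2) powr (a - 1) * q"
        using b Nu u' xu unfolding q_def by (simp only: powr_mult)
      also have "((b / N u)\<^sup>2) powr (a - 1) = (b / N u) powr (2 * a - 2)"
        using sq_powr[of "b / N u" "a - 1"] b Nu by (simp add: algebra_simps)
      finally show ?thesis .
    qed
    finally have "f (\<sigma> u) = - ((b / N u) powr (- 2 * a) * (b / N u) powr (2 * a - 2)) * (p * (a * q * (2 * \<sigma> u - x)))"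
      by (simp add: mult_ac)
    \<comment> \<open>The exponents - 2 a of the singular kernel and a - 1 of the integrand match:
      the powers of b / N combine to the reciprocal of the Jacobian b^2 / N^2.\<close>
    also have "(b / N u) powr (- 2 * a) * (b / N u) powr (2 * a - 2) = (b / N u) powr (- 2)"
      by (simp add: powr_add[symmetric])
    also have "(b / N u) powr (- 2) = (N u)\<^sup>2 / b\<^sup>2"
      using b Nu by (simp add: powr_minus powr_realpow[of _ 2, simplified] power_divide)
    finally have fs: "\<bar>- b\<^sup>2 / (N u)\<^sup>2\<bar> * f (\<sigma> u) = - (p * (a * q * (2 * \<sigma> u - x)))"
      using b Nu by simp
    \<comment> \<open>The factors 2 u - x and 2 \<sigma> u - x enter with opposite signs, which
      leaves a multiple of \<sigma> u - u, the numerator of the derivative of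
      \<open>v\<close>.\<close>
    have "f u + \<bar>- b\<^sup>2 / (N u)\<^sup>2\<bar> * f (\<sigma> u) = - 2 * a * ((\<sigma> u - u) * (p * q))"
      unfolding fu fs by (simp add: algebra_simps)
    also have "p * q = (v u powr (a - 1) * (1 - v u) powr ((1 - a) - 1)) / N u"
    proof -
      have p: "p = (1 - v u) powr (- a) * N u powr (- a)"
      proof -
        have "(1 - v u) * N u = (t - u)\<^sup>2" using v1[OF u'(1,2)] Nu by simp
        moreover have "p = ((t - u)\<^sup>2) powr (- a)"
          using u' sq_powr[of "t - u" "- a"] unfolding p_def by simp
        moreover have "1 - v u \<ge> 0" using v1[OF u'(1,2)] Nu by simp
        ultimately show ?thesis using Nu by (simp add: powr_mult[symmetric])
      qed
      have q: "q = v u powr (a - 1) * N u powr (a - 1)"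
      proof -
        have "v u * N u = u * (x - u)" using Nu by (simp add: v_def)
        moreover have "v u \<ge> 0" using u' xu Nu by (simp add: v_def)
        ultimately show ?thesis using Nu unfolding q_def by (simp add: powr_mult[symmetric])
      qed
      have "N u powr (- a) * N u powr (a - 1) = 1 / N u"
        using Nu powr_minus_divide[of "N u" 1] by (simp only: powr_add[symmetric]) simp
      moreover have "(1 - v u) powr (- a) * N u powr (- a) * (v u powr (a - 1) * N u powr (a - 1)) = v u powr (a - 1) * (1 - v u) powr (- a) * (N u powr (- a) * N u powr (a - 1))"
        by (simp only: mult_ac)
      ultimately have "(1 - v u) powr (- a) * N u powr (- a) * (v u powr (a - 1) * N u powr (a - 1)) = v u powr (a - 1) * (1 - v u) powr (- a) * (1 / N u)"
        by (simp only:)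
      then show ?thesis unfolding p q by simp
    qed
    finally show "f u + \<bar>- b\<^sup>2 / (N u)\<^sup>2\<bar> * f (\<sigma> u) = - 2 * a * (\<bar>(\<sigma> u - u) / N u\<bar> * (v u powr (a - 1) * (1 - v u) powr ((1 - a) - 1)))"
      unfolding abs_of_pos[OF vpos[OF u]] by simp
  qed
  also have "\<dots> = - 2 * a * integral S (\<lambda>u. \<bar>(\<sigma> u - u) / N u\<bar> * (v u powr (a - 1) * (1 - v u) powr ((1 - a) - 1)))"
    by (rule integral_mult_right)
  also have "integral S (\<lambda>u. \<bar>(\<sigma> u - u) / N u\<bar> * (v u powr (a - 1) * (1 - v u) powr ((1 - a) - 1))) = Beta a (1 - a)"
  proof -
    have hi: "((\<lambda>w. w powr (a - 1) * (1 - w) powr ((1 - a) - 1)) has_integral Beta a (1 - a)) {0<..<1}"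
      using has_integral_Beta_real[of a "1 - a"] a by (simp add: has_integral_Icc_iff_Ioo)
    then have "(\<lambda>w. w powr (a - 1) * (1 - w) powr ((1 - a) - 1)) absolutely_integrable_on v ` S \<and>
      integral (v ` S) (\<lambda>w. w powr (a - 1) * (1 - w) powr ((1 - a) - 1)) = Beta a (1 - a)"
      unfolding vimg by (auto simp: integral_unique intro!: nonnegative_absolutely_integrable_1 has_integral_integrable)
    then show ?thesis
      using has_absolute_integral_change_of_variables_1'[of S v "\<lambda>u. (\<sigma> u - u) / N u" "\<lambda>w. w powr (a - 1) * (1 - w) powr ((1 - a) - 1)" "Beta a (1 - a)"]
        Sm v2 Su vinj by auto
  qed
  finally show ?thesis using split by (simp add: f)
qed

section \<open>Covariance of the fundamental martingales\<close>

definition fbm_cov :: "real \<Rightarrow> real \<Rightarrow> real \<Rightarrow> real" where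
  "fbm_cov H s t = (s powr (2 * H) + t powr (2 * H) - \<bar>s - t\<bar> powr (2 * H)) / 2"

lemma mixed_cov_eq: "mixed_cov H s t = fbm_cov H s t + min s t"
  by (simp add: mixed_cov_def fbm_cov_def)

lemma fbm_cov_sym: "fbm_cov H s t = fbm_cov H t s"
  by (simp add: fbm_cov_def abs_minus_commute)

lemma fbm_cov_measurable [measurable]: "(\<lambda>(s, t). fbm_cov H s t) \<in> borel_measurable (borel \<Otimes>\<^sub>M borel)"
  unfolding fbm_cov_def by measurable

lemma fbm_cov_bound:
  assumes H: "H > 0" and st: "s \<in> {0..T}" "t \<in> {0..T}"
  shows "\<bar>fbm_cov H s t\<bar> \<le> 2 * T powr (2 * H)"
proof -
  have p: "x powr (2 * H) \<le> T powr (2 * H)" if "0 \<le> x" "x \<le> T" for x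
    using that H by (intro powr_mono2) auto
  have "s powr (2 * H) \<le> T powr (2 * H)" "t powr (2 * H) \<le> T powr (2 * H)" "\<bar>s - t\<bar> powr (2 * H) \<le> T powr (2 * H)"
    using st by (auto intro!: p)
  moreover have "0 \<le> s powr (2 * H)" "0 \<le> t powr (2 * H)" "0 \<le> \<bar>s - t\<bar> powr (2 * H)" by auto
  moreover have "\<bar>(p + q - r) / 2\<bar> \<le> 2 * K" if "0 \<le> p" "0 \<le> q" "0 \<le> r" "p \<le> K" "q \<le> K" "r \<le> K" for p q r K :: real
    using that by (auto simp: abs_le_iff field_simps)
  ultimately show ?thesis unfolding fbm_cov_def by blast
qed

lemma continuous_on_mixed_cov:
  assumes "H > 0" "A \<subseteq> {0..} \<times> {0..}"
  shows "continuous_on A (\<lambda>(s, t). mixed_cov H s t)"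
proof -
  have p: "continuous_on A (\<lambda>p. f p powr (2 * H))" if "continuous_on A f" "\<And>p. p \<in> A \<Longrightarrow> 0 \<le> f p"
    for f :: "real \<times> real \<Rightarrow> real"
    using that assms(1) by (intro continuous_on_powr' continuous_on_const) auto
  have f: "continuous_on A fst" "continuous_on A snd" by (intro continuous_on_fst continuous_on_snd continuous_on_id)+
  show ?thesis
    unfolding mixed_cov_def split_beta'
    by (intro continuous_on_add continuous_on_diff continuous_on_divide continuous_on_const continuous_on_min p
        continuous_on_rabs f) (use assms in auto)
qed

lemma integrable_mult_bounded_supp:
  fixes q \<psi> :: "real \<Rightarrow> real"
  assumes \<psi>: "integrable lborel \<psi>" and supp: "\<And>t. t \<notin> {0..T} \<Longrightarrow> \<psi> t = 0"
    and q [measurable]: "q \<in> borel_measurable borel" and C: "\<And>t. t \<in> {0..T} \<Longrightarrow> \<bar>q t\<bar> \<le> C"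
  shows "integrable lborel (\<lambda>t. q t * \<psi> t)" "\<bar>LINT t|lborel. q t * \<psi> t\<bar> \<le> C * (LINT t|lborel. \<bar>\<psi> t\<bar>)"
proof -
  have [measurable]: "\<psi> \<in> borel_measurable borel" using \<psi> by auto
  have le: "\<bar>q t * \<psi> t\<bar> \<le> C * \<bar>\<psi> t\<bar>" for t
    using C[of t] supp[of t] by (cases "t \<in> {0..T}") (auto simp: abs_mult intro!: mult_right_mono)
  show i: "integrable lborel (\<lambda>t. q t * \<psi> t)"
  proof (rule Bochner_Integration.integrable_bound)
    show "integrable lborel (\<lambda>t. C * \<bar>\<psi> t\<bar>)" using \<psi> by simp
    show "AE t in lborel. norm (q t * \<psi> t) \<le> norm (C * \<bar>\<psi> t\<bar>)"
      using le by (intro AE_I2) (auto intro: order_trans[OF le] simp del: abs_mult)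
  qed measurable
  have "\<bar>LINT t|lborel. q t * \<psi> t\<bar> \<le> (LINT t|lborel. C * \<bar>\<psi> t\<bar>)"
    by (rule integral_abs_bound_integral[OF i]) (use \<psi> le in auto)
  then show "\<bar>LINT t|lborel. q t * \<psi> t\<bar> \<le> C * (LINT t|lborel. \<bar>\<psi> t\<bar>)" by simp
qed

lemma mart_fn_deriv_supp: "t \<notin> {0..x} \<Longrightarrow> mart_fn_deriv a x t = 0"
  by (auto simp: mart_fn_deriv_def)

text \<open>The martingale property of \<open>\<integral> mart_fn a x dB\<close>: its covariance with \<open>B t\<close> is linear in \<open>t \<le> x\<close>.\<close>

lemma integral_fbm_cov_mart_fn_deriv:
  fixes a x t :: real
  assumes a: "0 < a" "a < 1/2" and x: "x > 0" and t: "0 \<le> t" "t \<le> x"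
  shows "(LINT u|lborel. fbm_cov (1/2 - a) t u * mart_fn_deriv a x u) = (1 - 2 * a) * a * Beta a (1 - a) * t"
proof -
  let ?\<psi> = "mart_fn_deriv a x"
  define k where "k u s = indicator {0..t} s * (sgn (s - u) * \<bar>s - u\<bar> powr (- 2 * a)) * ?\<psi> u" for u s
  have \<psi>i: "integrable lborel ?\<psi>" by (rule integrable_mart_fn_deriv[OF a(1) x])
  have exp2: "2 * (1/2 - a) = 1 - 2 * a" "(1 - 2 * a) - 1 = - 2 * a" by simp_all
  \<comment> \<open>The part of the covariance that depends on \<open>t\<close> alone therefore
    integrates to 0.\<close>
  have \<psi>0: "(LINT u|lborel. ?\<psi> u) = 0"
  proof -
    have eq: "(\<lambda>u. indicator {0..} u * ?\<psi> u) = ?\<psi>" by (auto simp: mart_fn_deriv_def indicator_def fun_eq_iff)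
    show ?thesis using integral_mart_fn_deriv[OF a(1) x, of 0] unfolding eq by (simp add: mart_fn_def)
  qed
  have km [measurable]: "(\<lambda>(u, s). k u s) \<in> borel_measurable (lborel \<Otimes>\<^sub>M lborel)"
    unfolding k_def by measurable
  have ki: "integrable (lborel \<Otimes>\<^sub>M lborel) (\<lambda>(u, s). k u s)"
  proof (rule lborel_pair.Fubini_integrable[OF km])
    define K where "K = 2 * x powr (- 2 * a + 1) / (- 2 * a + 1)"
    have ks: "integrable lborel (k u)" "(LINT s|lborel. \<bar>k u s\<bar>) \<le> K * \<bar>?\<psi> u\<bar>" for u
    proof -
      have "integrable lborel (k u) \<and> (LINT s|lborel. \<bar>k u s\<bar>) \<le> K * \<bar>?\<psi> u\<bar>"
      proof (cases "u \<in> {0..x}")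
        case True
        have i: "integrable lborel (\<lambda>s. indicator {0..x} s * \<bar>s - u\<bar> powr (- 2 * a))"
          "(LINT s|lborel. indicator {0..x} s * \<bar>s - u\<bar> powr (- 2 * a)) \<le> K"
          unfolding K_def by (rule integrable_abs_powr_Icc; use a True in simp)+
        have le: "\<bar>k u s\<bar> \<le> indicator {0..x} s * \<bar>s - u\<bar> powr (- 2 * a) * \<bar>?\<psi> u\<bar>" for s
          using t by (auto simp: k_def abs_mult indicator_def abs_sgn_eq)
        have i2: "integrable lborel (\<lambda>s. indicator {0..x} s * \<bar>s - u\<bar> powr (- 2 * a) * \<bar>?\<psi> u\<bar>)"
          using i(1) by (rule integrable_mult_left)
        have ki: "integrable lborel (k u)"
        proof (rule Bochner_Integration.integrable_bound[OF i2])
          show "k u \<in> borel_measurable lborel" unfolding k_def[abs_def] by measurable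
          show "AE s in lborel. norm (k u s) \<le> norm (indicator {0..x} s * \<bar>s - u\<bar> powr (- 2 * a) * \<bar>?\<psi> u\<bar>)"
            using le by (intro AE_I2) (auto intro: order_trans[OF le])
        qed
        have "(LINT s|lborel. \<bar>k u s\<bar>) \<le> (LINT s|lborel. indicator {0..x} s * \<bar>s - u\<bar> powr (- 2 * a) * \<bar>?\<psi> u\<bar>)"
          by (rule integral_mono[OF _ i2 le]) (use ki in simp)
        also have "\<dots> = (LINT s|lborel. indicator {0..x} s * \<bar>s - u\<bar> powr (- 2 * a)) * \<bar>?\<psi> u\<bar>"
          by (rule Bochner_Integration.integral_mult_left_zero)
        also have "\<dots> \<le> K * \<bar>?\<psi> u\<bar>" using i(2) by (rule mult_right_mono) simp
        finally show ?thesis using ki by simp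
      next
        case False
        then have "k u = (\<lambda>_. 0)" by (simp add: k_def fun_eq_iff mart_fn_deriv_supp)
        then show ?thesis using False by (simp add: mart_fn_deriv_supp)
      qed
      then show "integrable lborel (k u)" "(LINT s|lborel. \<bar>k u s\<bar>) \<le> K * \<bar>?\<psi> u\<bar>" by auto
    qed
    show "AE u in lborel. integrable lborel (\<lambda>s. case (u, s) of (u, s) \<Rightarrow> k u s)" using ks(1) by simp
    show "integrable lborel (\<lambda>u. LINT s|lborel. norm (case (u, s) of (u, s) \<Rightarrow> k u s))"
    proof (rule Bochner_Integration.integrable_bound)
      show "integrable lborel (\<lambda>u. K * \<bar>?\<psi> u\<bar>)" using \<psi>i by simp
      show "(\<lambda>u. LINT s|lborel. norm (case (u, s) of (u, s) \<Rightarrow> k u s)) \<in> borel_measurable lborel"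
        using km by (intro lborel.borel_measurable_lebesgue_integral) (simp add: split_beta')
      show "AE u in lborel. norm (LINT s|lborel. norm (case (u, s) of (u, s) \<Rightarrow> k u s)) \<le> norm (K * \<bar>?\<psi> u\<bar>)"
        using ks(2) by (intro AE_I2) (auto intro: order_trans[OF _ abs_ge_self] simp: integral_nonneg_AE)
    qed
  qed
  \<comment> \<open>The rest of the covariance is an integral of the singular kernel over s in
    [0, t]. After exchanging the integrals, the inner one is constant in \<open>s\<close> by
    \<open>integral_singular_mart_fn_deriv\<close>, whence the linearity in
    \<open>t\<close>.\<close>
  have inner: "fbm_cov (1/2 - a) t u * ?\<psi> u = (t powr (1 - 2 * a) / 2) * ?\<psi> u - ((1 - 2 * a) / 2) * (LINT s|lborel. k u s)" for u
  proof (cases "0 < u")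
    case True
    have "(LINT s|lborel. k u s) = (LINT s|lborel. indicator {0..t} s * (sgn (s - u) * \<bar>s - u\<bar> powr ((1 - 2 * a) - 1))) * ?\<psi> u"
      unfolding k_def exp2 by (rule Bochner_Integration.integral_mult_left_zero)
    also have "\<dots> = (\<bar>t - u\<bar> powr (1 - 2 * a) - u powr (1 - 2 * a)) / (1 - 2 * a) * ?\<psi> u"
      using a t True by (subst integral_sgn_powr) auto
    finally have I: "(LINT s|lborel. k u s) = (\<bar>t - u\<bar> powr (1 - 2 * a) - u powr (1 - 2 * a)) / (1 - 2 * a) * ?\<psi> u" .
    have "(1 - 2 * a) / 2 * (LINT s|lborel. k u s) = (\<bar>t - u\<bar> powr (1 - 2 * a) - u powr (1 - 2 * a)) / 2 * ?\<psi> u"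
    proof -
      have *: "d / 2 * (X / d * p) = X / 2 * p" if "d \<noteq> 0" for d X p :: real using that by simp
      show ?thesis unfolding I by (rule *) (use a in simp)
    qed
    then show ?thesis unfolding fbm_cov_def exp2 by (simp add: algebra_simps diff_divide_distrib add_divide_distrib)
  next
    case False
    then show ?thesis by (simp add: k_def mart_fn_deriv_def)
  qed
  have Ki: "integrable lborel (\<lambda>u. LINT s|lborel. k u s)"
    using lborel_pair.integrable_fst'[OF ki] by simp
  have "(LINT u|lborel. fbm_cov (1/2 - a) t u * ?\<psi> u) = - ((1 - 2 * a) / 2) * (LINT u|lborel. (LINT s|lborel. k u s))"
    unfolding inner using \<psi>i Ki \<psi>0 by (subst Bochner_Integration.integral_diff) auto
  also have "(LINT u|lborel. (LINT s|lborel. k u s)) = (LINT s|lborel. (LINT u|lborel. k u s))"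
    using lborel_pair.Fubini_integral[OF ki] by simp
  also have "\<dots> = (LINT s|lborel. indicator {0..t} s * (- 2 * a * Beta a (1 - a)))"
  proof (rule integral_cong_AE)
    show "(\<lambda>s. LINT u|lborel. k u s) \<in> borel_measurable lborel"
      using lborel_pair.integrable_snd[OF ki] by auto
    \<comment> \<open>Fubini provides integrability in \<open>u\<close> for almost every
      \<open>s\<close>, which is the hypothesis of the key identity. The end points are removed
      because that identity needs \<open>s\<close> strictly between 0 and \<open>x\<close>.\<close>
    have "AE s in lborel. integrable lborel (\<lambda>u. k u s)" using lborel_pair.AE_integrable_snd[OF ki] by simp
    moreover have "AE s in lborel. s \<noteq> 0" "AE s in lborel. s \<noteq> t" by (auto intro: AE_lborel_singleton)
    ultimately show "AE s in lborel. (LINT u|lborel. k u s) = indicator {0..t} s * (- 2 * a * Beta a (1 - a))"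
    proof eventually_elim
      case (elim s)
      show ?case
      proof (cases "s \<in> {0..t}")
        case True
        then have s: "0 < s" "s < x" using elim t by auto
        have k: "k u s = sgn (s - u) * \<bar>s - u\<bar> powr (- 2 * a) * ?\<psi> u" for u using True by (simp add: k_def)
        have "(LINT u|lborel. k u s) = - 2 * a * Beta a (1 - a)"
          unfolding k by (rule integral_singular_mart_fn_deriv) (use a s elim(1) in \<open>auto simp: k\<close>)
        then show ?thesis using True by simp
      qed (simp add: k_def)
    qed
  qed measurable
  also have "\<dots> = t * (- 2 * a * Beta a (1 - a))"
    using t by simp
  finally show ?thesis by (simp add: field_simps)
qed

text \<open>Integration by parts for the identity, whose derivative on [0, y] is 1; the integral of
  \<open>mart_fn\<close> remains.\<close>

lemma integral_id_mart_fn_deriv: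
  assumes a: "a > 0" and y: "y > 0"
  shows "(LINT s|lborel. s * mart_fn_deriv a y s) = y powr (2 * a + 1) * Beta (a + 1) (a + 1)"
proof -
  have "(LINT s|lborel. s * mart_fn_deriv a y s) = (LINT s|lborel. indicator {0..y} s * (indicator {0<..} s * (LINT t|lborel. indicator {s..} t * mart_fn_deriv a y t)))"
  proof (rule integral_by_parts_Fubini[where T=y])
    fix t assume t: "t \<in> {0..y}"
    have "(LINT s|lborel. indicator {s. 0 < s \<and> s \<le> t} s * indicator {0..y} s :: real) = (LINT s|lborel. indicator {0<..t} s)"
      using t by (intro Bochner_Integration.integral_cong) (auto simp: indicator_def)
    then show "t = (LINT s|lborel. indicator {s. 0 < s \<and> s \<le> t} s * indicator {0..y} s)" using t by simp
  qed (use integrable_mart_fn_deriv[OF a y] mart_fn_deriv_supp in \<open>auto intro!: integrable_real_indicator simp: emeasure_lborel_Icc_eq\<close>)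
  also have "\<dots> = (LINT s|lborel. mart_fn a y s)"
  proof (rule Bochner_Integration.integral_cong[OF refl])
    fix s
    show "indicator {0..y} s * (indicator {0<..} s * (LINT t|lborel. indicator {s..} t * mart_fn_deriv a y t)) = mart_fn a y s"
      using integral_mart_fn_deriv[OF a y, of s] by (auto simp: indicator_def mart_fn_def)
  qed
  finally show ?thesis using integral_mart_fn[OF a y] by (simp add: has_bochner_integral_iff)
qed

text \<open>The covariance of the integrals of \<open>B\<close> against \<open>\<phi>\<close> and
  against \<open>\<psi>\<close>.\<close>

definition fbm_form :: "real \<Rightarrow> (real \<Rightarrow> real) \<Rightarrow> (real \<Rightarrow> real) \<Rightarrow> real" where
  "fbm_form H \<phi> \<psi> = (LINT s|lborel. (LINT t|lborel. fbm_cov H s t * \<phi> t) * \<psi> s)"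

lemma fbm_form_sym:
  assumes H: "H > 0" and \<phi>: "integrable lborel \<phi>" "\<And>t. t \<notin> {0..T} \<Longrightarrow> \<phi> t = 0"
    and \<psi>: "integrable lborel \<psi>" "\<And>t. t \<notin> {0..T} \<Longrightarrow> \<psi> t = 0" and T: "T \<ge> 0"
  shows "fbm_form H \<phi> \<psi> = fbm_form H \<psi> \<phi>"
proof -
  define q where "q s t = indicator {0..T} s * indicator {0..T} t * fbm_cov H s t" for s t :: real
  have qm: "(\<lambda>(s, t). q s t) \<in> borel_measurable (lborel \<Otimes>\<^sub>M lborel)" unfolding q_def by measurable
  have q: "fbm_cov H s t * \<phi> t * \<psi> s = q s t * (\<psi> s * \<phi> t)" for s t
    using \<phi>(2)[of t] \<psi>(2)[of s] by (auto simp: q_def indicator_def)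
  have "integrable (lborel \<Otimes>\<^sub>M lborel) (\<lambda>(s, t). q s t * (\<psi> s * \<phi> t))"
  proof (rule integrable_pair_product[OF \<psi>(1) \<phi>(1) qm])
    show "\<bar>q s t\<bar> \<le> 2 * T powr (2 * H)" for s t
      using fbm_cov_bound[OF H, of s T t] by (auto simp: q_def indicator_def)
  qed
  note F = lborel_pair.Fubini_integral[OF this]
  have "fbm_form H \<phi> \<psi> = (LINT s|lborel. (LINT t|lborel. q s t * (\<psi> s * \<phi> t)))"
    unfolding fbm_form_def by (simp add: q[symmetric])
  also have "\<dots> = (LINT t|lborel. (LINT s|lborel. q s t * (\<psi> s * \<phi> t)))" using F by simp
  also have "\<dots> = (LINT t|lborel. (LINT s|lborel. fbm_cov H t s * \<psi> s * \<phi> t))"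
  proof -
    have "q s t * (\<psi> s * \<phi> t) = fbm_cov H t s * \<psi> s * \<phi> t" for s t
      unfolding q[symmetric] fbm_cov_sym[of H s t] by (simp add: mult_ac)
    then show ?thesis by (simp only:)
  qed
  also have "\<dots> = fbm_form H \<psi> \<phi>" unfolding fbm_form_def by simp
  finally show ?thesis .
qed

text \<open>For y <= x, integrating the covariance against the kernel with index \<open>x\<close>
  gives a linear function on [0, y] that no longer depends on \<open>x\<close>. Only the smaller
  index survives, as for the covariance of a martingale.\<close>

lemma fbm_form_mart_fn_deriv:
  assumes a: "0 < a" "a < 1/2" and x: "0 < x" and y: "0 < y"
  shows "fbm_form (1/2 - a) (mart_fn_deriv a x) (mart_fn_deriv a y)
    = (1 - 2 * a) * a * Beta a (1 - a) * Beta (a + 1) (a + 1) * min x y powr (2 * a + 1)"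
proof -
  have le: "fbm_form (1/2 - a) (mart_fn_deriv a x) (mart_fn_deriv a y)
    = (1 - 2 * a) * a * Beta a (1 - a) * Beta (a + 1) (a + 1) * y powr (2 * a + 1)" if y: "0 < y" "y \<le> x" for x y
  proof -
    have x: "x > 0" using y by simp
    have "fbm_form (1/2 - a) (mart_fn_deriv a x) (mart_fn_deriv a y) =
      (LINT s|lborel. ((1 - 2 * a) * a * Beta a (1 - a)) * (s * mart_fn_deriv a y s))"
      unfolding fbm_form_def
    proof (rule Bochner_Integration.integral_cong[OF refl])
      fix s
      show "(LINT t|lborel. fbm_cov (1/2 - a) s t * mart_fn_deriv a x t) * mart_fn_deriv a y s = ((1 - 2 * a) * a * Beta a (1 - a)) * (s * mart_fn_deriv a y s)"
      proof (cases "s \<in> {0..y}")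
        case True
        then have "(LINT t|lborel. fbm_cov (1/2 - a) s t * mart_fn_deriv a x t) = (1 - 2 * a) * a * Beta a (1 - a) * s"
          using y by (intro integral_fbm_cov_mart_fn_deriv a x) auto
        then show ?thesis by simp
      qed (simp add: mart_fn_deriv_supp)
    qed
    also have "\<dots> = ((1 - 2 * a) * a * Beta a (1 - a)) * (LINT s|lborel. s * mart_fn_deriv a y s)"
      by (rule Bochner_Integration.integral_mult_right_zero)
    finally show ?thesis unfolding integral_id_mart_fn_deriv[OF a(1) y(1)] by simp
  qed
  show ?thesis
  proof (cases "y \<le> x")
    case True then show ?thesis using le[OF y True] by simp
  next
    case False
    have "fbm_form (1/2 - a) (mart_fn_deriv a x) (mart_fn_deriv a y) = fbm_form (1/2 - a) (mart_fn_deriv a y) (mart_fn_deriv a x)"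
      by (rule fbm_form_sym[where T="max x y"])
        (use a x y integrable_mart_fn_deriv[OF a(1)] in \<open>auto simp: mart_fn_deriv_def\<close>)
    then show ?thesis using le[OF x, of y] False by simp
  qed
qed

lemma fbm_cov_integral_measurable:
  assumes "integrable lborel \<psi>"
  shows "(\<lambda>s. LINT t|lborel. fbm_cov H s t * \<psi> t) \<in> borel_measurable borel"
proof -
  have [measurable]: "\<psi> \<in> borel_measurable borel" using assms by auto
  have "(\<lambda>(s, t). fbm_cov H s t * \<psi> t) \<in> borel_measurable (borel \<Otimes>\<^sub>M lborel)"
    unfolding fbm_cov_def by measurable
  then show ?thesis by (rule lborel.borel_measurable_lebesgue_integral)
qed

lemma fbm_cov_section_measurable [measurable]: "(\<lambda>t. fbm_cov H s t) \<in> borel_measurable borel"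
  unfolding fbm_cov_def by measurable

lemma fbm_form_integrable:
  assumes H: "H > 0" and \<phi>: "integrable lborel \<phi>" "\<And>t. t \<notin> {0..T} \<Longrightarrow> \<phi> t = 0"
    and \<psi>: "integrable lborel \<psi>" "\<And>t. t \<notin> {0..T} \<Longrightarrow> \<psi> t = 0"
  shows "s \<in> {0..T} \<Longrightarrow> integrable lborel (\<lambda>t. fbm_cov H s t * \<phi> t)"
    and "integrable lborel (\<lambda>s. (LINT t|lborel. fbm_cov H s t * \<phi> t) * \<psi> s)"
proof -
  show 1: "integrable lborel (\<lambda>t. fbm_cov H s t * \<phi> t)" if "s \<in> {0..T}" for s
    by (rule integrable_mult_bounded_supp(1)[OF \<phi>, where C="2 * T powr (2 * H)"])
      (use fbm_cov_bound[OF H that] in auto)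
  have 2: "\<bar>LINT t|lborel. fbm_cov H s t * \<phi> t\<bar> \<le> 2 * T powr (2 * H) * (LINT t|lborel. \<bar>\<phi> t\<bar>)" if "s \<in> {0..T}" for s
    by (rule integrable_mult_bounded_supp(2)[OF \<phi>]) (use fbm_cov_bound[OF H that] in auto)
  show "integrable lborel (\<lambda>s. (LINT t|lborel. fbm_cov H s t * \<phi> t) * \<psi> s)"
    by (rule integrable_mult_bounded_supp(1)[OF \<psi> fbm_cov_integral_measurable[OF \<phi>(1)] 2])
qed

lemma fbm_form_sum:
  assumes H: "H > 0" and X: "finite X"
    and \<psi>: "\<And>x. x \<in> X \<Longrightarrow> integrable lborel (\<psi> x)" "\<And>x t. x \<in> X \<Longrightarrow> t \<notin> {0..T} \<Longrightarrow> \<psi> x t = 0"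
  shows "fbm_form H (\<lambda>t. \<Sum>x\<in>X. c x * \<psi> x t) (\<lambda>t. \<Sum>x\<in>X. c x * \<psi> x t) = (\<Sum>x\<in>X. \<Sum>y\<in>X. c x * c y * fbm_form H (\<psi> x) (\<psi> y))"
proof -
  have inner: "(LINT t|lborel. fbm_cov H s t * (\<Sum>x\<in>X. c x * \<psi> x t)) = (\<Sum>x\<in>X. c x * (LINT t|lborel. fbm_cov H s t * \<psi> x t))"
    if s: "s \<in> {0..T}" for s
  proof -
    have "(LINT t|lborel. fbm_cov H s t * (\<Sum>x\<in>X. c x * \<psi> x t)) = (LINT t|lborel. (\<Sum>x\<in>X. c x * (fbm_cov H s t * \<psi> x t)))"
      by (simp add: sum_distrib_left mult_ac)
    also have "\<dots> = (\<Sum>x\<in>X. (LINT t|lborel. c x * (fbm_cov H s t * \<psi> x t)))"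
      by (intro Bochner_Integration.integral_sum integrable_mult_right fbm_form_integrable(1)[OF H \<psi> \<psi> s]) auto
    finally show ?thesis by simp
  qed
  have "fbm_form H (\<lambda>t. \<Sum>x\<in>X. c x * \<psi> x t) (\<lambda>t. \<Sum>x\<in>X. c x * \<psi> x t)
    = (LINT s|lborel. (\<Sum>x\<in>X. \<Sum>y\<in>X. c x * c y * ((LINT t|lborel. fbm_cov H s t * \<psi> x t) * \<psi> y s)))"
    unfolding fbm_form_def
  proof (rule Bochner_Integration.integral_cong[OF refl])
    fix s
    show "(LINT t|lborel. fbm_cov H s t * (\<Sum>x\<in>X. c x * \<psi> x t)) * (\<Sum>x\<in>X. c x * \<psi> x s)
      = (\<Sum>x\<in>X. \<Sum>y\<in>X. c x * c y * ((LINT t|lborel. fbm_cov H s t * \<psi> x t) * \<psi> y s))"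
    proof (cases "s \<in> {0..T}")
      case True
      show ?thesis unfolding inner[OF True] sum_product by (intro sum.cong refl) (simp add: mult_ac)
    next
      case False
      then show ?thesis using \<psi>(2) by simp
    qed
  qed
  also have "\<dots> = (\<Sum>x\<in>X. \<Sum>y\<in>X. (LINT s|lborel. c x * c y * ((LINT t|lborel. fbm_cov H s t * \<psi> x t) * \<psi> y s)))"
  proof -
    have i: "integrable lborel (\<lambda>s. c x * c y * ((LINT t|lborel. fbm_cov H s t * \<psi> x t) * \<psi> y s))" if "x \<in> X" "y \<in> X" for x y
      by (intro integrable_mult_right fbm_form_integrable(2)[OF H, where T=T]) (use that \<psi> in auto)
    then have "(LINT s|lborel. (\<Sum>x\<in>X. \<Sum>y\<in>X. c x * c y * ((LINT t|lborel. fbm_cov H s t * \<psi> x t) * \<psi> y s)))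
      = (\<Sum>x\<in>X. (LINT s|lborel. (\<Sum>y\<in>X. c x * c y * ((LINT t|lborel. fbm_cov H s t * \<psi> x t) * \<psi> y s))))"
      by (intro Bochner_Integration.integral_sum Bochner_Integration.integrable_sum) blast
    also have "\<dots> = (\<Sum>x\<in>X. \<Sum>y\<in>X. (LINT s|lborel. c x * c y * ((LINT t|lborel. fbm_cov H s t * \<psi> x t) * \<psi> y s)))"
      by (intro sum.cong refl Bochner_Integration.integral_sum i)
    finally show ?thesis .
  qed
  also have "\<dots> = (\<Sum>x\<in>X. \<Sum>y\<in>X. c x * c y * fbm_form H (\<psi> x) (\<psi> y))"
    unfolding fbm_form_def by simp
  finally show ?thesis .
qed

text \<open>For the Wiener part, two integrations by parts, in the inner and then in the outer
  integral, move both factors \<open>\<psi>\<close> over to \<open>\<phi>\<close> and leave the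
  integral of its square.\<close>

lemma mixed_cov_form:
  assumes H: "H > 0" and T: "T \<ge> 0" and \<psi>: "integrable lborel \<psi>" "\<And>t. t \<notin> {0..T} \<Longrightarrow> \<psi> t = 0"
    and \<phi>: "integrable lborel \<phi>" "\<And>s. s \<le> 0 \<Longrightarrow> \<phi> s = 0" "\<And>s. s \<ge> 0 \<Longrightarrow> (LINT t|lborel. indicator {s..} t * \<psi> t) = \<phi> s"
  shows "(LINT s|lborel. (LINT t|lborel. mixed_cov H s t * \<psi> t) * \<psi> s) = fbm_form H \<psi> \<psi> + (LINT s|lborel. (\<phi> s)\<^sup>2)"
proof -
  have [measurable]: "\<psi> \<in> borel_measurable borel" using \<psi> by auto
  have \<phi>': "indicator {0<..} s * (LINT t|lborel. indicator {s..} t * \<psi> t) = \<phi> s" for s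
    using \<phi>(2,3)[of s] by (auto simp: indicator_def)
  have mi: "integrable lborel (\<lambda>t. min s t * \<psi> t)" if "s \<in> {0..T}" for s
    by (rule integrable_mult_bounded_supp(1)[OF \<psi>, where C=T]) (use that in auto)
  have mb: "\<bar>LINT t|lborel. min s t * \<psi> t\<bar> \<le> T * (LINT t|lborel. \<bar>\<psi> t\<bar>)" if "s \<in> {0..T}" for s
    by (rule integrable_mult_bounded_supp(2)[OF \<psi>]) (use that in auto)
  have mm: "(\<lambda>s. LINT t|lborel. min s t * \<psi> t) \<in> borel_measurable borel"
    by (rule lborel.borel_measurable_lebesgue_integral) measurable
  have mi2: "integrable lborel (\<lambda>s. (LINT t|lborel. min s t * \<psi> t) * \<psi> s)"
    by (rule integrable_mult_bounded_supp(1)[OF \<psi> mm mb])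
  have min: "(LINT t|lborel. min s t * \<psi> t) = (LINT u|lborel. indicator {u. 0 < u \<and> u \<le> s} u * \<phi> u)" if s: "s \<in> {0..T}" for s
  proof -
    have "(LINT t|lborel. min s t * \<psi> t) = (LINT u|lborel. indicator {0<..s} u * (indicator {0<..} u * (LINT t|lborel. indicator {u..} t * \<psi> t)))"
    proof (rule integral_by_parts_Fubini[where T=T, OF _ \<psi>])
      fix t assume t: "t \<in> {0..T}"
      have "(LINT u|lborel. indicator {u. 0 < u \<and> u \<le> t} u * indicator {0<..s} u :: real) = (LINT u|lborel. indicator {0<..min s t} u)"
        by (intro Bochner_Integration.integral_cong) (auto simp: indicator_def)
      then show "min s t = (LINT u|lborel. indicator {u. 0 < u \<and> u \<le> t} u * indicator {0<..s} u)" using t s by simp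
    qed (use s in \<open>auto intro!: integrable_real_indicator\<close>)
    also have "\<dots> = (LINT u|lborel. indicator {u. 0 < u \<and> u \<le> s} u * \<phi> u)"
      unfolding \<phi>' by (intro Bochner_Integration.integral_cong) (auto simp: indicator_def)
    finally show ?thesis .
  qed
  have "(LINT s|lborel. (LINT t|lborel. mixed_cov H s t * \<psi> t) * \<psi> s)
    = (LINT s|lborel. (LINT t|lborel. fbm_cov H s t * \<psi> t) * \<psi> s + (LINT t|lborel. min s t * \<psi> t) * \<psi> s)"
  proof (rule Bochner_Integration.integral_cong[OF refl])
    fix s
    show "(LINT t|lborel. mixed_cov H s t * \<psi> t) * \<psi> s = (LINT t|lborel. fbm_cov H s t * \<psi> t) * \<psi> s + (LINT t|lborel. min s t * \<psi> t) * \<psi> s"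
    proof (cases "s \<in> {0..T}")
      case True
      have "(LINT t|lborel. mixed_cov H s t * \<psi> t) = (LINT t|lborel. fbm_cov H s t * \<psi> t) + (LINT t|lborel. min s t * \<psi> t)"
        unfolding mixed_cov_eq distrib_right
        by (rule Bochner_Integration.integral_add[OF fbm_form_integrable(1)[OF H \<psi> \<psi> True] mi[OF True]])
      then show ?thesis by (simp add: distrib_right)
    qed (simp add: \<psi>(2))
  qed
  also have "\<dots> = fbm_form H \<psi> \<psi> + (LINT s|lborel. (LINT t|lborel. min s t * \<psi> t) * \<psi> s)"
    unfolding fbm_form_def by (rule Bochner_Integration.integral_add[OF fbm_form_integrable(2)[OF H \<psi> \<psi>] mi2])
  also have "(LINT s|lborel. (LINT t|lborel. min s t * \<psi> t) * \<psi> s) = (LINT s|lborel. \<phi> s * (indicator {0<..} s * (LINT t|lborel. indicator {s..} t * \<psi> t)))"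
  proof (rule integral_by_parts_Fubini[where T=T])
    show "(LINT u|lborel. min t u * \<psi> u) = (LINT s|lborel. indicator {s. 0 < s \<and> s \<le> t} s * \<phi> s)" if "t \<in> {0..T}" for t
      by (rule min[OF that])
  qed (use \<phi>(1) \<psi> in auto)
  finally show ?thesis unfolding \<phi>' by (simp add: power2_eq_square)
qed

definition pow_fn :: "real \<Rightarrow> real \<Rightarrow> real \<Rightarrow> real" where
  "pow_fn a x u = indicator {0<..x} u * u powr a"

lemma pow_fn_measurable [measurable]: "pow_fn a x \<in> borel_measurable borel"
  unfolding pow_fn_def[abs_def] by measurable

text \<open>Up to a constant factor this is the Gram matrix in
  \<open>fbm_form_mart_fn_deriv\<close>. Matching \<open>pow_fn a x\<close> with
  \<open>mart_fn_deriv a x\<close> thus turns the fractional covariance into a multiple of the L2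
  inner product.\<close>

lemma integral_pow_fn:
  assumes "a > 0" "x > 0" "y > 0"
  shows "has_bochner_integral lborel (\<lambda>u. pow_fn a x u * pow_fn a y u) (min x y powr (2 * a + 1) / (2 * a + 1))"
proof -
  have "pow_fn a x u * pow_fn a y u = indicator {0..min x y} u * u powr (2 * a)" for u
    by (auto simp: pow_fn_def indicator_def powr_add[symmetric])
  then show ?thesis using has_bochner_integral_powr_0[of "2 * a" "min x y"] assms by simp
qed

text \<open>The left-hand side is the ratio of the two Gram matrices, and its root is the reciprocal
  of the factor with which the operator maps \<open>pow_fn\<close> to \<open>mart_fn\<close> in
  \<open>frac_kernel_pow_fn\<close>. This agreement is what the normalization \<open>C1\<close>
  provides.\<close>

lemma C1_Gamma_square:
  assumes a: "0 < a" "a < 1/2"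
  shows "(1 - 2 * a) * a * Beta a (1 - a) * Beta (a + 1) (a + 1) * (2 * a + 1) = (a * C1 (1/2 - a) * Gamma a)\<^sup>2"
proof -
  have pos: "Gamma a > 0" "Gamma (1 - a) > 0" "Gamma (1 + a) > 0" "Gamma (1 + 2 * a) > 0"
    using a by (auto intro!: Gamma_real_pos)
  have e: "1/2 - a + 1/2 = 1 - a" "3/2 - (1/2 - a) = 1 + a" "2 - 2 * (1/2 - a) = 1 + 2 * a" "2 * (1/2 - a) = 1 - 2 * a"
    by (simp_all add: field_simps)
  have n: "a \<notin> \<int>\<^sub>\<le>\<^sub>0" "1 + 2 * a \<notin> \<int>\<^sub>\<le>\<^sub>0" using a by (auto elim!: nonpos_Ints_cases)
  have g1: "Gamma (1 + a) = a * Gamma a" using Gamma_plus1[of a] n by (simp add: add.commute)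
  have g2: "Gamma (a + 1 + (a + 1)) = (1 + 2 * a) * Gamma (1 + 2 * a)"
    using Gamma_plus1[of "1 + 2 * a"] n by (simp add: algebra_simps)
  have C: "(C1 (1/2 - a))\<^sup>2 = (1 - 2 * a) * Gamma (1 - a) * Gamma (1 + a) / Gamma (1 + 2 * a)"
  proof -
    have "0 \<le> (1 - 2 * a) * Gamma (1 - a) * Gamma (1 + a) / Gamma (1 + 2 * a)" using pos a by simp
    then show ?thesis unfolding C1_def e by (simp add: powr_half_sqrt)
  qed
  have b1: "Beta a (1 - a) = Gamma a * Gamma (1 - a)" by (simp add: Beta_def)
  have b2: "Beta (a + 1) (a + 1) = Gamma (1 + a) * Gamma (1 + a) / ((1 + 2 * a) * Gamma (1 + 2 * a))"
    unfolding Beta_def g2 by (simp add: add.commute)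
  have "(1 - 2 * a) * a * Beta a (1 - a) * Beta (a + 1) (a + 1) * (2 * a + 1)
    = (1 - 2 * a) * a * (Gamma a * Gamma (1 - a)) * (Gamma (1 + a) * Gamma (1 + a) / Gamma (1 + 2 * a))"
    unfolding b1 b2 using a by (simp add: add.commute)
  also have "\<dots> = a\<^sup>2 * (Gamma a)\<^sup>2 * ((1 - 2 * a) * Gamma (1 - a) * Gamma (1 + a) / Gamma (1 + 2 * a))"
    unfolding g1 by (simp add: power2_eq_square)
  also have "\<dots> = (a * C1 (1/2 - a) * Gamma a)\<^sup>2" unfolding C[symmetric] by (simp add: power_mult_distrib)
  finally show ?thesis .
qed

lemma C1_pos: "0 < a \<Longrightarrow> a < 1/2 \<Longrightarrow> C1 (1/2 - a) > 0"
proof -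
  assume a: "0 < a" "a < 1/2"
  have e: "1/2 - a + 1/2 = 1 - a" "3/2 - (1/2 - a) = 1 + a" "2 - 2 * (1/2 - a) = 1 + 2 * a" "2 * (1/2 - a) = 1 - 2 * a"
    by (simp_all add: field_simps)
  have pos: "Gamma (1 - a) > 0" "Gamma (1 + a) > 0" "Gamma (1 + 2 * a) > 0"
    using a by (auto intro!: Gamma_real_pos)
  have "(1 - 2 * a) * Gamma (1 - a) * Gamma (1 + a) / Gamma (1 + 2 * a) > 0"
    using a pos by (intro divide_pos_pos mult_pos_pos) auto
  then show ?thesis unfolding C1_def unfolding e(1-3) unfolding e(4) powr_gt_zero by (metis less_irrefl)
qed

text \<open>With \<open>P = \<Sum> c x \<cdot> pow_fn a x\<close>, the functional \<open>- \<integral> X d\<phi>\<close> has the variance \<open>\<parallel>\<phi>\<parallel>\<^sup>2 + (a C\<^sub>1 \<Gamma>(a))\<^sup>2 \<parallel>P\<parallel>\<^sup>2\<close>.\<close>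

lemma mixed_cov_form_mart_fn:
  fixes c :: "real \<Rightarrow> real"
  assumes a: "0 < a" "a < 1/2" and X: "finite X" "X \<subseteq> {0<..T}" and T: "T > 0"
  defines "\<psi> \<equiv> \<lambda>t. \<Sum>x\<in>X. c x * mart_fn_deriv a x t"
  shows "integrable lborel \<psi>" "\<And>t. t \<notin> {0..T} \<Longrightarrow> \<psi> t = 0"
    and "(LINT s|lborel. (LINT t|lborel. mixed_cov (1/2 - a) s t * \<psi> t) * \<psi> s) =
      (LINT s|lborel. (\<Sum>x\<in>X. c x * mart_fn a x s)\<^sup>2) + (a * C1 (1/2 - a) * Gamma a)\<^sup>2 * (LINT s|lborel. (\<Sum>x\<in>X. c x * pow_fn a x s)\<^sup>2)"
    and "integrable lborel (\<lambda>s. (\<Sum>x\<in>X. c x * pow_fn a x s)\<^sup>2)"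
    and "\<And>g G. integrable lborel G \<Longrightarrow> (\<And>t. t \<in> {0..T} \<Longrightarrow> g t = (LINT s|lborel. indicator {s. 0 < s \<and> s \<le> t} s * G s)) \<Longrightarrow>
      (LINT t|lborel. g t * \<psi> t) = (LINT s|lborel. G s * (\<Sum>x\<in>X. c x * mart_fn a x s))"
proof -
  let ?\<phi> = "\<lambda>s. \<Sum>x\<in>X. c x * mart_fn a x s"
  have x: "x > 0" "x \<le> T" if "x \<in> X" for x using X that by auto
  have i: "integrable lborel (mart_fn_deriv a x)" if "x \<in> X" for x
    by (rule integrable_mart_fn_deriv[OF a(1) x(1)[OF that]])
  have s: "mart_fn_deriv a x t = 0" if "x \<in> X" "t \<notin> {0..T}" for x t
    using x[OF that(1)] that(2) by (auto simp: mart_fn_deriv_def)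
  show \<psi>i: "integrable lborel \<psi>" unfolding \<psi>_def by (intro Bochner_Integration.integrable_sum integrable_mult_right i)
  show \<psi>s: "\<psi> t = 0" if "t \<notin> {0..T}" for t unfolding \<psi>_def using s that by (intro sum.neutral) simp
  have \<phi>i: "integrable lborel ?\<phi>"
    by (intro Bochner_Integration.integrable_sum integrable_mult_right) (use integral_mart_fn[OF a(1) x(1)] in \<open>auto simp: has_bochner_integral_iff\<close>)
  have \<phi>0: "?\<phi> s = 0" if "s \<le> 0" for s using that by (intro sum.neutral) (simp add: mart_fn_def)
  have \<phi>\<psi>: "(LINT t|lborel. indicator {s..} t * \<psi> t) = ?\<phi> s" if "s \<ge> 0" for s
  proof -
    have "(LINT t|lborel. indicator {s..} t * \<psi> t) = (LINT t|lborel. (\<Sum>x\<in>X. c x * (indicator {s..} t * mart_fn_deriv a x t)))"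
      unfolding \<psi>_def by (simp add: sum_distrib_left mult_ac)
    also have "\<dots> = (\<Sum>x\<in>X. (LINT t|lborel. c x * (indicator {s..} t * mart_fn_deriv a x t)))"
    proof (intro Bochner_Integration.integral_sum integrable_mult_right)
      fix x assume "x \<in> X"
      then show "integrable lborel (\<lambda>t. indicator {s..} t * mart_fn_deriv a x t)"
        using integrable_mult_indicator[OF _ i, of "{s..}" x] by simp
    qed
    also have "\<dots> = ?\<phi> s" using x that by (simp add: integral_mart_fn_deriv[OF a(1)])
    finally show ?thesis .
  qed
  have H: "1/2 - a > 0" using a by simp
  have P2: "(\<Sum>x\<in>X. c x * pow_fn a x s)\<^sup>2 = (\<Sum>x\<in>X. \<Sum>y\<in>X. c x * c y * (pow_fn a x s * pow_fn a y s))" for s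
    by (simp add: power2_eq_square sum_product mult_ac)
  have Pi: "integrable lborel (\<lambda>s. c x * c y * (pow_fn a x s * pow_fn a y s))"
    "(LINT s|lborel. c x * c y * (pow_fn a x s * pow_fn a y s)) = c x * c y * (min x y powr (2 * a + 1) / (2 * a + 1))" if "x \<in> X" "y \<in> X" for x y
    using integral_pow_fn[OF a(1) x(1)[OF that(1)] x(1)[OF that(2)]] by (auto simp: has_bochner_integral_iff)
  show "integrable lborel (\<lambda>s. (\<Sum>x\<in>X. c x * pow_fn a x s)\<^sup>2)"
    unfolding P2 by (intro Bochner_Integration.integrable_sum Pi(1))
  have PP: "(LINT s|lborel. (\<Sum>x\<in>X. c x * pow_fn a x s)\<^sup>2) = (\<Sum>x\<in>X. \<Sum>y\<in>X. c x * c y * (min x y powr (2 * a + 1) / (2 * a + 1)))"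
  proof -
    have "(LINT s|lborel. (\<Sum>x\<in>X. c x * pow_fn a x s)\<^sup>2) = (\<Sum>x\<in>X. (LINT s|lborel. (\<Sum>y\<in>X. c x * c y * (pow_fn a x s * pow_fn a y s))))"
      unfolding P2 by (intro Bochner_Integration.integral_sum Bochner_Integration.integrable_sum Pi(1))
    also have "\<dots> = (\<Sum>x\<in>X. \<Sum>y\<in>X. (LINT s|lborel. c x * c y * (pow_fn a x s * pow_fn a y s)))"
      by (intro sum.cong refl Bochner_Integration.integral_sum Pi(1))
    also have "\<dots> = (\<Sum>x\<in>X. \<Sum>y\<in>X. c x * c y * (min x y powr (2 * a + 1) / (2 * a + 1)))"
      by (intro sum.cong refl Pi(2))
    finally show ?thesis .
  qed
  define K where "K = (1 - 2 * a) * a * Beta a (1 - a) * Beta (a + 1) (a + 1)"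
  have "fbm_form (1/2 - a) \<psi> \<psi> = (\<Sum>x\<in>X. \<Sum>y\<in>X. c x * c y * fbm_form (1/2 - a) (mart_fn_deriv a x) (mart_fn_deriv a y))"
    unfolding \<psi>_def by (rule fbm_form_sum[OF H X(1) i s])
  also have "\<dots> = (\<Sum>x\<in>X. \<Sum>y\<in>X. c x * c y * (K * min x y powr (2 * a + 1)))"
    using x by (intro sum.cong refl) (simp add: fbm_form_mart_fn_deriv[OF a] K_def)
  also have "\<dots> = K * (2 * a + 1) * (LINT s|lborel. (\<Sum>x\<in>X. c x * pow_fn a x s)\<^sup>2)"
    unfolding PP sum_distrib_left using a by (intro sum.cong refl) (simp add: field_simps)
  also have "K * (2 * a + 1) = (a * C1 (1/2 - a) * Gamma a)\<^sup>2" unfolding K_def by (rule C1_Gamma_square[OF a])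
  finally show "(LINT s|lborel. (LINT t|lborel. mixed_cov (1/2 - a) s t * \<psi> t) * \<psi> s) =
      (LINT s|lborel. (?\<phi> s)\<^sup>2) + (a * C1 (1/2 - a) * Gamma a)\<^sup>2 * (LINT s|lborel. (\<Sum>x\<in>X. c x * pow_fn a x s)\<^sup>2)"
    using mixed_cov_form[where T=T, OF H _ \<psi>i \<psi>s \<phi>i \<phi>0 \<phi>\<psi>] T by simp
  show "(LINT t|lborel. g t * \<psi> t) = (LINT s|lborel. G s * ?\<phi> s)"
    if "integrable lborel G" "\<And>t. t \<in> {0..T} \<Longrightarrow> g t = (LINT s|lborel. indicator {s. 0 < s \<and> s \<le> t} s * G s)" for g G
  proof -
    have "indicator {0<..} s * (LINT t|lborel. indicator {s..} t * \<psi> t) = ?\<phi> s" for s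
      using \<phi>0[of s] \<phi>\<psi>[of s] by (auto simp: indicator_def)
    then show ?thesis using integral_by_parts_Fubini[OF that(1) \<psi>i \<psi>s that(2)] by simp
  qed
qed

section \<open>Integral operators and density of step functions\<close>

text \<open>Schur's test: a common bound \<open>C\<close> for the row and column integrals of a
  nonnegative kernel bounds the operator norm on L2 by \<open>C\<close>. The condition is symmetric
  in the arguments, so it covers the adjoint as well.\<close>

locale schur_kernel =
  fixes k :: "real \<Rightarrow> real \<Rightarrow> real" and C :: real
  assumes k_measurable [measurable]: "(\<lambda>(t, u). k t u) \<in> borel_measurable (borel \<Otimes>\<^sub>M borel)"
    and k_nonneg: "0 \<le> k t u" and C_pos: "C > 0"
    and k_row: "(\<integral>\<^sup>+u. ennreal (k t u) \<partial>lborel) \<le> ennreal C"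
    and k_col: "(\<integral>\<^sup>+t. ennreal (k t u) \<partial>lborel) \<le> ennreal C"
begin

lemma k_section [measurable]: "(\<lambda>u. k t u) \<in> borel_measurable borel" "(\<lambda>t. k t u) \<in> borel_measurable borel"
  by measurable

lemma k_pair [measurable]: "(\<lambda>(t, u). k t u) \<in> borel_measurable (lborel \<Otimes>\<^sub>M lborel)"
  using k_measurable by (simp cong: measurable_cong_sets)

lemma k_row_integral: "integrable lborel (\<lambda>u. k t u)" "(LINT u|lborel. k t u) \<le> C"
proof -
  show i: "integrable lborel (\<lambda>u. k t u)"
    by (rule integrableI_bounded) (use k_row[of t] k_nonneg in \<open>auto intro: le_less_trans\<close>)
  have "ennreal (LINT u|lborel. k t u) \<le> ennreal C"
    using k_row[of t] by (subst nn_integral_eq_integral[symmetric, OF i]) (auto simp: k_nonneg)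
  then show "(LINT u|lborel. k t u) \<le> C" using C_pos by simp
qed

text \<open>By Tonelli the integral over \<open>t\<close> can be taken first, where the column bound
  applies.\<close>

lemma integrable_right_square:
  assumes f: "f \<in> borel_measurable borel" "integrable lborel (\<lambda>u. (f u)\<^sup>2)"
  shows "integrable (lborel \<Otimes>\<^sub>M lborel) (\<lambda>(t, u). k t u * (f u)\<^sup>2)"
    and "(LINT t|lborel. (LINT u|lborel. k t u * (f u)\<^sup>2)) \<le> C * (LINT u|lborel. (f u)\<^sup>2)"
proof -
  note [measurable] = f(1)
  have m [measurable]: "(\<lambda>(t, u). k t u * (f u)\<^sup>2) \<in> borel_measurable (lborel \<Otimes>\<^sub>M lborel)" by measurable
  have "(\<integral>\<^sup>+p. ennreal (case p of (t, u) \<Rightarrow> k t u * (f u)\<^sup>2) \<partial>(lborel \<Otimes>\<^sub>M lborel)) = (\<integral>\<^sup>+u. (\<integral>\<^sup>+t. ennreal (k t u * (f u)\<^sup>2) \<partial>lborel) \<partial>lborel)"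
    by (subst lborel_pair.nn_integral_snd[symmetric]) (auto simp: split_beta')
  also have "\<dots> = (\<integral>\<^sup>+u. (\<integral>\<^sup>+t. ennreal (k t u) \<partial>lborel) * ennreal ((f u)\<^sup>2) \<partial>lborel)"
    by (intro nn_integral_cong) (simp add: ennreal_mult k_nonneg nn_integral_multc)
  also have "\<dots> \<le> (\<integral>\<^sup>+u. ennreal C * ennreal ((f u)\<^sup>2) \<partial>lborel)"
    by (intro nn_integral_mono mult_right_mono k_col) simp
  also have "\<dots> = ennreal C * (\<integral>\<^sup>+u. ennreal ((f u)\<^sup>2) \<partial>lborel)" by (rule nn_integral_cmult) measurable
  also have "\<dots> = ennreal (C * (LINT u|lborel. (f u)\<^sup>2))"
    using f(2) C_pos by (subst nn_integral_eq_integral) (auto simp: ennreal_mult)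
  finally have le: "(\<integral>\<^sup>+p. ennreal (case p of (t, u) \<Rightarrow> k t u * (f u)\<^sup>2) \<partial>(lborel \<Otimes>\<^sub>M lborel)) \<le> ennreal (C * (LINT u|lborel. (f u)\<^sup>2))" .
  have nn: "0 \<le> (case p of (t, u) \<Rightarrow> k t u * (f u)\<^sup>2)" for p by (cases p) (simp add: k_nonneg)
  show i: "integrable (lborel \<Otimes>\<^sub>M lborel) (\<lambda>(t, u). k t u * (f u)\<^sup>2)"
  proof (rule integrableI_bounded[OF m])
    have "(\<integral>\<^sup>+p. ennreal (norm (case p of (t, u) \<Rightarrow> k t u * (f u)\<^sup>2)) \<partial>(lborel \<Otimes>\<^sub>M lborel)) \<le> ennreal (C * (LINT u|lborel. (f u)\<^sup>2))"
      using le by (simp only: real_norm_def abs_of_nonneg[OF nn])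
    then show "(\<integral>\<^sup>+p. ennreal (norm (case p of (t, u) \<Rightarrow> k t u * (f u)\<^sup>2)) \<partial>(lborel \<Otimes>\<^sub>M lborel)) < \<infinity>"
      by (rule le_less_trans) simp
  qed
  have "ennreal (integral\<^sup>L (lborel \<Otimes>\<^sub>M lborel) (\<lambda>(t, u). k t u * (f u)\<^sup>2)) \<le> ennreal (C * (LINT u|lborel. (f u)\<^sup>2))"
    using le by (subst nn_integral_eq_integral[symmetric, OF i]) (use nn in auto)
  then have "integral\<^sup>L (lborel \<Otimes>\<^sub>M lborel) (\<lambda>(t, u). k t u * (f u)\<^sup>2) \<le> C * (LINT u|lborel. (f u)\<^sup>2)"
    using C_pos by (subst (asm) ennreal_le_iff) (auto intro!: mult_nonneg_nonneg integral_nonneg_AE)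
  then show "(LINT t|lborel. (LINT u|lborel. k t u * (f u)\<^sup>2)) \<le> C * (LINT u|lborel. (f u)\<^sup>2)"
    using lborel_pair.integral_fst'[OF i] by simp
qed

lemma transpose: "schur_kernel (\<lambda>t u. k u t) C"
proof
  have "(\<lambda>p. (\<lambda>(t, u). k t u) (snd p, fst p)) \<in> borel_measurable (borel \<Otimes>\<^sub>M borel)" by measurable
  then show "(\<lambda>(t, u). k u t) \<in> borel_measurable (borel \<Otimes>\<^sub>M borel)" by (simp add: split_beta')
qed (auto simp: k_nonneg C_pos k_row k_col)

definition op :: "(real \<Rightarrow> real) \<Rightarrow> real \<Rightarrow> real" where
  "op f t = (LINT u|lborel. k t u * f u)"

lemma op_measurable [measurable (raw)]:
  assumes [measurable]: "f \<in> borel_measurable borel"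
  shows "op f \<in> borel_measurable borel"
  unfolding op_def[abs_def] by (rule lborel.borel_measurable_lebesgue_integral) measurable

lemma integrable_k_mult:
  assumes [measurable]: "f \<in> borel_measurable borel" and i: "integrable lborel (\<lambda>u. k t u * (f u)\<^sup>2)"
  shows "integrable lborel (\<lambda>u. k t u * f u)"
proof (rule Bochner_Integration.integrable_bound)
  show "integrable lborel (\<lambda>u. k t u + k t u * (f u)\<^sup>2)" using k_row_integral(1) i by simp
  have *: "\<bar>x\<bar> \<le> 1 + x\<^sup>2" for x :: real
    using sum_squares_bound[of 1 "\<bar>x\<bar>"] by simp
  have "k t u * \<bar>f u\<bar> \<le> k t u * (1 + (f u)\<^sup>2)" for u by (intro mult_left_mono * k_nonneg)
  then show "AE u in lborel. norm (k t u * f u) \<le> norm (k t u + k t u * (f u)\<^sup>2)"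
    using k_nonneg[of t] by (simp add: abs_mult distrib_left)
qed measurable

lemma op_square:
  assumes f: "f \<in> borel_measurable borel" "integrable lborel (\<lambda>u. (f u)\<^sup>2)"
  shows "integrable lborel (\<lambda>t. (op f t)\<^sup>2)" "(LINT t|lborel. (op f t)\<^sup>2) \<le> C\<^sup>2 * (LINT u|lborel. (f u)\<^sup>2)"
    and "AE t in lborel. integrable lborel (\<lambda>u. k t u * f u)"
proof -
  note [measurable] = f(1)
  note i = integrable_right_square[OF f]
  have Ki: "integrable lborel (\<lambda>t. LINT u|lborel. k t u * (f u)\<^sup>2)"
    using lborel_pair.integrable_fst'[OF i(1)] by simp
  have ae: "AE t in lborel. integrable lborel (\<lambda>u. k t u * (f u)\<^sup>2)"
    using lborel_pair.AE_integrable_fst'[OF i(1)] by simp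
  show "AE t in lborel. integrable lborel (\<lambda>u. k t u * f u)"
    using ae by eventually_elim (rule integrable_k_mult[OF f(1)])
  have le: "AE t in lborel. (op f t)\<^sup>2 \<le> C * (LINT u|lborel. k t u * (f u)\<^sup>2)"
    using ae
  proof eventually_elim
    case (elim t)
    \<comment> \<open>Cauchy-Schwarz for the row measure, by expanding the square around
      \<open>m\<close>. Dividing by the bound \<open>C\<close> instead of the exact row mass avoids
      a separate case of mass zero.\<close>
    define m where "m = op f t / C"
    note i1 = integrable_k_mult[OF f(1) elim]
    have "0 \<le> (LINT u|lborel. k t u * (f u - m)\<^sup>2)" by (intro integral_nonneg_AE) (simp add: k_nonneg)
    also have "\<dots> = (LINT u|lborel. k t u * (f u)\<^sup>2 - 2 * m * (k t u * f u) + m\<^sup>2 * k t u)"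
      by (intro Bochner_Integration.integral_cong) (auto simp: power2_eq_square algebra_simps)
    also have "\<dots> = (LINT u|lborel. k t u * (f u)\<^sup>2) - 2 * m * op f t + m\<^sup>2 * (LINT u|lborel. k t u)"
      using elim i1 k_row_integral(1)[of t] by (simp add: op_def)
    also have "\<dots> \<le> (LINT u|lborel. k t u * (f u)\<^sup>2) - 2 * m * op f t + m\<^sup>2 * C"
      using k_row_integral(2)[of t] by (simp add: mult_left_mono)
    also have "2 * m * op f t = 2 * ((op f t)\<^sup>2 / C)" by (simp add: m_def power2_eq_square)
    also have "m\<^sup>2 * C = (op f t)\<^sup>2 / C" using C_pos by (simp add: m_def power2_eq_square)
    finally have "(op f t)\<^sup>2 / C \<le> (LINT u|lborel. k t u * (f u)\<^sup>2)" by simp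
    then show ?case using C_pos by (simp add: field_simps)
  qed
  show oi: "integrable lborel (\<lambda>t. (op f t)\<^sup>2)"
  proof (rule Bochner_Integration.integrable_bound)
    show "integrable lborel (\<lambda>t. C * (LINT u|lborel. k t u * (f u)\<^sup>2))" using Ki by simp
    show "AE t in lborel. norm ((op f t)\<^sup>2) \<le> norm (C * (LINT u|lborel. k t u * (f u)\<^sup>2))"
      using le by eventually_elim simp
  qed measurable
  have "(LINT t|lborel. (op f t)\<^sup>2) \<le> (LINT t|lborel. C * (LINT u|lborel. k t u * (f u)\<^sup>2))"
    by (rule integral_mono_AE[OF oi _ le]) (use Ki in simp)
  also have "\<dots> \<le> C * (C * (LINT u|lborel. (f u)\<^sup>2))" using i(2) C_pos by simp
  finally show "(LINT t|lborel. (op f t)\<^sup>2) \<le> C\<^sup>2 * (LINT u|lborel. (f u)\<^sup>2)" by (simp add: power2_eq_square mult.assoc)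
qed

text \<open>Fubini is justified by k |g f| <= k f^2 + k g^2; the columns control the first summand
  and the rows the second.\<close>

lemma op_adjoint:
  assumes f: "f \<in> borel_measurable borel" "integrable lborel (\<lambda>u. (f u)\<^sup>2)"
    and g: "g \<in> borel_measurable borel" "integrable lborel (\<lambda>u. (g u)\<^sup>2)"
  shows "(LINT t|lborel. g t * op f t) = (LINT u|lborel. schur_kernel.op (\<lambda>t u. k u t) g u * f u)"
proof -
  interpret T: schur_kernel "\<lambda>t u. k u t" C by (rule transpose)
  note [measurable] = f(1) g(1)
  have i1: "integrable (lborel \<Otimes>\<^sub>M lborel) (\<lambda>(t, u). k t u * (f u)\<^sup>2)" by (rule integrable_right_square[OF f])
  have i2: "integrable (lborel \<Otimes>\<^sub>M lborel) (\<lambda>(t, u). k t u * (g t)\<^sup>2)"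
    using lborel_pair.integrable_product_swap[OF T.integrable_right_square(1)[OF g]] by (simp add: split_beta')
  have i: "integrable (lborel \<Otimes>\<^sub>M lborel) (\<lambda>(t, u). g t * (k t u * f u))"
  proof (rule Bochner_Integration.integrable_bound)
    show "integrable (lborel \<Otimes>\<^sub>M lborel) (\<lambda>p. (case p of (t, u) \<Rightarrow> k t u * (f u)\<^sup>2) + (case p of (t, u) \<Rightarrow> k t u * (g t)\<^sup>2))"
      using i1 i2 by simp
    have *: "\<bar>x\<bar> * \<bar>y\<bar> \<le> y\<^sup>2 + x\<^sup>2" for x y :: real
    proof -
      have "2 * (\<bar>x\<bar> * \<bar>y\<bar>) \<le> x\<^sup>2 + y\<^sup>2" "0 \<le> \<bar>x\<bar> * \<bar>y\<bar>" using sum_squares_bound[of "\<bar>x\<bar>" "\<bar>y\<bar>"] by simp_all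
      moreover have "z \<le> B + A" if "2 * z \<le> A + B" "0 \<le> z" for z A B :: real using that by linarith
      ultimately show ?thesis by blast
    qed
    have "k t u * (\<bar>g t\<bar> * \<bar>f u\<bar>) \<le> k t u * ((f u)\<^sup>2 + (g t)\<^sup>2)" for t u by (intro mult_left_mono * k_nonneg)
    then show "AE p in lborel \<Otimes>\<^sub>M lborel. norm (case p of (t, u) \<Rightarrow> g t * (k t u * f u)) \<le> norm ((case p of (t, u) \<Rightarrow> k t u * (f u)\<^sup>2) + (case p of (t, u) \<Rightarrow> k t u * (g t)\<^sup>2))"
      by (intro AE_I2) (auto simp: abs_mult k_nonneg distrib_left mult_ac split: prod.split)
  qed measurable
  have "(LINT t|lborel. g t * op f t) = (LINT t|lborel. (LINT u|lborel. g t * (k t u * f u)))"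
    by (simp add: op_def)
  also have "\<dots> = (LINT u|lborel. (LINT t|lborel. g t * (k t u * f u)))"
    using lborel_pair.Fubini_integral[OF i] by simp
  also have "\<dots> = (LINT u|lborel. (LINT t|lborel. k t u * g t * f u))"
    by (simp add: mult_ac)
  also have "\<dots> = (LINT u|lborel. T.op g u * f u)"
    by (simp add: T.op_def)
  finally show ?thesis .
qed

end

text \<open>In \<open>L\<^sub>2\<close> of a finite measure, the functions that can be approximated by linear combinations of the
  indicators of \<open>{..x}\<close> form a closed subspace; a Dynkin argument shows that it contains all indicators.\<close>

definition step_approx :: "real measure \<Rightarrow> real set \<Rightarrow> (real \<Rightarrow> real) \<Rightarrow> bool" where
  "step_approx \<mu> D p \<longleftrightarrow> (\<forall>\<delta>>0. \<exists>X c. finite X \<and> X \<subseteq> D \<and> (LINT u|\<mu>. (p u - (\<Sum>x\<in>X. c x * indicator {..x} u))\<^sup>2) < \<delta>)"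

lemma square_add_le: "((a :: real) + b)\<^sup>2 \<le> 2 * a\<^sup>2 + 2 * b\<^sup>2"
  using sum_squares_bound[of a b] by (simp add: power2_sum)

lemma (in finite_measure) integrable_square_diff:
  fixes p q :: "'a \<Rightarrow> real"
  assumes [measurable]: "p \<in> borel_measurable M" "q \<in> borel_measurable M"
    and "integrable M (\<lambda>u. (p u)\<^sup>2)" "integrable M (\<lambda>u. (q u)\<^sup>2)"
  shows "integrable M (\<lambda>u. (p u - q u)\<^sup>2)"
proof (rule Bochner_Integration.integrable_bound)
  show "integrable M (\<lambda>u. 2 * (p u)\<^sup>2 + 2 * (- q u)\<^sup>2)" using assms by simp
  show "AE u in M. norm ((p u - q u)\<^sup>2) \<le> norm (2 * (p u)\<^sup>2 + 2 * (- q u)\<^sup>2)"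
    using square_add_le[of "p _" "- q _"] by (intro AE_I2) simp
qed measurable

lemma integrable_step_square:
  fixes \<mu> :: "real measure"
  assumes \<mu>: "finite_measure \<mu>" "sets \<mu> = sets borel" and X: "finite X"
  shows "integrable \<mu> (\<lambda>u. (\<Sum>x\<in>X. c x * indicator {..x} u :: real)\<^sup>2)"
proof -
  interpret finite_measure \<mu> by fact
  note [measurable_cong] = \<mu>(2)
  have "\<bar>\<Sum>x\<in>X. c x * indicator {..x} u\<bar> \<le> (\<Sum>x\<in>X. \<bar>c x\<bar>)" for u :: real
    by (rule order_trans[OF sum_abs]) (auto intro!: sum_mono simp: indicator_def)
  from power_mono[OF this, where n=2] have "(\<Sum>x\<in>X. c x * indicator {..x} u)\<^sup>2 \<le> (\<Sum>x\<in>X. \<bar>c x\<bar>)\<^sup>2" for u :: real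
    by simp
  then have "AE u in \<mu>. norm ((\<Sum>x\<in>X. c x * indicator {..x} u :: real)\<^sup>2) \<le> (\<Sum>x\<in>X. \<bar>c x\<bar>)\<^sup>2"
    by (intro AE_I2) simp
  then show ?thesis by (rule integrable_const_bound) measurable
qed

lemma step_approx_closed:
  assumes \<mu>: "finite_measure \<mu>" "sets \<mu> = sets borel"
    and p: "p \<in> borel_measurable \<mu>" "integrable \<mu> (\<lambda>u. (p u)\<^sup>2)"
    and ap: "\<And>\<delta>. \<delta> > 0 \<Longrightarrow> \<exists>q. q \<in> borel_measurable \<mu> \<and> integrable \<mu> (\<lambda>u. (q u)\<^sup>2) \<and> step_approx \<mu> D q \<and> (LINT u|\<mu>. (p u - q u)\<^sup>2) < \<delta>"
  shows "step_approx \<mu> D p"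
  unfolding step_approx_def
proof (intro allI impI)
  interpret finite_measure \<mu> by fact
  note [measurable_cong] = \<mu>(2)
  fix \<delta> :: real assume \<delta>: "\<delta> > 0"
  obtain q where q: "q \<in> borel_measurable \<mu>" "integrable \<mu> (\<lambda>u. (q u)\<^sup>2)" "step_approx \<mu> D q" "(LINT u|\<mu>. (p u - q u)\<^sup>2) < \<delta> / 4"
    using ap[of "\<delta> / 4"] \<delta> by auto
  obtain X c where X: "finite X" "X \<subseteq> D" "(LINT u|\<mu>. (q u - (\<Sum>x\<in>X. c x * indicator {..x} u))\<^sup>2) < \<delta> / 4"
    using q(3)[unfolded step_approx_def, rule_format, of "\<delta> / 4"] \<delta> by auto
  let ?s = "\<lambda>u. \<Sum>x\<in>X. c x * indicator {..x} u"
  note si = integrable_step_square[OF \<mu> X(1), of c]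
  have sm: "?s \<in> borel_measurable \<mu>" by measurable
  have "(LINT u|\<mu>. (p u - ?s u)\<^sup>2) \<le> (LINT u|\<mu>. 2 * (p u - q u)\<^sup>2 + 2 * (q u - ?s u)\<^sup>2)"
  proof (rule integral_mono)
    show "(p u - ?s u)\<^sup>2 \<le> 2 * (p u - q u)\<^sup>2 + 2 * (q u - ?s u)\<^sup>2" for u
      using square_add_le[of "p u - q u" "q u - ?s u"] by simp
  qed (intro Bochner_Integration.integrable_add integrable_mult_right integrable_square_diff p q si sm)+
  also have "\<dots> = 2 * (LINT u|\<mu>. (p u - q u)\<^sup>2) + 2 * (LINT u|\<mu>. (q u - ?s u)\<^sup>2)"
    by (subst Bochner_Integration.integral_add)
      (simp_all add: integrable_square_diff[OF p(1) q(1) p(2) q(2)] integrable_square_diff[OF q(1) sm q(2) si])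
  also have "\<dots> < \<delta>" using q(4) X(3) by linarith
  finally show "\<exists>X c. finite X \<and> X \<subseteq> D \<and> (LINT u|\<mu>. (p u - (\<Sum>x\<in>X. c x * indicator {..x} u))\<^sup>2) < \<delta>"
    using X by blast
qed

lemma step_approx_lincomb:
  assumes \<mu>: "finite_measure \<mu>" "sets \<mu> = sets borel"
    and p: "p \<in> borel_measurable \<mu>" "integrable \<mu> (\<lambda>u. (p u)\<^sup>2)" "step_approx \<mu> D p"
    and q: "q \<in> borel_measurable \<mu>" "integrable \<mu> (\<lambda>u. (q u)\<^sup>2)" "step_approx \<mu> D q"
  shows "step_approx \<mu> D (\<lambda>u. a * p u + b * q u)"
  unfolding step_approx_def
proof (intro allI impI)
  interpret finite_measure \<mu> by fact
  note [measurable_cong] = \<mu>(2)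
  fix \<delta> :: real assume \<delta>: "\<delta> > 0"
  define m where "m = \<delta> / (4 * (a\<^sup>2 + b\<^sup>2 + 1))"
  have ab: "a\<^sup>2 + b\<^sup>2 + 1 > 0" by (simp add: add_nonneg_pos)
  then have m: "m > 0" using \<delta> by (simp add: m_def)
  obtain X c where X: "finite X" "X \<subseteq> D" "(LINT u|\<mu>. (p u - (\<Sum>x\<in>X. c x * indicator {..x} u))\<^sup>2) < m"
    using p(3)[unfolded step_approx_def, rule_format, OF m] by auto
  obtain Y d where Y: "finite Y" "Y \<subseteq> D" "(LINT u|\<mu>. (q u - (\<Sum>x\<in>Y. d x * indicator {..x} u))\<^sup>2) < m"
    using q(3)[unfolded step_approx_def, rule_format, OF m] by auto
  define s where "s u = (\<Sum>x\<in>X. c x * indicator {..x} u)" for u :: real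
  define r where "r u = (\<Sum>x\<in>Y. d x * indicator {..x} u)" for u :: real
  define e where "e x = (if x \<in> X then a * c x else 0) + (if x \<in> Y then b * d x else 0)" for x
  have e: "(\<Sum>x\<in>X \<union> Y. e x * indicator {..x} u) = a * s u + b * r u" for u
  proof -
    have "(\<Sum>x\<in>X \<union> Y. e x * indicator {..x} u) = (\<Sum>x\<in>X \<union> Y. (if x \<in> X then a * c x * indicator {..x} u else 0)) + (\<Sum>x\<in>X \<union> Y. (if x \<in> Y then b * d x * indicator {..x} u else 0))"
      unfolding sum.distrib[symmetric] by (intro sum.cong refl) (simp add: e_def distrib_right)
    also have "(\<Sum>x\<in>X \<union> Y. (if x \<in> X then a * c x * indicator {..x} u else 0)) = (\<Sum>x\<in>X. a * c x * indicator {..x} u)"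
      using X(1) Y(1) by (intro sum.mono_neutral_cong_right) auto
    also have "(\<Sum>x\<in>X \<union> Y. (if x \<in> Y then b * d x * indicator {..x} u else 0)) = (\<Sum>x\<in>Y. b * d x * indicator {..x} u)"
      using X(1) Y(1) by (intro sum.mono_neutral_cong_right) auto
    finally show ?thesis by (simp add: s_def r_def sum_distrib_left mult.assoc)
  qed
  have si: "integrable \<mu> (\<lambda>u. (s u)\<^sup>2)" "integrable \<mu> (\<lambda>u. (r u)\<^sup>2)"
    unfolding s_def r_def by (intro integrable_step_square[OF \<mu>] X Y)+
  have sm: "s \<in> borel_measurable \<mu>" "r \<in> borel_measurable \<mu>"
    unfolding s_def[abs_def] r_def[abs_def] by measurable
  note i1 = integrable_square_diff[OF p(1) sm(1) p(2) si(1)] and i2 = integrable_square_diff[OF q(1) sm(2) q(2) si(2)]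
  have "(LINT u|\<mu>. (a * p u + b * q u - (\<Sum>x\<in>X \<union> Y. e x * indicator {..x} u))\<^sup>2)
    \<le> (LINT u|\<mu>. 2 * a\<^sup>2 * (p u - s u)\<^sup>2 + 2 * b\<^sup>2 * (q u - r u)\<^sup>2)"
  proof (rule integral_mono_AE')
    show "integrable \<mu> (\<lambda>u. 2 * a\<^sup>2 * (p u - s u)\<^sup>2 + 2 * b\<^sup>2 * (q u - r u)\<^sup>2)" using i1 i2 by simp
    show "AE u in \<mu>. (a * p u + b * q u - (\<Sum>x\<in>X \<union> Y. e x * indicator {..x} u))\<^sup>2 \<le> 2 * a\<^sup>2 * (p u - s u)\<^sup>2 + 2 * b\<^sup>2 * (q u - r u)\<^sup>2"
    proof (rule AE_I2)
      fix u
      have "a * p u + b * q u - (a * s u + b * r u) = a * (p u - s u) + b * (q u - r u)" by (simp add: algebra_simps)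
      then show "(a * p u + b * q u - (\<Sum>x\<in>X \<union> Y. e x * indicator {..x} u))\<^sup>2 \<le> 2 * a\<^sup>2 * (p u - s u)\<^sup>2 + 2 * b\<^sup>2 * (q u - r u)\<^sup>2"
        unfolding e using square_add_le[of "a * (p u - s u)" "b * (q u - r u)"] by (simp add: power_mult_distrib)
    qed
  qed simp
  also have "\<dots> = 2 * a\<^sup>2 * (LINT u|\<mu>. (p u - s u)\<^sup>2) + 2 * b\<^sup>2 * (LINT u|\<mu>. (q u - r u)\<^sup>2)"
    using i1 i2 by simp
  also have "\<dots> \<le> 2 * a\<^sup>2 * m + 2 * b\<^sup>2 * m"
    using X(3) Y(3) unfolding s_def r_def by (intro add_mono mult_left_mono) auto
  also have "\<dots> < 4 * (a\<^sup>2 + b\<^sup>2 + 1) * m"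
  proof -
    have "4 * (a\<^sup>2 + b\<^sup>2 + 1) * m - (2 * a\<^sup>2 * m + 2 * b\<^sup>2 * m) = (2 * a\<^sup>2 + 2 * b\<^sup>2 + 4) * m"
      by (simp add: algebra_simps)
    moreover have "(2 * a\<^sup>2 + 2 * b\<^sup>2 + 4) * m > 0" using m by (intro mult_pos_pos add_nonneg_pos) auto
    ultimately show ?thesis by linarith
  qed
  also have "\<dots> = \<delta>" using ab by (simp add: m_def)
  finally show "\<exists>X c. finite X \<and> X \<subseteq> D \<and> (LINT u|\<mu>. (a * p u + b * q u - (\<Sum>x\<in>X. c x * indicator {..x} u))\<^sup>2) < \<delta>"
    using X Y by (intro exI[of _ "X \<union> Y"] exI[of _ e]) auto
qed

lemma step_approx_AE_cong:
  assumes \<mu>: "sets \<mu> = sets borel" and p: "p \<in> borel_measurable \<mu>" "q \<in> borel_measurable \<mu>"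
    and ae: "AE u in \<mu>. p u = q u" and q: "step_approx \<mu> D q"
  shows "step_approx \<mu> D p"
proof -
  note [measurable_cong] = \<mu>
  note [measurable] = p
  have "(LINT u|\<mu>. (p u - (\<Sum>x\<in>X. c x * indicator {..x} u))\<^sup>2) = (LINT u|\<mu>. (q u - (\<Sum>x\<in>X. c x * indicator {..x} u))\<^sup>2)" for X c
    by (rule integral_cong_AE) (measurable, use ae in \<open>auto elim: eventually_mono\<close>)
  then show ?thesis using q unfolding step_approx_def by simp
qed

lemma step_approx_indicator_atMost: "x \<in> D \<Longrightarrow> step_approx \<mu> D (indicator {..x})"
  unfolding step_approx_def by (intro allI impI exI[of _ "{x}"] exI[of _ "\<lambda>_. 1"]) simp

lemma step_approx_zero: "step_approx \<mu> D (\<lambda>_. 0)"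
  unfolding step_approx_def by (intro allI impI exI[of _ "{}"]) simp

lemma step_approx_indicator:
  assumes \<mu>: "finite_measure \<mu>" "sets \<mu> = sets borel" and ae: "AE u in \<mu>. 0 < u \<and> u \<le> T" and T: "T > 0"
    and A: "A \<in> sets borel"
  shows "step_approx \<mu> {0<..T} (indicator A)"
proof -
  interpret finite_measure \<mu> by fact
  note [measurable_cong] = \<mu>(2)
  have sp: "space \<mu> = UNIV" using sets_eq_imp_space_eq[OF \<mu>(2)] by simp
  have ind: "indicator A \<in> borel_measurable \<mu>" "integrable \<mu> (\<lambda>u. (indicator A u :: real)\<^sup>2)" if "A \<in> sets borel" for A :: "real set"
  proof -
    show m: "indicator A \<in> borel_measurable \<mu>" using that by measurable
    show "integrable \<mu> (\<lambda>u. (indicator A u :: real)\<^sup>2)"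
      by (rule integrable_const_bound[where B=1, OF _ borel_measurable_power[OF m]]) (simp add: indicator_def)
  qed
  \<comment> \<open>The measure lives on (0, T], where the constant 1 agrees with the indicator of
    \<open>{..T}\<close>; this keeps all nodes inside the interval.\<close>
  have one: "step_approx \<mu> {0<..T} (\<lambda>_. 1)"
    by (rule step_approx_AE_cong[OF \<mu>(2) _ _ _ step_approx_indicator_atMost[of T]]) (use ae T in \<open>auto elim: eventually_mono\<close>)
  have A': "A \<in> sigma_sets UNIV (range (\<lambda>a::real. {..a}))"
    using A by (simp add: borel_eq_atMost)
  have st: "Int_stable (range (\<lambda>a::real. {..a}))" "range (\<lambda>a::real. {..a}) \<subseteq> Pow UNIV" by (auto simp: Int_stable_def)
  from st A' show ?thesis
  proof (induction rule: sigma_sets_induct_disjoint)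
    case (basic B)
    then obtain x where B: "B = {..x}" by auto
    consider "x \<le> 0" | "0 < x" "x \<le> T" | "T < x" by linarith
    then show ?case
    proof cases
      case 1
      show ?thesis
        by (rule step_approx_AE_cong[OF \<mu>(2) _ _ _ step_approx_zero]) (use ae 1 in \<open>auto simp: B indicator_def elim: eventually_mono\<close>)
    next
      case 2
      then show ?thesis unfolding B by (intro step_approx_indicator_atMost) auto
    next
      case 3
      show ?thesis
        by (rule step_approx_AE_cong[OF \<mu>(2) _ _ _ one]) (use ae 3 in \<open>auto simp: B indicator_def elim: eventually_mono\<close>)
    qed
  next
    case empty
    then show ?case using step_approx_zero by (simp add: indicator_def)
  next
    case (compl B)
    then have B: "B \<in> sets borel" by (simp add: borel_eq_atMost)
    have "step_approx \<mu> {0<..T} (\<lambda>u. 1 * 1 + (-1) * indicator B u)"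
      by (rule step_approx_lincomb[OF \<mu> _ _ one ind[OF B] compl(2)]) auto
    moreover have "(\<lambda>u. 1 * 1 + (-1) * indicator B u) = (indicator (UNIV - B) :: real \<Rightarrow> real)" by (auto simp: indicator_def)
    ultimately show ?case by simp
  next
    case (union B)
    then have B: "B i \<in> sets borel" for i by (auto simp: borel_eq_atMost)
    have UB: "(\<Union>i. B i) \<in> sets borel" using B by auto
    define U where "U n = (\<Union>i<n. B i)" for n
    have Um: "U n \<in> sets borel" for n using B by (auto simp: U_def)
    have Uap: "step_approx \<mu> {0<..T} (indicator (U n))" for n
    proof (induction n)
      case 0 then show ?case using step_approx_zero by (simp add: U_def indicator_def)
    next
      case (Suc n)
      have "step_approx \<mu> {0<..T} (\<lambda>u. 1 * indicator (U n) u + 1 * indicator (B n) u)"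
        by (rule step_approx_lincomb[OF \<mu> ind[OF Um] Suc ind[OF B] union(3)])
      moreover have "1 * indicator (U n) u + 1 * indicator (B n) u = (indicator (U (Suc n)) u :: real)" for u
      proof -
        have "B i \<inter> B n = {}" if "i < n" for i using union(1) that unfolding disjoint_family_on_def by auto
        then have "U n \<inter> B n = {}" unfolding U_def by blast
        then show ?thesis by (auto simp: U_def lessThan_Suc indicator_def)
      qed
      ultimately show ?case by simp
    qed
    show ?case
    proof (rule step_approx_closed[OF \<mu> ind[OF UB]])
      fix \<delta> :: real assume \<delta>: "\<delta> > 0"
      \<comment> \<open>The squared distance from the union to a partial union is the measure of the
        remaining part, which tends to 0 by continuity from below.\<close>
      have "(\<lambda>n. measure \<mu> (U n)) \<longlonglongrightarrow> measure \<mu> (\<Union>n. U n)"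
      proof (rule finite_Lim_measure_incseq)
        show "range U \<subseteq> sets \<mu>" using Um \<mu>(2) by auto
        show "incseq U" unfolding incseq_def U_def by (intro allI impI UN_mono) auto
      qed
      moreover have "(\<Union>n. U n) = (\<Union>i. B i)" by (auto simp: U_def)
      ultimately have "(\<lambda>n. measure \<mu> (\<Union>i. B i) - measure \<mu> (U n)) \<longlonglongrightarrow> measure \<mu> (\<Union>i. B i) - measure \<mu> (\<Union>i. B i)"
        by (intro tendsto_diff tendsto_const) simp
      then have "(\<lambda>n. measure \<mu> (\<Union>i. B i) - measure \<mu> (U n)) \<longlonglongrightarrow> 0" by simp
      from order_tendstoD(2)[OF this \<delta>] obtain n where n: "measure \<mu> (\<Union>i. B i) - measure \<mu> (U n) < \<delta>"
        using eventually_happens'[OF sequentially_bot] by blast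
      have "(indicator (\<Union>i. B i) u - indicator (U n) u)\<^sup>2 = (indicator ((\<Union>i. B i) - U n) u :: real)" for u
        by (auto simp: indicator_def U_def)
      then have "(LINT u|\<mu>. (indicator (\<Union>i. B i) u - indicator (U n) u)\<^sup>2) = measure \<mu> ((\<Union>i. B i) - U n)"
        by (simp add: sp)
      also have "\<dots> = measure \<mu> (\<Union>i. B i) - measure \<mu> (U n)"
        by (rule finite_measure_Diff) (use UB Um \<mu>(2) in \<open>auto simp: U_def\<close>)
      finally show "\<exists>q. q \<in> borel_measurable \<mu> \<and> integrable \<mu> (\<lambda>u. (q u)\<^sup>2) \<and> step_approx \<mu> {0<..T} q \<and> (LINT u|\<mu>. (indicator (\<Union>i. B i) u - q u)\<^sup>2) < \<delta>"
        using n ind[OF Um] Uap by (intro exI[of _ "indicator (U n)"]) auto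
    qed
  qed
qed

text \<open>Simple functions are finite combinations of indicators and approximate \<open>p\<close>
  in L2, so closedness of the approximable functions finishes the argument.\<close>

lemma step_approx_L2:
  assumes \<mu>: "finite_measure \<mu>" "sets \<mu> = sets borel" and ae: "AE u in \<mu>. 0 < u \<and> u \<le> T" and T: "T > 0"
    and p: "p \<in> borel_measurable \<mu>" "integrable \<mu> (\<lambda>u. (p u)\<^sup>2)"
  shows "step_approx \<mu> {0<..T} p"
proof (rule step_approx_closed[OF \<mu> p])
  interpret finite_measure \<mu> by fact
  note [measurable_cong] = \<mu>(2)
  have sp: "space \<mu> = UNIV" using sets_eq_imp_space_eq[OF \<mu>(2)] by simp
  fix \<delta> :: real assume \<delta>: "\<delta> > 0"
  obtain F where F': "\<forall>i. simple_function \<mu> (F i)" "\<forall>x\<in>space \<mu>. (\<lambda>i. F i x) \<longlonglongrightarrow> p x"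
    "\<forall>i. \<forall>x\<in>space \<mu>. dist (F i x) 0 \<le> 2 * dist (p x) 0"
    using borel_measurable_implies_sequence_metric[OF p(1), of 0] by blast
  have F: "\<And>i. simple_function \<mu> (F i)" "\<And>x. x \<in> space \<mu> \<Longrightarrow> (\<lambda>i. F i x) \<longlonglongrightarrow> p x"
    "\<And>i x. x \<in> space \<mu> \<Longrightarrow> norm (F i x) \<le> 2 * norm (p x)"
    using F' by (auto simp: dist_norm)
  have Fm [measurable]: "F i \<in> borel_measurable \<mu>" for i using F(1) by (rule borel_measurable_simple_function)
  have Fi: "integrable \<mu> (\<lambda>u. (F i u)\<^sup>2)" for i
  proof (rule Bochner_Integration.integrable_bound)
    show "integrable \<mu> (\<lambda>u. 4 * (p u)\<^sup>2)" using p(2) by simp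
    have "(F i u)\<^sup>2 \<le> 4 * (p u)\<^sup>2" for u
      using power_mono[OF F(3)[of u i], of 2] sp by (simp add: power_mult_distrib)
    then show "AE u in \<mu>. norm ((F i u)\<^sup>2) \<le> norm (4 * (p u)\<^sup>2)" by simp
  qed measurable
  have "(\<lambda>i. LINT u|\<mu>. (p u - F i u)\<^sup>2) \<longlonglongrightarrow> (LINT u|\<mu>. 0)"
  \<comment> \<open>The constant 10 is 2 + 2 * 4, since the approximants are bounded by twice the
    absolute value of \<open>p\<close>.\<close>
  proof (rule integral_dominated_convergence[where w="\<lambda>u. 10 * (p u)\<^sup>2"])
    show "AE u in \<mu>. (\<lambda>i. (p u - F i u)\<^sup>2) \<longlonglongrightarrow> 0"
    proof (rule AE_I2)
      fix u assume "u \<in> space \<mu>"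
      from tendsto_power[OF tendsto_diff[OF tendsto_const[of "p u"] F(2)[OF this]], of 2]
      show "(\<lambda>i. (p u - F i u)\<^sup>2) \<longlonglongrightarrow> 0" by simp
    qed
    show "AE u in \<mu>. norm ((p u - F i u)\<^sup>2) \<le> 10 * (p u)\<^sup>2" for i
    proof (rule AE_I2)
      fix u
      have "(F i u)\<^sup>2 \<le> 4 * (p u)\<^sup>2"
        using power_mono[OF F(3)[of u i], of 2] sp by (simp add: power_mult_distrib)
      then show "norm ((p u - F i u)\<^sup>2) \<le> 10 * (p u)\<^sup>2" using square_add_le[of "p u" "- F i u"] by simp
    qed
  qed (use p in auto)
  then have "(\<lambda>i. LINT u|\<mu>. (p u - F i u)\<^sup>2) \<longlonglongrightarrow> 0" by simp
  from order_tendstoD(2)[OF this \<delta>] obtain i where i: "(LINT u|\<mu>. (p u - F i u)\<^sup>2) < \<delta>"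
    using eventually_happens'[OF sequentially_bot] by blast
  have "step_approx \<mu> {0<..T} (F i)"
  proof -
    have fin: "finite (range (F i))" using F(1)[of i] by (simp add: simple_function_def sp)
    have lev: "F i -` {y} \<in> sets borel" for y
      using F(1)[of i] \<mu>(2) by (cases "y \<in> range (F i)") (auto simp: simple_function_def sp vimage_def)
    have "step_approx \<mu> {0<..T} (\<lambda>u. \<Sum>y\<in>Y. y * indicator (F i -` {y}) u)
      \<and> integrable \<mu> (\<lambda>u. (\<Sum>y\<in>Y. y * indicator (F i -` {y}) u)\<^sup>2)" if "finite Y" for Y
      using that
    proof (induction Y)
      case empty then show ?case using step_approx_zero by simp
    next
      case (insert y Y)
      let ?I = "\<lambda>u. indicator (F i -` {y}) u :: real"
      let ?S = "\<lambda>u. \<Sum>y\<in>Y. y * indicator (F i -` {y}) u"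
      have [measurable]: "F i -` {y} \<in> sets borel" for y by (rule lev)
      have I: "integrable \<mu> (\<lambda>u. (?I u)\<^sup>2)"
        by (rule integrable_const_bound[where B=1]) (simp add: indicator_def, measurable)
      have Im: "?I \<in> borel_measurable \<mu>" "?S \<in> borel_measurable \<mu>" by measurable
      have S: "step_approx \<mu> {0<..T} ?S" "integrable \<mu> (\<lambda>u. (?S u)\<^sup>2)" using insert.IH by auto
      have "step_approx \<mu> {0<..T} (\<lambda>u. y * ?I u + 1 * ?S u)"
        by (rule step_approx_lincomb[OF \<mu> Im(1) I step_approx_indicator[OF \<mu> ae T lev] Im(2) S(2,1)])
      moreover have "integrable \<mu> (\<lambda>u. (y * ?I u - (-1) * ?S u)\<^sup>2)"
        by (rule integrable_square_diff) (use I S(2) in \<open>auto simp: power_mult_distrib\<close>)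
      ultimately show ?case
        unfolding sum.insert[OF insert.hyps] by (simp only: mult_1 mult_minus1 diff_minus_eq_add)
    qed
    from this[OF fin] have "step_approx \<mu> {0<..T} (\<lambda>u. \<Sum>y\<in>range (F i). y * indicator (F i -` {y}) u)" by simp
    moreover have "(\<Sum>y\<in>range (F i). y * indicator (F i -` {y}) u) = F i u" for u
    proof -
      have "(\<Sum>y\<in>range (F i). y * indicator (F i -` {y}) u) = (\<Sum>y\<in>range (F i). if y = F i u then y else 0)"
        by (intro sum.cong refl) (auto simp: indicator_def)
      then show ?thesis using fin by simp
    qed
    ultimately show ?thesis by simp
  qed
  then show "\<exists>q. q \<in> borel_measurable \<mu> \<and> integrable \<mu> (\<lambda>u. (q u)\<^sup>2) \<and> step_approx \<mu> {0<..T} q \<and> (LINT u|\<mu>. (p u - q u)\<^sup>2) < \<delta>"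
    using Fm Fi i by blast
qed

section \<open>Approximation of the optimal functional\<close>

lemma lebesgue_on_integral_borel:
  fixes f :: "real \<Rightarrow> real"
  assumes f: "f \<in> borel_measurable borel" and S: "S \<in> sets borel"
  shows "(LINT t|lebesgue_on S. f t) = (LINT t|lborel. indicator S t * f t)"
proof -
  note [measurable] = f S
  have "(LINT t|lebesgue_on S. f t) = (LINT t|lebesgue. indicator S t *\<^sub>R f t)"
    using S by (intro integral_restrict_space) auto
  also have "\<dots> = (LINT t|lborel. indicator S t *\<^sub>R f t)"
    by (rule integral_completion) measurable
  finally show ?thesis by simp
qed

text \<open>Dividing by \<open>u powr a\<close> turns the functions \<open>pow_fn\<close> into
  indicators and Lebesgue measure on the interval into the finite measure with density
  \<open>u powr (2 * a)\<close>, to which \<open>step_approx_L2\<close> applies.\<close>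

lemma density_pow_fn:
  assumes a: "a \<ge> 0" and T: "T > 0" and h: "h \<in> borel_measurable borel" "integrable lborel (\<lambda>u. (h u)\<^sup>2)"
    and supp: "\<And>u. u \<notin> {0<..T} \<Longrightarrow> h u = 0" and \<delta>: "\<delta> > 0"
  shows "\<exists>X c. finite X \<and> X \<subseteq> {0<..T} \<and> (LINT u|lborel. (h u - (\<Sum>x\<in>X. c x * pow_fn a x u))\<^sup>2) < \<delta>"
proof -
  define w where "w u = indicator {0<..T} u * u powr (2 * a)" for u
  define \<mu> where "\<mu> = density lborel (\<lambda>u. ennreal (w u))"
  have [measurable]: "h \<in> borel_measurable borel" by (rule h(1))
  have wm [measurable]: "w \<in> borel_measurable borel" unfolding w_def by measurable
  have w0: "w u \<ge> 0" for u by (simp add: w_def)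
  have wi: "integrable lborel w"
  proof (rule Bochner_Integration.integrable_bound)
    show "integrable lborel (\<lambda>u. indicator {0..T} u * u powr (2 * a))"
      using has_bochner_integral_powr_0[of "2 * a" T] a T by (auto simp: has_bochner_integral_iff)
  qed (auto simp: w_def indicator_def)
  have \<mu>: "finite_measure \<mu>" "sets \<mu> = sets borel"
  proof -
    have "(\<integral>\<^sup>+u. ennreal (w u) \<partial>lborel) < \<infinity>" using wi w0 by (simp add: nn_integral_eq_integral)
    then show "finite_measure \<mu>" by (intro finite_measureI) (auto simp: \<mu>_def emeasure_density)
  qed (simp add: \<mu>_def)
  have LINT: "(LINT u|\<mu>. f u) = (LINT u|lborel. w u * f u)" if "f \<in> borel_measurable borel" for f :: "real \<Rightarrow> real"
    unfolding \<mu>_def using that w0 by (subst integral_density) auto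
  have ae: "AE u in \<mu>. 0 < u \<and> u \<le> T"
    unfolding \<mu>_def by (subst AE_density) (auto simp: w_def indicator_def)
  define p where "p u = h u * u powr (- a)" for u
  have pm: "p \<in> borel_measurable borel" unfolding p_def by measurable
  have wp: "w u * (p u - s)\<^sup>2 = (h u - indicator {0<..T} u * u powr a * s)\<^sup>2" for u s
  proof (cases "u \<in> {0<..T}")
    case True
    then have u: "u > 0" by simp
    have "u powr (2 * a) = (u powr a)\<^sup>2" using u by (simp add: power2_eq_square powr_add[symmetric])
    moreover have "h u = u powr a * p u" using u by (simp add: p_def powr_minus field_simps)
    ultimately show ?thesis using True by (simp add: w_def power2_eq_square algebra_simps)
  next
    case False then show ?thesis using supp by (simp add: w_def)
  qed
  have "integrable \<mu> (\<lambda>u. (p u)\<^sup>2)"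
    unfolding \<mu>_def using pm w0 wp[of _ 0] h(2) by (subst integrable_density) auto
  from step_approx_L2[OF \<mu> ae T _ this] have "step_approx \<mu> {0<..T} p" using pm \<mu>(2) by (simp cong: measurable_cong_sets)
  from this[unfolded step_approx_def, rule_format, OF \<delta>] obtain X c where X: "finite X" "X \<subseteq> {0<..T}"
    "(LINT u|\<mu>. (p u - (\<Sum>x\<in>X. c x * indicator {..x} u))\<^sup>2) < \<delta>" by auto
  have "(LINT u|\<mu>. (p u - (\<Sum>x\<in>X. c x * indicator {..x} u))\<^sup>2) = (LINT u|lborel. (h u - (\<Sum>x\<in>X. c x * pow_fn a x u))\<^sup>2)"
  proof -
    have m: "(\<lambda>u. (p u - (\<Sum>x\<in>X. c x * indicator {..x} u))\<^sup>2) \<in> borel_measurable borel" using pm by measurable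
    have "indicator {0<..T} u * u powr a * (\<Sum>x\<in>X. c x * indicator {..x} u) = (\<Sum>x\<in>X. c x * pow_fn a x u)" for u
      unfolding sum_distrib_left using X(2) by (intro sum.cong refl) (auto simp: pow_fn_def indicator_def)
    then show ?thesis unfolding LINT[OF m] wp by simp
  qed
  then show ?thesis using X by (intro exI[of _ X] exI[of _ c]) simp
qed

text \<open>\<open>F\<close> is orthogonal to all step functions, so its norm is at most its
  distance to any of them, and these are dense by the case a = 0 of \<open>density_pow_fn\<close>.
  It serves to identify an L2 derivative from its primitive.\<close>

lemma L2_zero_of_integrals_zero:
  fixes F :: "real \<Rightarrow> real"
  assumes T: "T > 0" and F: "F \<in> borel_measurable borel" "integrable lborel (\<lambda>u. (F u)\<^sup>2)"
    and supp: "\<And>u. u \<notin> {0<..T} \<Longrightarrow> F u = 0"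
    and zero: "\<And>t. t \<in> {0<..T} \<Longrightarrow> (LINT u|lborel. indicator {0..t} u * F u) = 0"
  shows "AE u in lborel. F u = 0"
proof -
  have [measurable]: "F \<in> borel_measurable borel" by (rule F(1))
  have "(LINT u|lborel. (F u)\<^sup>2) < \<delta>" if \<delta>: "\<delta> > 0" for \<delta>
  proof -
    obtain X c where X: "finite X" "X \<subseteq> {0<..T}" "(LINT u|lborel. (F u - (\<Sum>x\<in>X. c x * pow_fn 0 x u))\<^sup>2) < \<delta>"
      using density_pow_fn[OF _ T F supp \<delta>, of 0] by auto
    define s where "s u = (\<Sum>x\<in>X. c x * pow_fn 0 x u)" for u
    have sm [measurable]: "s \<in> borel_measurable borel" unfolding s_def[abs_def] by measurable
    have p1: "integrable lborel (\<lambda>u. (pow_fn 0 x u)\<^sup>2)" if "x \<in> X" for x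
    proof -
      have "(\<lambda>u. (pow_fn 0 x u)\<^sup>2) = indicator {0<..x}" by (auto simp: pow_fn_def indicator_def fun_eq_iff)
      then show ?thesis using X(2) that by (auto intro!: integrable_real_indicator)
    qed
    have si: "integrable lborel (\<lambda>u. (s u)\<^sup>2)"
      unfolding s_def by (rule integrable_square_sum(1)) (auto intro: p1)
    have Fs: "integrable lborel (\<lambda>u. F u * s u)" by (intro integrable_mult_of_squares F si) measurable
    have "(LINT u|lborel. F u * s u) = (LINT u|lborel. (\<Sum>x\<in>X. c x * (indicator {0..x} u * F u)))"
    proof (rule Bochner_Integration.integral_cong[OF refl])
      fix u show "F u * s u = (\<Sum>x\<in>X. c x * (indicator {0..x} u * F u))"
        unfolding s_def sum_distrib_left using supp[of u] by (intro sum.cong refl) (auto simp: pow_fn_def indicator_def)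
    qed
    also have "\<dots> = (\<Sum>x\<in>X. (LINT u|lborel. c x * (indicator {0..x} u * F u)))"
    proof (intro Bochner_Integration.integral_sum integrable_mult_right)
      fix x assume "x \<in> X"
      have "integrable lborel (\<lambda>u. F u * pow_fn 0 x u)" using p1[OF \<open>x \<in> X\<close>] by (intro integrable_mult_of_squares F) measurable
      moreover have "F u * pow_fn 0 x u = indicator {0..x} u * F u" for u using supp[of u] by (auto simp: pow_fn_def indicator_def)
      ultimately show "integrable lborel (\<lambda>u. indicator {0..x} u * F u)" by simp
    qed
    also have "\<dots> = 0" using zero X(2) by (intro sum.neutral) auto
    finally have Fs0: "(LINT u|lborel. F u * s u) = 0" .
    have "(LINT u|lborel. (F u - s u)\<^sup>2) = (LINT u|lborel. (F u)\<^sup>2 + (s u)\<^sup>2 - 2 * (F u * s u))"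
      by (simp add: power2_diff mult.assoc)
    also have "\<dots> = (LINT u|lborel. (F u)\<^sup>2) + (LINT u|lborel. (s u)\<^sup>2)"
      using F(2) si Fs Fs0 by simp
    finally have "(LINT u|lborel. (F u)\<^sup>2) + (LINT u|lborel. (s u)\<^sup>2) < \<delta>" using X(3) by (simp add: s_def)
    moreover have "0 \<le> (LINT u|lborel. (s u)\<^sup>2)" by simp
    ultimately show ?thesis by linarith
  qed
  moreover have "0 \<le> (LINT u|lborel. (F u)\<^sup>2)" by simp
  ultimately have "(LINT u|lborel. (F u)\<^sup>2) = 0" by (metis less_le less_irrefl)
  then have "AE u in lborel. (F u)\<^sup>2 = 0" by (subst (asm) integral_nonneg_eq_0_iff_AE) (auto intro: F(2))
  then show ?thesis by eventually_elim simp
qed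

text \<open>The kernel of \<open>KT_star\<close> for H = 1/2 - a; with its arguments exchanged it is
  the kernel of \<open>K0_star\<close>, which makes the two operators adjoint.\<close>

definition frac_kernel :: "real \<Rightarrow> real \<Rightarrow> real \<Rightarrow> real \<Rightarrow> real" where
  "frac_kernel a T t u = (if 0 < t \<and> t < u \<and> u \<le> T
     then inverse (C1 (1/2 - a)) / Gamma a * (t powr a * (u - t) powr (a - 1) * u powr (- a)) else 0)"

text \<open>For t < u the factor \<open>t powr a * u powr (- a)\<close> is at most 1. Up to a
  constant the kernel is therefore dominated by \<open>\<bar>u - t\<bar> powr (a - 1)\<close>, whose
  integral over the interval is at most \<open>2 * T powr a / a\<close> in either variable.\<close>

lemma schur_frac_kernel:
  assumes a: "0 < a" "a < 1/2" and T: "T > 0"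
  shows "schur_kernel (frac_kernel a T) (inverse (C1 (1/2 - a)) / Gamma a * (2 * T powr a / a))"
proof -
  define c where "c = inverse (C1 (1/2 - a)) / Gamma a"
  have c: "c > 0" using C1_pos[OF a] a by (simp add: c_def Gamma_real_pos)
  have fk: "frac_kernel a T t u = (if 0 < t \<and> t < u \<and> u \<le> T then c * (t powr a * (u - t) powr (a - 1) * u powr (- a)) else 0)" for t u
    by (simp add: frac_kernel_def c_def)
  have "schur_kernel (frac_kernel a T) (c * (2 * T powr a / a))"
  proof
  show "(\<lambda>(t, u). frac_kernel a T t u) \<in> borel_measurable (borel \<Otimes>\<^sub>M borel)"
    unfolding frac_kernel_def by measurable
  show "0 \<le> frac_kernel a T t u" for t u using c by (simp add: fk)
  show "c * (2 * T powr a / a) > 0" using c a T by (intro mult_pos_pos divide_pos_pos) auto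
  have le: "frac_kernel a T t u \<le> c * (indicator {0..T} t * (indicator {0..T} u * \<bar>u - t\<bar> powr (a - 1)))" for t u
  proof (cases "0 < t \<and> t < u \<and> u \<le> T")
    case True
    have "t powr a * u powr (- a) = (t / u) powr a" using True by (simp add: powr_divide powr_minus field_simps)
    also have "\<dots> \<le> 1" using True a by (intro powr_le1) auto
    finally have "(t powr a * u powr (- a)) * (u - t) powr (a - 1) \<le> 1 * (u - t) powr (a - 1)"
      by (rule mult_right_mono) simp
    then have "c * ((t powr a * u powr (- a)) * (u - t) powr (a - 1)) \<le> c * (u - t) powr (a - 1)"
      using c by (simp only: mult_1) (rule mult_left_mono, auto)
    then show ?thesis using True by (simp add: fk mult_ac)
  next
    case False
    then have "frac_kernel a T t u = 0" unfolding fk by (simp only: if_False)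
    then show ?thesis using c by simp
  qed
  have e: "a - 1 > -1" "a - 1 + 1 = a" using a by auto
  have bound: "(\<integral>\<^sup>+u. ennreal (c * (indicator {0..T} t * (indicator {0..T} u * \<bar>u - t\<bar> powr (a - 1)))) \<partial>lborel) \<le> ennreal (c * (2 * T powr a / a))" for t
  proof (cases "t \<in> {0..T}")
    case True
    note i = integrable_abs_powr_Icc[OF e(1) True, unfolded e(2)]
    have "(\<integral>\<^sup>+u. ennreal (c * (indicator {0..T} t * (indicator {0..T} u * \<bar>u - t\<bar> powr (a - 1)))) \<partial>lborel)
      = ennreal (LINT u|lborel. c * (indicator {0..T} u * \<bar>u - t\<bar> powr (a - 1)))"
      using True i(1) c by (subst nn_integral_eq_integral) (auto intro!: integrable_mult_right mult_nonneg_nonneg)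
    also have "\<dots> \<le> ennreal (c * (2 * T powr a / a))"
      unfolding Bochner_Integration.integral_mult_right_zero using i(2) c by (intro ennreal_leI mult_left_mono) auto
    finally show ?thesis .
  qed simp
  show "(\<integral>\<^sup>+u. ennreal (frac_kernel a T t u) \<partial>lborel) \<le> ennreal (c * (2 * T powr a / a))" for t
    by (rule order_trans[OF nn_integral_mono bound]) (rule ennreal_leI[OF le])
  show "(\<integral>\<^sup>+t. ennreal (frac_kernel a T t u) \<partial>lborel) \<le> ennreal (c * (2 * T powr a / a))" for u
  proof (rule order_trans[OF nn_integral_mono bound])
    fix t
    have "frac_kernel a T t u \<le> c * (indicator {0..T} u * (indicator {0..T} t * \<bar>t - u\<bar> powr (a - 1)))"
      using le[of t u] by (simp add: mult_ac abs_minus_commute)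
    then show "ennreal (frac_kernel a T t u) \<le> ennreal (c * (indicator {0..T} u * (indicator {0..T} t * \<bar>t - u\<bar> powr (a - 1))))"
      by (rule ennreal_leI)
  qed
  qed
  then show ?thesis by (simp only: c_def)
qed

text \<open>The factor \<open>u powr a\<close> cancels the weight \<open>u powr (- a)\<close> of the
  kernel, leaving the integral of \<open>(u - t) powr (a - 1)\<close> from \<open>t\<close> to
  \<open>x\<close>.\<close>

lemma frac_kernel_pow_fn:
  assumes a: "0 < a" "a < 1/2" and x: "0 < x" "x \<le> T"
  shows "has_bochner_integral lborel (\<lambda>u. frac_kernel a T t u * pow_fn a x u) (inverse (C1 (1/2 - a)) / Gamma a / a * mart_fn a x t)"
proof (cases "0 < t \<and> t < x")
  case True
  let ?c = "inverse (C1 (1/2 - a)) / Gamma a"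
  have "has_bochner_integral lborel (\<lambda>s. indicator {0..x - t} s * s powr (a - 1)) ((x - t) powr (a - 1 + 1) / (a - 1 + 1))"
    using a True by (intro has_bochner_integral_powr_0) auto
  then have "has_bochner_integral lborel (\<lambda>u. indicator {0..x - t} (- t + 1 * u) * (- t + 1 * u) powr (a - 1)) ((x - t) powr (a - 1 + 1) / (a - 1 + 1) /\<^sub>R \<bar>1\<bar>)"
    by (rule lborel_has_bochner_integral_real_affine_iff[THEN iffD1, rotated]) simp
  then have "has_bochner_integral lborel (\<lambda>u. (?c * t powr a) * (indicator {0..x - t} (- t + 1 * u) * (- t + 1 * u) powr (a - 1))) ((?c * t powr a) * ((x - t) powr (a - 1 + 1) / (a - 1 + 1) /\<^sub>R \<bar>1\<bar>))"
    by (rule has_bochner_integral_mult_right)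
  moreover have "(?c * t powr a) * (indicator {0..x - t} (- t + 1 * u) * (- t + 1 * u) powr (a - 1)) = frac_kernel a T t u * pow_fn a x u" for u
    using True x by (auto simp: frac_kernel_def pow_fn_def indicator_def powr_minus)
  moreover have "(?c * t powr a) * ((x - t) powr (a - 1 + 1) / (a - 1 + 1) /\<^sub>R \<bar>1\<bar>) = ?c / a * mart_fn a x t"
    using True by (simp add: mart_fn_def powr_mult)
  ultimately show ?thesis by (simp only:)
next
  case False
  then have "frac_kernel a T t u * pow_fn a x u = 0" for u by (auto simp: frac_kernel_def pow_fn_def indicator_def)
  moreover have "mart_fn a x t = 0" using False by (simp add: mart_fn_def)
  ultimately show ?thesis using has_bochner_integral_zero[of lborel] by (simp only: mult_zero_right)
qed

text \<open>Completing the square: for \<open>l = - \<integral> X d\<phi>\<close> with \<open>\<phi> = K P\<close>, the value \<open>l(g) - Var l / 2\<close> differs from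
  \<open>(\<parallel>K h\<parallel>\<^sup>2 + \<parallel>h\<parallel>\<^sup>2) / 2\<close> only by \<open>(\<parallel>K d\<parallel>\<^sup>2 + \<parallel>d\<parallel>\<^sup>2) / 2\<close>, where \<open>d = h - P\<close>.\<close>

lemma functional_approximation:
  fixes a T :: real and b g :: "real \<Rightarrow> real"
  assumes a: "0 < a" "a < 1/2" and T: "T > 0"
    and b: "b \<in> borel_measurable borel" "integrable lborel (\<lambda>u. (b u)\<^sup>2)" and bsupp: "\<And>u. u \<notin> {0<..T} \<Longrightarrow> b u = 0"
  defines "h \<equiv> schur_kernel.op (\<lambda>t u. frac_kernel a T u t) b"
  defines "w \<equiv> schur_kernel.op (frac_kernel a T) h"
  assumes g: "continuous_on {0..T} g" "\<And>t. t \<in> {0..T} \<Longrightarrow> g t = (LINT s|lborel. indicator {s. 0 < s \<and> s \<le> t} s * (w s + b s))"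
    and \<delta>: "\<delta> > 0"
  shows "\<exists>F v. finite F \<and> F \<subseteq> {0..T} \<and>
    (\<Sum>t\<in>F. v t * g t) - (\<Sum>s\<in>F. \<Sum>t\<in>F. v s * v t * mixed_cov (1/2 - a) s t) / 2
      \<ge> ((LINT t|lborel. (w t)\<^sup>2) + (LINT t|lborel. (h t)\<^sup>2)) / 2 - \<delta>"
proof -
  define c0 where "c0 = inverse (C1 (1/2 - a)) / Gamma a"
  define C where "C = c0 * (2 * T powr a / a)"
  interpret K: schur_kernel "frac_kernel a T" C unfolding C_def c0_def by (rule schur_frac_kernel[OF a T])
  interpret K': schur_kernel "\<lambda>t u. frac_kernel a T u t" C by (rule K.transpose)
  have h: "h = K'.op b" and w: "w = K.op h" by (simp_all add: h_def w_def)
  have hm: "h \<in> borel_measurable borel" unfolding h by (rule K'.op_measurable[OF b(1)])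
  have hi: "integrable lborel (\<lambda>u. (h u)\<^sup>2)" unfolding h by (rule K'.op_square[OF b])
  have wm: "w \<in> borel_measurable borel" unfolding w by (rule K.op_measurable[OF hm])
  have wi: "integrable lborel (\<lambda>u. (w u)\<^sup>2)" unfolding w by (rule K.op_square[OF hm hi])
  have hsupp: "h u = 0" if "u \<notin> {0<..T}" for u
    unfolding h K'.op_def using that by (auto simp: frac_kernel_def intro!: integral_eq_zero_AE)
  have wsupp: "w u = 0" if "u \<notin> {0<..T}" for u
    unfolding w K.op_def using that by (auto simp: frac_kernel_def intro!: integral_eq_zero_AE)
  \<comment> \<open>The defect is half of ||K d||^2 + ||d||^2, at most (C^2 + 1) / 2 times ||d||^2.
    This choice makes it smaller than \<delta> / 2 and leaves the other half for the
    discretization.\<close>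
  define \<eta> where "\<eta> = \<delta> / (C\<^sup>2 + 1)"
  have C1': "C\<^sup>2 + 1 > 0" by (simp add: add_nonneg_pos)
  then have \<eta>: "\<eta> > 0" using \<delta> by (simp add: \<eta>_def)
  obtain X c where X: "finite X" "X \<subseteq> {0<..T}" "(LINT u|lborel. (h u - (\<Sum>x\<in>X. c x * pow_fn a x u))\<^sup>2) < \<eta>"
    using density_pow_fn[OF less_imp_le[OF a(1)] T hm hi hsupp \<eta>] by auto
  define P where "P u = (\<Sum>x\<in>X. c x * pow_fn a x u)" for u
  define d where "d u = h u - P u" for u
  \<comment> \<open>By \<open>frac_kernel_pow_fn\<close> these are the coefficients of K P with
    respect to the functions \<open>mart_fn\<close>.\<close>
  define c' where "c' x = c0 / a * c x" for x
  have c0: "c0 > 0" using C1_pos[OF a] a by (simp add: Gamma_real_pos c0_def)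
  note form = mixed_cov_form_mart_fn[OF a X(1,2) T, where c=c']
  have Pm: "P \<in> borel_measurable borel" unfolding P_def[abs_def] by measurable
  have Pi: "integrable lborel (\<lambda>u. (P u)\<^sup>2)"
    unfolding P_def by (rule mixed_cov_form_mart_fn(4)[OF a X(1,2) T])
  have dm: "d \<in> borel_measurable borel" unfolding d_def[abs_def] using hm Pm by measurable
  have di: "integrable lborel (\<lambda>u. (d u)\<^sup>2)"
  proof (rule Bochner_Integration.integrable_bound)
    show "integrable lborel (\<lambda>u. 2 * (h u)\<^sup>2 + 2 * (- P u)\<^sup>2)" using hi Pi by simp
    show "AE u in lborel. norm ((d u)\<^sup>2) \<le> norm (2 * (h u)\<^sup>2 + 2 * (- P u)\<^sup>2)"
      using square_add_le[of "h _" "- P _"] by (intro AE_I2) (simp add: d_def)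
  qed (use dm in measurable)
  have KP: "K.op P t = (\<Sum>x\<in>X. c' x * mart_fn a x t)" for t
  proof -
    have x: "0 < x" "x \<le> T" if "x \<in> X" for x using X(2) that by auto
    have "K.op P t = (LINT u|lborel. (\<Sum>x\<in>X. c x * (frac_kernel a T t u * pow_fn a x u)))"
      unfolding K.op_def P_def by (simp add: sum_distrib_left mult_ac)
    also have "\<dots> = (\<Sum>x\<in>X. (LINT u|lborel. c x * (frac_kernel a T t u * pow_fn a x u)))"
      using frac_kernel_pow_fn[OF a x] by (intro Bochner_Integration.integral_sum integrable_mult_right) (auto simp: has_bochner_integral_iff)
    also have "\<dots> = (\<Sum>x\<in>X. c' x * mart_fn a x t)"
    proof (intro sum.cong refl)
      fix x' assume "x' \<in> X"
      from frac_kernel_pow_fn[OF a x[OF this], of t]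
      show "(LINT u|lborel. c x' * (frac_kernel a T t u * pow_fn a x' u)) = c' x' * mart_fn a x' t"
        by (simp add: has_bochner_integral_iff c'_def c0_def)
    qed
    finally show ?thesis .
  qed
  have KPm: "K.op P \<in> borel_measurable borel" by (rule K.op_measurable[OF Pm])
  have KPi: "integrable lborel (\<lambda>u. (K.op P u)\<^sup>2)" by (rule K.op_square[OF Pm Pi])
  have Kdm: "K.op d \<in> borel_measurable borel" by (rule K.op_measurable[OF dm])
  have Kdi: "integrable lborel (\<lambda>u. (K.op d u)\<^sup>2)" by (rule K.op_square[OF dm di])
  \<comment> \<open>The operator is linear only where both defining integrals converge, that is
    almost everywhere.\<close>
  have ae: "AE t in lborel. K.op P t = w t - K.op d t"
    using K.op_square(3)[OF hm hi] K.op_square(3)[OF Pm Pi]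
  proof eventually_elim
    case (elim t)
    have "K.op d t = (LINT u|lborel. frac_kernel a T t u * h u - frac_kernel a T t u * P u)"
      unfolding K.op_def d_def by (simp add: right_diff_distrib)
    also have "\<dots> = w t - K.op P t" unfolding w K.op_def by (rule Bochner_Integration.integral_diff[OF elim])
    finally show ?case by simp
  qed
  let ?\<psi> = "\<lambda>t. \<Sum>x\<in>X. c' x * mart_fn_deriv a x t"
  define D where "D = (LINT s|lborel. (LINT t|lborel. mixed_cov (1/2 - a) s t * ?\<psi> t) * ?\<psi> s)"
  define Lg where "Lg = (LINT t|lborel. g t * ?\<psi> t)"
  have D: "D = (LINT s|lborel. (K.op P s)\<^sup>2) + (LINT s|lborel. (P s)\<^sup>2)"
  proof -
    have "(\<Sum>x\<in>X. c' x * pow_fn a x s)\<^sup>2 = (c0 / a)\<^sup>2 * (P s)\<^sup>2" for s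
    proof -
      have "(\<Sum>x\<in>X. c' x * pow_fn a x s) = c0 / a * P s"
        unfolding c'_def P_def sum_distrib_left by (intro sum.cong refl) simp
      then show ?thesis by (simp only: power_mult_distrib)
    qed
    \<comment> \<open>The constants of the fractional covariance and of the operator cancel, so the
      fractional part of the variance is exactly the squared norm of \<open>P\<close>.\<close>
    moreover have "(a * C1 (1/2 - a) * Gamma a)\<^sup>2 * (c0 / a)\<^sup>2 = 1"
    proof -
      have "Gamma a \<noteq> 0" using Gamma_real_pos[OF a(1)] by (metis less_irrefl)
      then have "a * C1 (1/2 - a) * Gamma a * (c0 / a) = 1"
        unfolding c0_def using C1_pos[OF a] a by simp
      then show ?thesis by (simp add: power_mult_distrib[symmetric])
    qed
    ultimately show ?thesis unfolding D_def form(3) KP by (simp add: mult.assoc[symmetric])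
  qed
  have wb: "integrable lborel (\<lambda>s. w s + b s)"
  proof -
    have I: "integrable lborel (indicator {0<..T} :: real \<Rightarrow> real)" "integrable lborel (\<lambda>s. (indicator {0<..T} s :: real)\<^sup>2)"
    proof -
      show "integrable lborel (indicator {0<..T} :: real \<Rightarrow> real)" using T by (auto intro!: integrable_real_indicator)
      moreover have "(\<lambda>s. (indicator {0<..T} s :: real)\<^sup>2) = indicator {0<..T}" by (auto simp: indicator_def)
      ultimately show "integrable lborel (\<lambda>s. (indicator {0<..T} s :: real)\<^sup>2)" by simp
    qed
    have "integrable lborel (\<lambda>s. indicator {0<..T} s * w s)" "integrable lborel (\<lambda>s. indicator {0<..T} s * b s)"
      by (intro integrable_mult_of_squares I wm wi b; simp)+
    moreover have "indicator {0<..T} s * w s = w s" "indicator {0<..T} s * b s = b s" for s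
      using wsupp bsupp by (auto simp: indicator_def)
    ultimately show ?thesis by simp
  qed
  have Lg: "Lg = (LINT s|lborel. (w s + b s) * K.op P s)"
    unfolding Lg_def KP by (rule form(5)[OF wb g(2)])
  note ip = integrable_mult_of_squares
  have bw: "integrable lborel (\<lambda>t. b t * w t)" "integrable lborel (\<lambda>t. b t * K.op d t)" "integrable lborel (\<lambda>t. h t * d t)"
    by (intro ip b wm wi Kdm Kdi hm hi dm di; simp add: b wm Kdm hm dm)+
  \<comment> \<open>As \<open>h\<close> is the adjoint operator applied to \<open>b\<close>, pairing
    \<open>b\<close> with K of a function equals pairing \<open>h\<close> with that
    function.\<close>
  have adj: "(LINT t|lborel. b t * w t) = (LINT u|lborel. h u * h u)" "(LINT t|lborel. b t * K.op d t) = (LINT u|lborel. h u * d u)"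
    unfolding w h by (rule K.op_adjoint[OF _ _ b]; (fold h)?; intro hm hi dm di)+
  have "Lg - D / 2 = (LINT s|lborel. (w s + b s) * K.op P s - (K.op P s)\<^sup>2 / 2) - (LINT s|lborel. (P s)\<^sup>2) / 2"
  proof -
    have 1: "integrable lborel (\<lambda>s. (w s + b s) * K.op P s)"
      unfolding distrib_right by (intro Bochner_Integration.integrable_add ip wm wi KPm KPi b; simp add: wm KPm b)
    have "(LINT s|lborel. (w s + b s) * K.op P s - (K.op P s)\<^sup>2 / 2) = Lg - (LINT s|lborel. (K.op P s)\<^sup>2) / 2"
      unfolding Lg using 1 KPi by simp
    then show ?thesis unfolding D by (simp add: field_simps)
  qed
  also have "(LINT s|lborel. (w s + b s) * K.op P s - (K.op P s)\<^sup>2 / 2)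
    = (LINT s|lborel. (w s)\<^sup>2 / 2 + b s * w s - b s * K.op d s - (K.op d s)\<^sup>2 / 2)"
  proof (rule integral_cong_AE)
    show "AE s in lborel. (w s + b s) * K.op P s - (K.op P s)\<^sup>2 / 2 = (w s)\<^sup>2 / 2 + b s * w s - b s * K.op d s - (K.op d s)\<^sup>2 / 2"
      using ae
    proof eventually_elim
      case (elim s)
      show ?case unfolding elim by (simp add: power2_eq_square field_simps)
    qed
  qed (use wm b(1) KPm Kdm in measurable)
  also have "\<dots> = (LINT s|lborel. (w s)\<^sup>2) / 2 + (LINT u|lborel. h u * h u) - (LINT u|lborel. h u * d u) - (LINT s|lborel. (K.op d s)\<^sup>2) / 2"
    unfolding adj[symmetric] using wi bw Kdi by simp
  also have "(LINT s|lborel. (P s)\<^sup>2) = (LINT u|lborel. (h u)\<^sup>2 - 2 * (h u * d u) + (d u)\<^sup>2)"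
    by (intro Bochner_Integration.integral_cong) (auto simp: d_def power2_eq_square algebra_simps)
  also have "\<dots> = (LINT u|lborel. (h u)\<^sup>2) - 2 * (LINT u|lborel. h u * d u) + (LINT u|lborel. (d u)\<^sup>2)"
    using hi bw(3) di by simp
  finally have val: "Lg - D / 2 = ((LINT t|lborel. (w t)\<^sup>2) + (LINT t|lborel. (h t)\<^sup>2)) / 2
    - ((LINT s|lborel. (K.op d s)\<^sup>2) + (LINT u|lborel. (d u)\<^sup>2)) / 2"
    by (simp add: power2_eq_square field_simps)
  have d\<eta>: "(LINT u|lborel. (d u)\<^sup>2) < \<eta>" using X(3) by (simp add: d_def P_def)
  have "(LINT s|lborel. (K.op d s)\<^sup>2) + (LINT u|lborel. (d u)\<^sup>2) \<le> (C\<^sup>2 + 1) * (LINT u|lborel. (d u)\<^sup>2)"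
    using K.op_square(2)[OF dm di] by (simp add: distrib_right)
  also have "\<dots> < (C\<^sup>2 + 1) * \<eta>" using d\<eta> C1' by (rule mult_strict_left_mono)
  also have "\<dots> = \<delta>" using C1' by (simp add: \<eta>_def)
  finally have near: "Lg - D / 2 > ((LINT t|lborel. (w t)\<^sup>2) + (LINT t|lborel. (h t)\<^sup>2)) / 2 - \<delta> / 2"
    unfolding val by simp
  have cont: "continuous_on ({0..T} \<times> {0..T}) (\<lambda>(s, t). mixed_cov (1/2 - a) s t)"
    by (rule continuous_on_mixed_cov) (use a in auto)
  obtain F v where Fv: "\<forall>n. finite (F n) \<and> F n \<subseteq> {0..T}"
    "(\<lambda>n. \<Sum>t\<in>F n. v n t * g t) \<longlonglongrightarrow> Lg"
    "(\<lambda>n. \<Sum>s\<in>F n. \<Sum>t\<in>F n. v n s * v n t * mixed_cov (1/2 - a) s t) \<longlonglongrightarrow> D"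
    using discretization[OF T form(1,2) g(1) cont] unfolding Lg_def D_def by blast
  have "(\<lambda>n. (\<Sum>t\<in>F n. v n t * g t) - (\<Sum>s\<in>F n. \<Sum>t\<in>F n. v n s * v n t * mixed_cov (1/2 - a) s t) / 2) \<longlonglongrightarrow> Lg - D / 2"
    by (intro tendsto_diff tendsto_divide Fv tendsto_const) simp
  from order_tendstoD(1)[OF this, of "((LINT t|lborel. (w t)\<^sup>2) + (LINT t|lborel. (h t)\<^sup>2)) / 2 - \<delta>"] near \<delta>
  obtain n where "(\<Sum>t\<in>F n. v n t * g t) - (\<Sum>s\<in>F n. \<Sum>t\<in>F n. v n s * v n t * mixed_cov (1/2 - a) s t) / 2
    > ((LINT t|lborel. (w t)\<^sup>2) + (LINT t|lborel. (h t)\<^sup>2)) / 2 - \<delta>"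
    using eventually_happens'[OF sequentially_bot] by fastforce
  then show ?thesis using Fv(1) by (intro exI[of _ "F n"] exI[of _ "v n"]) auto
qed

text \<open>The Fubini arguments run over \<open>lborel\<close>, while \<open>L2_on\<close> provides
  Lebesgue measurability. The representative is also set to 0 at the point 0, so that it lives on
  the half-open interval used for the step functions.\<close>

lemma L2_on_borel_version:
  assumes \<phi>: "L2_on T \<phi>"
  obtains \<psi> where "\<psi> \<in> borel_measurable borel" "integrable lborel (\<lambda>t. (\<psi> t)\<^sup>2)" "\<And>t. t \<notin> {0<..T} \<Longrightarrow> \<psi> t = 0"
    "AE t in lebesgue_on {0..T}. \<phi> t = \<psi> t"
proof -
  have m: "(\<lambda>t. indicator {0..T} t *\<^sub>R \<phi> t) \<in> borel_measurable lebesgue"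
    using \<phi> by (subst borel_measurable_restrict_space_iff[symmetric]) (auto simp: L2_on_def)
  obtain \<phi>0 where \<phi>0: "\<phi>0 \<in> borel_measurable lborel" "AE t in lborel. indicator {0..T} t *\<^sub>R \<phi> t = \<phi>0 t"
    using completion_ex_borel_measurable_real[OF m] by auto
  define \<psi> where "\<psi> t = indicator {0<..T} t * \<phi>0 t" for t
  have \<psi>m: "\<psi> \<in> borel_measurable borel" unfolding \<psi>_def[abs_def] using \<phi>0(1) by measurable
  have ae0: "AE t in lborel. t \<in> {0..T} \<longrightarrow> \<phi> t = \<psi> t"
    using \<phi>0(2) AE_lborel_singleton[of 0] by eventually_elim (auto simp: \<psi>_def indicator_def)
  then have ae1: "AE t in lebesgue. t \<in> {0..T} \<longrightarrow> \<phi> t = \<psi> t" by (rule AE_completion)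
  then have ae: "AE t in lebesgue_on {0..T}. \<phi> t = \<psi> t" by (subst AE_restrict_space_iff) auto
  have i0: "integrable lebesgue (\<lambda>t. indicator {0..T} t *\<^sub>R (\<phi> t)\<^sup>2)"
    using \<phi> by (subst integrable_restrict_space[symmetric]) (auto simp: L2_on_def)
  have "integrable lebesgue (\<lambda>t. (\<psi> t)\<^sup>2)"
  proof (rule integrable_cong_AE_imp[OF i0])
    show "(\<lambda>t. (\<psi> t)\<^sup>2) \<in> borel_measurable lebesgue"
      using \<psi>m by (intro measurable_completion) measurable
    show "AE t in lebesgue. indicator {0..T} t *\<^sub>R (\<phi> t)\<^sup>2 = (\<psi> t)\<^sup>2"
      using ae1 by eventually_elim (auto simp: \<psi>_def indicator_def)
  qed
  then have "integrable lborel (\<lambda>t. (\<psi> t)\<^sup>2)" using \<psi>m by (subst (asm) integrable_completion) auto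
  then show ?thesis using \<psi>m ae by (intro that[of \<psi>]) (auto simp: \<psi>_def)
qed

lemma AE_lebesgue_on_subset:
  fixes T :: real
  assumes "AE t in lebesgue_on {0..T}. P t" "A \<subseteq> {0..T}" "A \<in> sets lebesgue"
  shows "AE t in lebesgue_on A. P t"
proof -
  have "AE t in lebesgue. t \<in> {0..T} \<longrightarrow> P t" using assms(1) by (subst (asm) AE_restrict_space_iff) auto
  then have "AE t in lebesgue. t \<in> A \<longrightarrow> P t" by eventually_elim (use assms(2) in auto)
  then show ?thesis using assms(3) by (subst AE_restrict_space_iff) auto
qed

lemma measurable_lebesgue_on_subset:
  fixes \<phi> :: "real \<Rightarrow> real"
  assumes "\<phi> \<in> borel_measurable (lebesgue_on {0..T})" "A \<subseteq> {0..T}" "A \<in> sets lebesgue"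
  shows "\<phi> \<in> borel_measurable (lebesgue_on A)"
  using measurable_restrict_mono[OF assms(1,2)] .

lemma borel_lebesgue_on: "f \<in> borel_measurable borel \<Longrightarrow> f \<in> borel_measurable (lebesgue_on A)"
  for f :: "real \<Rightarrow> real"
  by (intro measurable_restrict_space1 measurable_completion) simp

lemma integral_lebesgue_on_version:
  fixes \<phi> \<psi> q :: "real \<Rightarrow> real"
  assumes \<phi>: "\<phi> \<in> borel_measurable (lebesgue_on {0..T})" and \<psi>: "\<psi> \<in> borel_measurable borel"
    and ae: "AE t in lebesgue_on {0..T}. \<phi> t = \<psi> t" and A: "A \<subseteq> {0..T}" "A \<in> sets borel"
    and q: "q \<in> borel_measurable borel"
  shows "(LINT t|lebesgue_on A. q t * \<phi> t) = (LINT t|lborel. indicator A t * (q t * \<psi> t))"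
proof -
  have AL: "A \<in> sets lebesgue" using A(2) by auto
  have "(LINT t|lebesgue_on A. q t * \<phi> t) = (LINT t|lebesgue_on A. q t * \<psi> t)"
  proof (rule integral_cong_AE)
    show "(\<lambda>t. q t * \<phi> t) \<in> borel_measurable (lebesgue_on A)"
      by (intro borel_measurable_times borel_lebesgue_on q measurable_lebesgue_on_subset[OF \<phi> A(1) AL])
    show "(\<lambda>t. q t * \<psi> t) \<in> borel_measurable (lebesgue_on A)"
      by (intro borel_measurable_times borel_lebesgue_on q \<psi>)
    show "AE t in lebesgue_on A. q t * \<phi> t = q t * \<psi> t"
      using AE_lebesgue_on_subset[OF ae A(1) AL] by eventually_elim simp
  qed
  also have "\<dots> = (LINT t|lborel. indicator A t * (q t * \<psi> t))"
    using q \<psi> A(2) by (intro lebesgue_on_integral_borel) auto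
  finally show ?thesis .
qed

text \<open>The equality is pointwise in \<open>t\<close>, since changing \<open>\<phi>\<close> on a
  null set does not affect the integral.\<close>

lemma K0_star_eq_op:
  assumes H: "0 < H" "H < 1/2" and \<phi>: "\<phi> \<in> borel_measurable (lebesgue_on {0..T})" and \<psi>: "\<psi> \<in> borel_measurable borel"
    and ae: "AE t in lebesgue_on {0..T}. \<phi> t = \<psi> t" and t: "0 < t" "t \<le> T"
  shows "K0_star H \<phi> t = (LINT u|lborel. frac_kernel (1/2 - H) T u t * \<psi> u)"
proof -
  define a where "a = 1/2 - H"
  have e: "- 1/2 - H = a - 1" "H - 1/2 = - a" "1/2 - H = a" and e': "1/2 - a = H" by (simp_all add: a_def)
  have "(LINT u|lebesgue_on {0..t}. (t - u) powr (- 1/2 - H) * u powr (1/2 - H) * \<phi> u)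
    = (LINT u|lborel. indicator {0..t} u * ((t - u) powr (- 1/2 - H) * u powr (1/2 - H) * \<psi> u))"
    by (rule integral_lebesgue_on_version[OF \<phi> \<psi> ae]) (use t in auto)
  then have "K0_star H \<phi> t = (LINT u|lborel. inverse (C1 H) * t powr (H - 1/2) / Gamma (1/2 - H) *
     (indicator {0..t} u * ((t - u) powr (- 1/2 - H) * u powr (1/2 - H) * \<psi> u)))"
    unfolding K0_star_def by (simp only: Bochner_Integration.integral_mult_right_zero)
  also have "\<dots> = (LINT u|lborel. frac_kernel (1/2 - H) T u t * \<psi> u)"
  proof (rule Bochner_Integration.integral_cong[OF refl])
    fix u
    \<comment> \<open>At u = 0 and at u = t the convention \<open>0 powr _ = 0\<close> agrees with
      the value 0 of the kernel.\<close>
    show "inverse (C1 H) * t powr (H - 1/2) / Gamma (1/2 - H) * (indicator {0..t} u * ((t - u) powr (- 1/2 - H) * u powr (1/2 - H) * \<psi> u))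
      = frac_kernel (1/2 - H) T u t * \<psi> u"
      unfolding e unfolding frac_kernel_def e'
      using t by (cases "u = 0"; cases "u = t") (auto simp: indicator_def)
  qed
  finally show ?thesis .
qed

lemma KT_star_eq_op:
  assumes H: "0 < H" "H < 1/2" and \<phi>: "\<phi> \<in> borel_measurable (lebesgue_on {0..T})" and \<psi>: "\<psi> \<in> borel_measurable borel"
    and ae: "AE t in lebesgue_on {0..T}. \<phi> t = \<psi> t" and t: "0 < t" "t \<le> T"
  shows "KT_star H T \<phi> t = (LINT u|lborel. frac_kernel (1/2 - H) T t u * \<psi> u)"
proof -
  define a where "a = 1/2 - H"
  have e: "- 1/2 - H = a - 1" "H - 1/2 = - a" "1/2 - H = a" and e': "1/2 - a = H" by (simp_all add: a_def)
  have "(LINT u|lebesgue_on {t..T}. (u - t) powr (- 1/2 - H) * u powr (H - 1/2) * \<phi> u)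
    = (LINT u|lborel. indicator {t..T} u * ((u - t) powr (- 1/2 - H) * u powr (H - 1/2) * \<psi> u))"
    by (rule integral_lebesgue_on_version[OF \<phi> \<psi> ae]) (use t in auto)
  then have "KT_star H T \<phi> t = (LINT u|lborel. inverse (C1 H) * t powr (1/2 - H) / Gamma (1/2 - H) *
     (indicator {t..T} u * ((u - t) powr (- 1/2 - H) * u powr (H - 1/2) * \<psi> u)))"
    unfolding KT_star_def by (simp only: Bochner_Integration.integral_mult_right_zero)
  also have "\<dots> = (LINT u|lborel. frac_kernel (1/2 - H) T t u * \<psi> u)"
  proof (rule Bochner_Integration.integral_cong[OF refl])
    fix u
    show "inverse (C1 H) * t powr (1/2 - H) / Gamma (1/2 - H) * (indicator {t..T} u * ((u - t) powr (- 1/2 - H) * u powr (H - 1/2) * \<psi> u))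
      = frac_kernel (1/2 - H) T t u * \<psi> u"
      unfolding e unfolding frac_kernel_def e'
      using t by (cases "u = t") (auto simp: indicator_def)
  qed
  finally show ?thesis .
qed

lemma AE_lebesgue_on_nonzero: "AE t in lebesgue_on {0..T}. t \<noteq> (0::real)"
proof -
  have "AE t in lebesgue. t \<noteq> (0::real)" by (rule AE_completion[OF AE_lborel_singleton])
  then show ?thesis by (subst AE_restrict_space_iff) (auto elim: eventually_mono)
qed

lemma continuous_on_indefinite_integral:
  fixes \<psi> g :: "real \<Rightarrow> real"
  assumes \<psi>: "integrable lborel \<psi>" and g: "\<And>t. t \<in> {0..T} \<Longrightarrow> g t = (LINT s|lborel. indicator {0..t} s * \<psi> s)"
  shows "continuous_on {0..T} g"
proof -
  have "continuous_on {0..T} (\<lambda>t. integral {0..t} \<psi>)"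
    using integrable_lborel_imp_absolutely_integrable_on(1)[OF \<psi>, of "{0..T}"]
    by (intro indefinite_integral_continuous_1 set_lebesgue_integral_eq_integral(1)) simp
  then show ?thesis
    by (rule continuous_on_eq) (use g integrable_lborel_imp_absolutely_integrable_on(2)[OF \<psi>] in auto)
qed

theorem lemma3p10:
  fixes M :: "'a measure"
    and B W :: "real \<Rightarrow> 'a \<Rightarrow> real"
    and H T :: real
    and f g g' gB gB' gW gW' h :: "real \<Rightarrow> real"
  assumes "prob_space M"
    and "0 < H" "H < 1/2" "0 < T"
    and "fractional_brownian_motion M {0..T} H B" "continuous_paths M {0..T} B"
    and "wiener_process M {0..T} W"
    and "independent_processes M {0..T} B W"
    and "f \<in> borel_measurable (lebesgue_on {0..T})" "\<forall>t\<in>{0..T}. 0 < f t"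
    and "AC0_with_L2_derivative T g g'"
    and "L2_on T gB'"
    and "AE t in lebesgue_on {0..T}. g' t - gB' t = KT_star H T (K0_star H gB') t"
    and "AC0_with_L2_derivative T gB gB'"
    and "\<forall>t\<in>{0..T}. gW t = g t - gB t"
    and "AC0_with_L2_derivative T gW gW'"
    and "AE t in lebesgue_on {0..T}. h t = K0_star H gB' t"
  shows "\<exists>C c :: nat \<Rightarrow> real. c \<longlonglongrightarrow> 0 \<and>
    (\<forall>\<epsilon>>0. \<forall>n\<ge>1.
      small_ball_prob M B W f T g \<epsilon>
        \<le> exp (- (1/2) * (\<integral>t. ((gW' t)\<^sup>2 + (h t)\<^sup>2) \<partial>lebesgue_on {0..T}))
            * small_ball_prob M B W f T (\<lambda>_. 0) \<epsilon>
          + small_ball_prob M B W f T (\<lambda>_. 0) \<epsilon> * (exp (\<epsilon> * C n + c n) - 1))"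
proof -
  note H = \<open>0 < H\<close> \<open>H < 1/2\<close> and T = \<open>0 < T\<close>
  define a where "a = 1/2 - H"
  have a: "0 < a" "a < 1/2" and aH: "1/2 - a = H" using H by (auto simp: a_def)
  interpret prob_space M by fact
  obtain C where "schur_kernel (frac_kernel a T) C" using schur_frac_kernel[OF a T] by blast
  then interpret K: schur_kernel "frac_kernel a T" C .
  interpret K': schur_kernel "\<lambda>t u. frac_kernel a T u t" C by (rule K.transpose)
  have ggL: "L2_on T g'" "L2_on T gW'" and g_int: "\<And>t. t \<in> {0..T} \<Longrightarrow> g t = (LINT s|lebesgue_on {0..t}. g' s)"
    and gB_int: "\<And>t. t \<in> {0..T} \<Longrightarrow> gB t = (LINT s|lebesgue_on {0..t}. gB' s)"
    and gW_int: "\<And>t. t \<in> {0..T} \<Longrightarrow> gW t = (LINT s|lebesgue_on {0..t}. gW' s)"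
    using assms(11,14,16) by (auto simp: AC0_with_L2_derivative_def)
  have meas: "\<phi> \<in> borel_measurable (lebesgue_on {0..T})" if "L2_on T \<phi>" for \<phi> using that by (simp add: L2_on_def)
  \<comment> \<open>\<open>b\<close> and \<open>v\<close> are Borel versions of \<open>gB'\<close>
    and \<open>gW'\<close>; \<open>k\<close> and \<open>w\<close>, computed from \<open>b\<close>,
    will be those of \<open>h\<close> and of its image under \<open>KT_star\<close>.\<close>
  obtain b where b: "b \<in> borel_measurable borel" "integrable lborel (\<lambda>t. (b t)\<^sup>2)" "\<And>t. t \<notin> {0<..T} \<Longrightarrow> b t = 0"
    "AE t in lebesgue_on {0..T}. gB' t = b t" by (rule L2_on_borel_version[OF assms(12)]) blast
  obtain v where v: "v \<in> borel_measurable borel" "integrable lborel (\<lambda>t. (v t)\<^sup>2)" "\<And>t. t \<notin> {0<..T} \<Longrightarrow> v t = 0"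
    "AE t in lebesgue_on {0..T}. gW' t = v t" by (rule L2_on_borel_version[OF ggL(2)]) blast
  define k where "k = K'.op b"
  define w where "w = K.op k"
  have km: "k \<in> borel_measurable borel" and ki: "integrable lborel (\<lambda>t. (k t)\<^sup>2)"
    unfolding k_def by (rule K'.op_measurable[OF b(1)], rule K'.op_square[OF b(1,2)])
  have wm: "w \<in> borel_measurable borel" and wi: "integrable lborel (\<lambda>t. (w t)\<^sup>2)"
    unfolding w_def by (rule K.op_measurable[OF km], rule K.op_square[OF km ki])
  have ksupp: "k u = 0" and wsupp: "w u = 0" if "u \<notin> {0<..T}" for u
    unfolding w_def k_def K.op_def K'.op_def using that by (auto simp: frac_kernel_def intro!: integral_eq_zero_AE)
  have K0: "K0_star H gB' t = k t" if "0 < t" "t \<le> T" for t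
    unfolding k_def K'.op_def unfolding a_def by (rule K0_star_eq_op[OF H meas[OF assms(12)] b(1,4) that])
  have K0ae: "AE t in lebesgue_on {0..T}. K0_star H gB' t = k t"
    using AE_lebesgue_on_nonzero AE_space by eventually_elim (use K0 in auto)
  have K0m: "K0_star H gB' \<in> borel_measurable (lebesgue_on {0..T})"
  proof -
    \<comment> \<open>By \<open>0 powr _ = 0\<close> the values agree at 0 too, which gives
      measurability on the closed interval.\<close>
    have "K0_star H gB' 0 = 0" by (simp add: K0_star_def)
    then have "K0_star H gB' t = k t" if "t \<in> {0..T}" for t
      using K0[of t] ksupp[of 0] that by (cases "t = 0") auto
    then show ?thesis using borel_lebesgue_on[OF km, of "{0..T}"] by (subst measurable_cong[where g=k]) auto
  qed
  have KT: "KT_star H T (K0_star H gB') t = w t" if "0 < t" "t \<le> T" for t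
    unfolding w_def K.op_def unfolding a_def by (rule KT_star_eq_op[OF H K0m km K0ae that])
  have g'ae: "AE t in lebesgue_on {0..T}. g' t = w t + b t"
    using assms(13) b(4) AE_lebesgue_on_nonzero AE_space
  proof eventually_elim
    case (elim t)
    then show ?case using KT[of t] by auto
  qed
  have int1: "integrable lborel \<phi>" if "\<phi> \<in> borel_measurable borel" "integrable lborel (\<lambda>t. (\<phi> t)\<^sup>2)" "\<And>t. t \<notin> {0<..T} \<Longrightarrow> \<phi> t = 0" for \<phi> :: "real \<Rightarrow> real"
  proof -
    have I: "integrable lborel (indicator {0<..T} :: real \<Rightarrow> real)" using T by (auto intro!: integrable_real_indicator)
    moreover have "(\<lambda>s. (indicator {0<..T} s :: real)\<^sup>2) = indicator {0<..T}" by (auto simp: indicator_def)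
    ultimately have "integrable lborel (\<lambda>s. indicator {0<..T} s * \<phi> s)"
      using that by (intro integrable_mult_of_squares) auto
    moreover have "indicator {0<..T} s * \<phi> s = \<phi> s" for s using that(3) by (auto simp: indicator_def)
    ultimately show ?thesis by simp
  qed
  have wbm: "(\<lambda>t. w t + b t) \<in> borel_measurable borel" using wm b(1) by measurable
  have bi1: "integrable lborel b" and wi1: "integrable lborel w" and vi1: "integrable lborel v"
    using int1 b wm wi wsupp v by blast+
  have ver: "(LINT s|lebesgue_on {0..t}. \<phi> s) = (LINT s|lborel. indicator {0..t} s * \<psi> s)"
    if "\<phi> \<in> borel_measurable (lebesgue_on {0..T})" "\<psi> \<in> borel_measurable borel" "AE t in lebesgue_on {0..T}. \<phi> t = \<psi> t" "t \<in> {0..T}" for \<phi> \<psi> :: "real \<Rightarrow> real" and t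
    using integral_lebesgue_on_version[OF that(1,2,3), of "{0..t}" "\<lambda>_. 1"] that(4) by simp
  have g1: "g t = (LINT s|lborel. indicator {0..t} s * (w s + b s))" if "t \<in> {0..T}" for t
    using g_int[OF that] ver[OF meas[OF ggL(1)] wbm g'ae that] by simp
  have gcont: "continuous_on {0..T} g"
    by (rule continuous_on_indefinite_integral[OF _ g1]) (use bi1 wi1 in simp)
  \<comment> \<open>The point 0 may be left out of the integral because \<open>w\<close> and
    \<open>b\<close> vanish there.\<close>
  have g2: "g t = (LINT s|lborel. indicator {s. 0 < s \<and> s \<le> t} s * (w s + b s))" if "t \<in> {0..T}" for t
    unfolding g1[OF that] by (intro Bochner_Integration.integral_cong refl) (use wsupp[of 0] b(3)[of 0] in \<open>auto simp: indicator_def order_le_less\<close>)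
  \<comment> \<open>\<open>gW'\<close> is given only as a derivative of \<open>g - gB\<close>;
    comparing primitives identifies it with the image of \<open>h\<close> under
    \<open>KT_star\<close>.\<close>
  have vw: "AE t in lborel. v t - w t = 0"
  proof (rule L2_zero_of_integrals_zero[OF T])
    show "(\<lambda>t. v t - w t) \<in> borel_measurable borel" using v(1) wm by measurable
    have "integrable lborel (\<lambda>t. (v t)\<^sup>2 + (w t)\<^sup>2 - 2 * (v t * w t))"
      using v(1,2) wm wi by (intro Bochner_Integration.integrable_diff Bochner_Integration.integrable_add integrable_mult_right integrable_mult_of_squares) auto
    then show "integrable lborel (\<lambda>t. (v t - w t)\<^sup>2)" by (simp add: power2_diff mult.assoc)
    show "v u - w u = 0" if "u \<notin> {0<..T}" for u using that v(3) wsupp by simp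
    fix t assume "t \<in> {0<..T}"
    then have t: "t \<in> {0..T}" by auto
    have ind: "integrable lborel (\<lambda>s. indicator {0..t} s * \<phi> s)" if "integrable lborel \<phi>" for \<phi> :: "real \<Rightarrow> real"
      using integrable_mult_indicator[OF _ that, of "{0..t}"] by simp
    have "(LINT s|lborel. indicator {0..t} s * v s) = gW t" using gW_int[OF t] ver[OF meas[OF ggL(2)] v(1,4) t] by simp
    moreover have "gB t = (LINT s|lborel. indicator {0..t} s * b s)" using gB_int[OF t] ver[OF meas[OF assms(12)] b(1,4) t] by simp
    moreover have "g t = (LINT s|lborel. indicator {0..t} s * w s) + (LINT s|lborel. indicator {0..t} s * b s)"
      unfolding g1[OF t] distrib_left by (rule Bochner_Integration.integral_add[OF ind[OF wi1] ind[OF bi1]])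
    moreover have "(LINT s|lborel. indicator {0..t} s * (v s - w s)) = (LINT s|lborel. indicator {0..t} s * v s) - (LINT s|lborel. indicator {0..t} s * w s)"
      unfolding right_diff_distrib by (rule Bochner_Integration.integral_diff[OF ind[OF vi1] ind[OF wi1]])
    ultimately show "(LINT s|lborel. indicator {0..t} s * (v s - w s)) = 0" using assms(15) t by simp
  qed
  define E where "E = (\<integral>t. ((gW' t)\<^sup>2 + (h t)\<^sup>2) \<partial>lebesgue_on {0..T})"
  have E: "E = (LINT t|lborel. (w t)\<^sup>2) + (LINT t|lborel. (k t)\<^sup>2)"
  proof -
    have "AE t in lebesgue. v t - w t = 0" using vw by (rule AE_completion)
    then have "AE t in lebesgue_on {0..T}. v t - w t = 0" by (subst AE_restrict_space_iff) (auto elim: eventually_mono)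
    then have ae: "AE t in lebesgue_on {0..T}. gW' t = w t" "AE t in lebesgue_on {0..T}. h t = k t"
      using v(4) assms(17) K0ae by (eventually_elim, simp)+
    have E1: "E = (LINT t|lebesgue_on {0..T}. (w t)\<^sup>2 + (k t)\<^sup>2)"
      unfolding E_def
    proof (rule integral_cong_AE)
      \<comment> \<open>Measurability of \<open>h\<close> comes from its almost everywhere equality
        with the Borel function \<open>k\<close>, Lebesgue measure being complete.\<close>
      have "AE t in lebesgue. t \<in> {0..T} \<longrightarrow> h t = k t" using ae(2) by (subst (asm) AE_restrict_space_iff) auto
      then have "AE t in lebesgue. k t = indicator {0..T} t *\<^sub>R h t"
        by eventually_elim (use ksupp in \<open>auto simp: indicator_def\<close>)
      then have "(\<lambda>t. indicator {0..T} t *\<^sub>R h t) \<in> borel_measurable lebesgue"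
        by (rule borel_measurable_AE[rotated]) (use km in \<open>auto intro: measurable_completion\<close>)
      then have hm: "h \<in> borel_measurable (lebesgue_on {0..T})"
        by (subst borel_measurable_restrict_space_iff) auto
      show "(\<lambda>t. (gW' t)\<^sup>2 + (h t)\<^sup>2) \<in> borel_measurable (lebesgue_on {0..T})"
        using hm meas[OF ggL(2)] by measurable
      show "(\<lambda>t. (w t)\<^sup>2 + (k t)\<^sup>2) \<in> borel_measurable (lebesgue_on {0..T})"
        using borel_lebesgue_on[OF wm] borel_lebesgue_on[OF km] by measurable
      show "AE t in lebesgue_on {0..T}. (gW' t)\<^sup>2 + (h t)\<^sup>2 = (w t)\<^sup>2 + (k t)\<^sup>2"
        using ae by eventually_elim simp
    qed
    also have "\<dots> = (LINT t|lborel. indicator {0..T} t * ((w t)\<^sup>2 + (k t)\<^sup>2))"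
      using wm km by (intro lebesgue_on_integral_borel) auto
    also have "\<dots> = (LINT t|lborel. (w t)\<^sup>2 + (k t)\<^sup>2)"
      by (intro Bochner_Integration.integral_cong refl) (use wsupp ksupp in \<open>auto simp: indicator_def\<close>)
    finally show ?thesis using wi ki by simp
  qed
  define Q where "Q n F a' \<longleftrightarrow> finite F \<and> F \<subseteq> {0..T} \<and>
    (\<Sum>t\<in>F. a' t * g t) - (\<Sum>s\<in>F. \<Sum>t\<in>F. a' s * a' t * mixed_cov H s t) / 2 \<ge> E / 2 - 1 / real (Suc n)"
    for n and F :: "real set" and a' :: "real \<Rightarrow> real"
  have "\<exists>F a'. Q n F a'" for n
    using functional_approximation[OF a T b(1,2,3) gcont, folded k_def w_def, OF _ g2, of "1 / real (Suc n)"]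
    unfolding aH E Q_def by simp
  then obtain F a' where "\<And>n. Q n (F n) (a' n)" by metis
  then have F: "\<And>n. finite (F n)" "\<And>n. F n \<subseteq> {0..T}"
    "\<And>n. (\<Sum>t\<in>F n. a' n t * g t) - (\<Sum>s\<in>F n. \<Sum>t\<in>F n. a' n s * a' n t * mixed_cov H s t) / 2 \<ge> E / 2 - 1 / real (Suc n)"
    by (simp_all add: Q_def)
  \<comment> \<open>The sum is finite for every positive \<open>f\<close>, with no bound in
    \<open>n\<close> claimed; the precision demanded of the functional with index \<open>n\<close>
    becomes \<open>cn n\<close>.\<close>
  define Cn where "Cn n = (\<Sum>t\<in>F n. \<bar>a' n t\<bar> * f t)" for n
  define cn where "cn n = 1 / real (Suc n)" for n
  have "cn \<longlonglongrightarrow> 0" unfolding cn_def by real_asymp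
  moreover have "small_ball_prob M B W f T g \<epsilon> \<le> exp (- (1/2) * E) * small_ball_prob M B W f T (\<lambda>_. 0) \<epsilon>
      + small_ball_prob M B W f T (\<lambda>_. 0) \<epsilon> * (exp (\<epsilon> * Cn n + cn n) - 1)" if \<epsilon>: "\<epsilon> > 0" for \<epsilon> n
  proof -
    let ?P = "small_ball_prob M B W f T (\<lambda>_. 0) \<epsilon>"
    have P: "?P \<ge> 0" by (simp add: small_ball_prob_def)
    have "Cn n \<ge> 0" unfolding Cn_def using F(2)[of n] assms(10) by (intro sum_nonneg mult_nonneg_nonneg) (auto intro: less_imp_le)
    then have x: "\<epsilon> * Cn n + cn n \<ge> 0" using \<epsilon> by (simp add: cn_def)
    have E0: "E \<ge> 0" unfolding E by simp
    have "small_ball_prob M B W f T g \<epsilon> \<le> exp (\<epsilon> * Cn n - ((\<Sum>t\<in>F n. a' n t * g t) - (\<Sum>s\<in>F n. \<Sum>t\<in>F n. a' n s * a' n t * mixed_cov H s t) / 2)) * ?P"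
      unfolding Cn_def by (rule small_ball_prob_shift[OF assms(5-8) F(1,2) _ gcont]) (use T in simp)
    also have "\<dots> \<le> exp (- (1/2) * E + (\<epsilon> * Cn n + cn n)) * ?P"
      using F(3)[of n] P by (intro mult_right_mono) (auto simp: cn_def)
    also have "\<dots> = exp (- (1/2) * E) * exp (\<epsilon> * Cn n + cn n) * ?P" by (simp only: exp_add)
    also have "\<dots> \<le> (exp (- (1/2) * E) + (exp (\<epsilon> * Cn n + cn n) - 1)) * ?P"
    proof (rule mult_right_mono[OF _ P])
      \<comment> \<open>For p <= 1 <= q one has p q <= p + q - 1, which turns the product bound into
        the additive one.\<close>
      have "0 \<le> (1 - exp (- (1/2) * E)) * (exp (\<epsilon> * Cn n + cn n) - 1)"
        using x E0 by (intro mult_nonneg_nonneg) auto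
      then show "exp (- (1/2) * E) * exp (\<epsilon> * Cn n + cn n) \<le> exp (- (1/2) * E) + (exp (\<epsilon> * Cn n + cn n) - 1)"
        by (simp add: algebra_simps)
    qed
    finally show ?thesis by (simp add: algebra_simps)
  qed
  ultimately show ?thesis unfolding E_def by blast
qed

end
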